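(* Let $(\mathcal{M},\otimes,\mathbf{1},\sigma)$ be an abelian symmetric monoidal category that satisfies the faithful coflatness condition and the faithful flatness condition. Then regular epimorphisms in $\mathsf{Hopf}_{\mathrm{coc}}(\mathcal{M})$ (equivalently, cokernels in $\mathsf{Hopf}_{\mathrm{coc}}(\mathcal{M})$) are stable under pullbacks.
   Context: Associativity and unit constraints are suppressed. An abelian symmetric monoidal category is a symmetric monoidal category $(\mathcal{M},\otimes,\mathbf{1},\sigma)$ such that $\mathcal{M}$ is abelian and, for every object $M$, the functors $M\otimes(-)$ and $(-)\otimes M$ are additive and exact. $\mathsf{Hopf}_{\mathrm{coc}}(\mathcal{M})$ is the category of Hopf monoids $(A,m_A,u_A,\Delta_A,\varepsilon_A,S_A)$ in $\mathcal{M}$ with $\sigma_{A,A}\Delta_A=\Delta_A$ and Hopf monoid morphisms; it is pointed with zero object $\mathbf{1}$ and finitely complete. $\mathsf{Comon}_{\mathrm{coc}}({}_A\mathcal{M})$, for $A$ in $\mathsf{Hopf}_{\mathrm{coc}}(\mathcal{M})$: objects are cocommutative comonoids $Q$ in $\mathcal{M}$ with a left $A$-action $\mu_Q$ such that $\Delta_Q,\varepsilon_Q$ are left $A$-linear, where $Q\otimes Q$ has action $(\mu_Q\otimes\mu_Q)(\mathrm{Id}_A\otimes\sigma_{A,Q}\otimes\mathrm{Id}_Q)(\Delta_A\otimes\mathrm{Id}_{Q\otimes Q})$ and $\mathbf{1}$ has action $\varepsilon_A$; morphisms are left $A$-linear comonoid morphisms; $A$ is an object of it via $m_A$. For a right $Q$-comodule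 $(V,\rho_V)$ and a left $Q$-comodule $(W,\lambda_W)$, $V\square_Q W$ is the equalizer in $\mathcal{M}$ of $\rho_V\otimes\mathrm{Id}_W,\ \mathrm{Id}_V\otimes\lambda_W: V\otimes W\to V\otimes Q\otimes W$. For a monoid $K$, a right $K$-module $(M,\nu_M)$ and a left $K$-module $(X,\mu_X)$, $M\otimes_K X$ is the coequalizer in $\mathcal{M}$ of $\nu_M\otimes\mathrm{Id}_X,\ \mathrm{Id}_M\otimes\mu_X:M\otimes K\otimes X\to M\otimes X$. These give functors $(-)\square_Q W:\mathcal{M}^Q\to\mathcal{M}$ (from right $Q$-comodules) and $(-)\otimes_K X:\mathcal{M}_K\to\mathcal{M}$ (from right $K$-modules). Faithful coflatness condition: for any $A$ in $\mathsf{Hopf}_{\mathrm{coc}}(\mathcal{M})$ and any morphism $\pi:A\to Q$ in $\mathsf{Comon}_{\mathrm{coc}}({}_A\mathcal{M})$ which is an epimorphism in $\mathcal{M}$, the functor $(-)\square_Q A$ preserves and reflects epimorphisms, where $A$ is a left $Q$-comodule via $(\pi\otimes\mathrm{Id}_A)\Delta_A$. Faithful flatness condition: for any $A$ in $\mathsf{Hopf}_{\mathrm{coc}}(\mathcal{M})$ and any morphism $i:K\to A$ in $\mathsf{Hopf}_{\mathrm{coc}}(\mathcal{M})$ which is a monomorphism in $\mathcal{M}$, the functor $(-)\otimes_K A$ preserves and reflects monomorphisms, where $A$ is a left $K$-module via $m_A(i\otimes\mathrm{Id}_A)$. *)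

theory Defs
  imports "HOL-Algebra.Group"
begin

no_notation monoid.mult (infixl "\<otimes>\<index>" 70)

section \<open>Categories\<close>

record ('o, 'm) cat =
  Obj :: "'o set"
  Arr :: "'m set"
  Dom :: "'m \<Rightarrow> 'o"
  Cod :: "'m \<Rightarrow> 'o"
  Id :: "'o \<Rightarrow> 'm"
  Comp :: "'m \<Rightarrow> 'm \<Rightarrow> 'm" (infixr "\<cdot>\<index>" 55)

definition hset :: "('o, 'm, 'z) cat_scheme \<Rightarrow> 'o \<Rightarrow> 'o \<Rightarrow> 'm set" where
  "hset C a b = {f \<in> Arr C. Dom C f = a \<and> Cod C f = b}"

locale category =
  fixes C :: "('o, 'm, 'z) cat_scheme" (structure)
  assumes dom_in_Obj: "f \<in> Arr C \<Longrightarrow> Dom C f \<in> Obj C"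
    and cod_in_Obj: "f \<in> Arr C \<Longrightarrow> Cod C f \<in> Obj C"
    and id_in_hset: "a \<in> Obj C \<Longrightarrow> Id C a \<in> hset C a a"
    and comp_in_hset: "f \<in> hset C a b \<Longrightarrow> g \<in> hset C b c \<Longrightarrow> g \<cdot> f \<in> hset C a c"
    and comp_id: "f \<in> hset C a b \<Longrightarrow> f \<cdot> Id C a = f"
    and id_comp: "f \<in> hset C a b \<Longrightarrow> Id C b \<cdot> f = f"
    and comp_assoc: "f \<in> hset C a b \<Longrightarrow> g \<in> hset C b c \<Longrightarrow> h \<in> hset C c d \<Longrightarrow>
      (h \<cdot> g) \<cdot> f = h \<cdot> (g \<cdot> f)"

definition mono_arr :: "('o, 'm, 'z) cat_scheme \<Rightarrow> 'm \<Rightarrow> bool" where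
  "mono_arr C f \<longleftrightarrow> f \<in> Arr C \<and>
    (\<forall>a. \<forall>g \<in> hset C a (Dom C f). \<forall>h \<in> hset C a (Dom C f). f \<cdot> g = f \<cdot> h \<longrightarrow> g = h)"
  for C (structure)

definition epi_arr :: "('o, 'm, 'z) cat_scheme \<Rightarrow> 'm \<Rightarrow> bool" where
  "epi_arr C f \<longleftrightarrow> f \<in> Arr C \<and>
    (\<forall>c. \<forall>g \<in> hset C (Cod C f) c. \<forall>h \<in> hset C (Cod C f) c. g \<cdot> f = h \<cdot> f \<longrightarrow> g = h)"
  for C (structure)

definition inverse_arrs :: "('o, 'm, 'z) cat_scheme \<Rightarrow> 'm \<Rightarrow> 'm \<Rightarrow> bool" where
  "inverse_arrs C f g \<longleftrightarrow> f \<in> Arr C \<and> g \<in> hset C (Cod C f) (Dom C f) \<and>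
    g \<cdot> f = Id C (Dom C f) \<and> f \<cdot> g = Id C (Cod C f)"
  for C (structure)

definition iso_arr :: "('o, 'm, 'z) cat_scheme \<Rightarrow> 'm \<Rightarrow> bool" where
  "iso_arr C f \<longleftrightarrow> (\<exists>g. inverse_arrs C f g)"

definition inv_arr :: "('o, 'm, 'z) cat_scheme \<Rightarrow> 'm \<Rightarrow> 'm" where
  "inv_arr C f = (THE g. inverse_arrs C f g)"

definition is_equalizer :: "('o, 'm, 'z) cat_scheme \<Rightarrow> 'm \<Rightarrow> 'm \<Rightarrow> 'm \<Rightarrow> bool" where
  "is_equalizer C f g e \<longleftrightarrow>
    f \<in> Arr C \<and> g \<in> hset C (Dom C f) (Cod C f) \<and>
    e \<in> Arr C \<and> Cod C e = Dom C f \<and> f \<cdot> e = g \<cdot> e \<and>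
    (\<forall>x. \<forall>h \<in> hset C x (Dom C f). f \<cdot> h = g \<cdot> h \<longrightarrow>
      (\<exists>!k. k \<in> hset C x (Dom C e) \<and> e \<cdot> k = h))"
  for C (structure)

definition is_coequalizer :: "('o, 'm, 'z) cat_scheme \<Rightarrow> 'm \<Rightarrow> 'm \<Rightarrow> 'm \<Rightarrow> bool" where
  "is_coequalizer C f g q \<longleftrightarrow>
    f \<in> Arr C \<and> g \<in> hset C (Dom C f) (Cod C f) \<and>
    q \<in> Arr C \<and> Dom C q = Cod C f \<and> q \<cdot> f = q \<cdot> g \<and>
    (\<forall>x. \<forall>h \<in> hset C (Cod C f) x. h \<cdot> f = h \<cdot> g \<longrightarrow>
      (\<exists>!k. k \<in> hset C (Cod C q) x \<and> k \<cdot> q = h))"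
  for C (structure)

definition regular_epi :: "('o, 'm, 'z) cat_scheme \<Rightarrow> 'm \<Rightarrow> bool" where
  "regular_epi C q \<longleftrightarrow> (\<exists>f g. is_coequalizer C f g q)"

definition is_pullback :: "('o, 'm, 'z) cat_scheme \<Rightarrow> 'm \<Rightarrow> 'm \<Rightarrow> 'm \<Rightarrow> 'm \<Rightarrow> bool" where
  "is_pullback C f g p q \<longleftrightarrow>
    f \<in> Arr C \<and> g \<in> Arr C \<and> Cod C f = Cod C g \<and>
    p \<in> Arr C \<and> q \<in> Arr C \<and> Dom C p = Dom C q \<and> Cod C p = Dom C f \<and> Cod C q = Dom C g \<and>
    f \<cdot> p = g \<cdot> q \<and>
    (\<forall>x. \<forall>h \<in> hset C x (Dom C f). \<forall>k \<in> hset C x (Dom C g). f \<cdot> h = g \<cdot> k \<longrightarrow>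
      (\<exists>!l. l \<in> hset C x (Dom C p) \<and> p \<cdot> l = h \<and> q \<cdot> l = k))"
  for C (structure)

definition stable_under_pullbacks :: "('o, 'm, 'z) cat_scheme \<Rightarrow> ('m \<Rightarrow> bool) \<Rightarrow> bool" where
  "stable_under_pullbacks C P \<longleftrightarrow> (\<forall>f g p q. P f \<and> is_pullback C f g p q \<longrightarrow> P q)"

definition zero_obj :: "('o, 'm, 'z) cat_scheme \<Rightarrow> 'o \<Rightarrow> bool" where
  "zero_obj C z \<longleftrightarrow> z \<in> Obj C \<and>
    (\<forall>a \<in> Obj C. (\<exists>!f. f \<in> hset C a z) \<and> (\<exists>!f. f \<in> hset C z a))"

definition is_zero_arr :: "('o, 'm, 'z) cat_scheme \<Rightarrow> 'm \<Rightarrow> bool" where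
  "is_zero_arr C f \<longleftrightarrow> f \<in> Arr C \<and>
    (\<exists>z. zero_obj C z \<and> (\<exists>s \<in> hset C (Dom C f) z. \<exists>t \<in> hset C z (Cod C f). f = t \<cdot> s))"
  for C (structure)

definition is_kernel :: "('o, 'm, 'z) cat_scheme \<Rightarrow> 'm \<Rightarrow> 'm \<Rightarrow> bool" where
  "is_kernel C f k \<longleftrightarrow>
    f \<in> Arr C \<and> k \<in> Arr C \<and> Cod C k = Dom C f \<and> is_zero_arr C (f \<cdot> k) \<and>
    (\<forall>x. \<forall>h \<in> hset C x (Dom C f). is_zero_arr C (f \<cdot> h) \<longrightarrow>
      (\<exists>!l. l \<in> hset C x (Dom C k) \<and> k \<cdot> l = h))"
  for C (structure)

definition is_cokernel :: "('o, 'm, 'z) cat_scheme \<Rightarrow> 'm \<Rightarrow> 'm \<Rightarrow> bool" where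
  "is_cokernel C f q \<longleftrightarrow>
    f \<in> Arr C \<and> q \<in> Arr C \<and> Dom C q = Cod C f \<and> is_zero_arr C (q \<cdot> f) \<and>
    (\<forall>x. \<forall>h \<in> hset C (Cod C f) x. is_zero_arr C (h \<cdot> f) \<longrightarrow>
      (\<exists>!l. l \<in> hset C (Cod C q) x \<and> l \<cdot> q = h))"
  for C (structure)

definition some_kernel :: "('o, 'm, 'z) cat_scheme \<Rightarrow> 'm \<Rightarrow> bool" where
  "some_kernel C k \<longleftrightarrow> (\<exists>f. is_kernel C f k)"

definition some_cokernel :: "('o, 'm, 'z) cat_scheme \<Rightarrow> 'm \<Rightarrow> bool" where
  "some_cokernel C q \<longleftrightarrow> (\<exists>f. is_cokernel C f q)"

definition short_exact :: "('o, 'm, 'z) cat_scheme \<Rightarrow> 'm \<Rightarrow> 'm \<Rightarrow> bool" where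
  "short_exact C f g \<longleftrightarrow> is_kernel C g f \<and> is_cokernel C f g"

text \<open>
  In the following definitions a functor is given by its action \<open>F\<close> on arrows.
\<close>

definition exact_functor ::
  "('o, 'm, 'z) cat_scheme \<Rightarrow> ('p, 'n, 'y) cat_scheme \<Rightarrow> ('m \<Rightarrow> 'n) \<Rightarrow> bool" where
  "exact_functor C D F \<longleftrightarrow> (\<forall>f g. short_exact C f g \<longrightarrow> short_exact D (F f) (F g))"

definition preserves_epis ::
  "('o, 'm, 'z) cat_scheme \<Rightarrow> ('p, 'n, 'y) cat_scheme \<Rightarrow> ('m \<Rightarrow> 'n) \<Rightarrow> bool" where
  "preserves_epis C D F \<longleftrightarrow> (\<forall>f \<in> Arr C. epi_arr C f \<longrightarrow> epi_arr D (F f))"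

definition reflects_epis ::
  "('o, 'm, 'z) cat_scheme \<Rightarrow> ('p, 'n, 'y) cat_scheme \<Rightarrow> ('m \<Rightarrow> 'n) \<Rightarrow> bool" where
  "reflects_epis C D F \<longleftrightarrow> (\<forall>f \<in> Arr C. epi_arr D (F f) \<longrightarrow> epi_arr C f)"

definition preserves_monos ::
  "('o, 'm, 'z) cat_scheme \<Rightarrow> ('p, 'n, 'y) cat_scheme \<Rightarrow> ('m \<Rightarrow> 'n) \<Rightarrow> bool" where
  "preserves_monos C D F \<longleftrightarrow> (\<forall>f \<in> Arr C. mono_arr C f \<longrightarrow> mono_arr D (F f))"

definition reflects_monos ::
  "('o, 'm, 'z) cat_scheme \<Rightarrow> ('p, 'n, 'y) cat_scheme \<Rightarrow> ('m \<Rightarrow> 'n) \<Rightarrow> bool" where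
  "reflects_monos C D F \<longleftrightarrow> (\<forall>f \<in> Arr C. mono_arr D (F f) \<longrightarrow> mono_arr C f)"

text \<open>
  The category of structured objects over \<open>C\<close>: \<open>Ob\<close> is the set of structured objects, \<open>U\<close> gives
  the underlying object of \<open>C\<close>, and \<open>P X Y f\<close> says that \<open>f\<close> respects the structures. An arrow is
  stored as \<open>(X, f, Y)\<close>, since \<open>f\<close> alone does not determine the structures on its ends.
\<close>

definition struct_cat ::
  "('o, 'm, 'z) cat_scheme \<Rightarrow> 'x set \<Rightarrow> ('x \<Rightarrow> 'o) \<Rightarrow> ('x \<Rightarrow> 'x \<Rightarrow> 'm \<Rightarrow> bool) \<Rightarrow>
    ('x, 'x \<times> 'm \<times> 'x) cat" where
  "struct_cat C Ob U P =
    \<lparr>Obj = Ob,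
     Arr = {(X, f, Y). X \<in> Ob \<and> Y \<in> Ob \<and> f \<in> hset C (U X) (U Y) \<and> P X Y f},
     Dom = (\<lambda>(X, f, Y). X),
     Cod = (\<lambda>(X, f, Y). Y),
     Id = (\<lambda>X. (X, Id C (U X), X)),
     Comp = (\<lambda>(Y', g, Z) (X, f, Y). (X, g \<cdot> f, Z))\<rparr>"
  for C (structure)

abbreviation underlying :: "'x \<times> 'm \<times> 'x \<Rightarrow> 'm" where
  "underlying F \<equiv> fst (snd F)"


section \<open>Abelian symmetric monoidal categories\<close>

record ('o, 'm) add_cat = "('o, 'm) cat" +
  zero_arr :: "'o \<Rightarrow> 'o \<Rightarrow> 'm"
  add_arr :: "'m \<Rightarrow> 'm \<Rightarrow> 'm" (infixl "+\<^sub>m\<index>" 65)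

definition hom_group :: "('o, 'm, 'z) add_cat_scheme \<Rightarrow> 'o \<Rightarrow> 'o \<Rightarrow> 'm monoid" where
  "hom_group C a b = \<lparr>carrier = hset C a b, mult = add_arr C, one = zero_arr C a b\<rparr>"

locale preadditive_category = category C
  for C :: "('o, 'm, 'z) add_cat_scheme" (structure) +
  assumes hom_comm_group: "a \<in> Obj C \<Longrightarrow> b \<in> Obj C \<Longrightarrow> comm_group (hom_group C a b)"
    and comp_add: "f \<in> hset C a b \<Longrightarrow> g \<in> hset C b c \<Longrightarrow> h \<in> hset C b c \<Longrightarrow>
      (g +\<^sub>m h) \<cdot> f = (g \<cdot> f) +\<^sub>m (h \<cdot> f)"
    and add_comp: "f \<in> hset C a b \<Longrightarrow> g \<in> hset C a b \<Longrightarrow> h \<in> hset C b c \<Longrightarrow>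
      h \<cdot> (f +\<^sub>m g) = (h \<cdot> f) +\<^sub>m (h \<cdot> g)"

definition is_biproduct ::
  "('o, 'm, 'z) add_cat_scheme \<Rightarrow> 'o \<Rightarrow> 'o \<Rightarrow> 'o \<Rightarrow> 'm \<Rightarrow> 'm \<Rightarrow> 'm \<Rightarrow> 'm \<Rightarrow> bool" where
  "is_biproduct C a b c i j p q \<longleftrightarrow>
    c \<in> Obj C \<and> i \<in> hset C a c \<and> j \<in> hset C b c \<and> p \<in> hset C c a \<and> q \<in> hset C c b \<and>
    p \<cdot> i = Id C a \<and> q \<cdot> j = Id C b \<and>
    p \<cdot> j = zero_arr C b a \<and> q \<cdot> i = zero_arr C a b \<and>
    (i \<cdot> p) +\<^sub>m (j \<cdot> q) = Id C c"
  for C (structure)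

locale abelian_category = preadditive_category C
  for C :: "('o, 'm, 'z) add_cat_scheme" (structure) +
  assumes ex_zero_obj: "\<exists>z. zero_obj C z"
    and ex_biproduct: "a \<in> Obj C \<Longrightarrow> b \<in> Obj C \<Longrightarrow> \<exists>c i j p q. is_biproduct C a b c i j p q"
    and ex_kernel: "f \<in> Arr C \<Longrightarrow> \<exists>k. is_kernel C f k"
    and ex_cokernel: "f \<in> Arr C \<Longrightarrow> \<exists>q. is_cokernel C f q"
    and mono_is_kernel: "mono_arr C f \<Longrightarrow> some_kernel C f"
    and epi_is_cokernel: "epi_arr C f \<Longrightarrow> some_cokernel C f"

definition additive_functor ::
  "('o, 'm, 'z) add_cat_scheme \<Rightarrow> ('p, 'n, 'y) add_cat_scheme \<Rightarrow> ('m \<Rightarrow> 'n) \<Rightarrow> bool" where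
  "additive_functor C D F \<longleftrightarrow>
    (\<forall>a \<in> Obj C. \<forall>b \<in> Obj C. \<forall>f \<in> hset C a b. \<forall>g \<in> hset C a b.
      F (add_arr C f g) = add_arr D (F f) (F g))"

text \<open>
  The associator is \<open>assoc a b c : (a \<otimes> b) \<otimes> c \<rightarrow> a \<otimes> (b \<otimes> c)\<close>, the unitors are
  \<open>lunit a : \<one> \<otimes> a \<rightarrow> a\<close> and \<open>runit a : a \<otimes> \<one> \<rightarrow> a\<close>, and the symmetry is
  \<open>symm a b : a \<otimes> b \<rightarrow> b \<otimes> a\<close>.
\<close>

record ('o, 'm) smc = "('o, 'm) add_cat" +
  tensor_obj :: "'o \<Rightarrow> 'o \<Rightarrow> 'o" (infixr "\<otimes>\<index>" 70)
  tensor_arr :: "'m \<Rightarrow> 'm \<Rightarrow> 'm" (infixr "\<otimes>\<^sub>m\<index>" 70)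
  unit_obj :: "'o"
  assoc :: "'o \<Rightarrow> 'o \<Rightarrow> 'o \<Rightarrow> 'm"
  lunit :: "'o \<Rightarrow> 'm"
  runit :: "'o \<Rightarrow> 'm"
  symm :: "'o \<Rightarrow> 'o \<Rightarrow> 'm"

locale symmetric_monoidal_category = category M
  for M :: "('o, 'm, 'z) smc_scheme" (structure) +
  assumes unit_obj_in_Obj: "unit_obj M \<in> Obj M"
    and tensor_obj_in_Obj: "a \<in> Obj M \<Longrightarrow> b \<in> Obj M \<Longrightarrow> a \<otimes> b \<in> Obj M"
    and tensor_in_hset: "f \<in> hset M a b \<Longrightarrow> g \<in> hset M c d \<Longrightarrow>
      f \<otimes>\<^sub>m g \<in> hset M (a \<otimes> c) (b \<otimes> d)"
    and tensor_id: "a \<in> Obj M \<Longrightarrow> b \<in> Obj M \<Longrightarrow> Id M a \<otimes>\<^sub>m Id M b = Id M (a \<otimes> b)"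
    and tensor_comp: "f \<in> hset M a b \<Longrightarrow> f' \<in> hset M b c \<Longrightarrow> g \<in> hset M a' b' \<Longrightarrow>
      g' \<in> hset M b' c' \<Longrightarrow> (f' \<cdot> f) \<otimes>\<^sub>m (g' \<cdot> g) = (f' \<otimes>\<^sub>m g') \<cdot> (f \<otimes>\<^sub>m g)"
    and assoc_in_hset: "a \<in> Obj M \<Longrightarrow> b \<in> Obj M \<Longrightarrow> c \<in> Obj M \<Longrightarrow>
      assoc M a b c \<in> hset M ((a \<otimes> b) \<otimes> c) (a \<otimes> (b \<otimes> c))"
    and assoc_iso: "a \<in> Obj M \<Longrightarrow> b \<in> Obj M \<Longrightarrow> c \<in> Obj M \<Longrightarrow> iso_arr M (assoc M a b c)"
    and assoc_natural: "f \<in> hset M a a' \<Longrightarrow> g \<in> hset M b b' \<Longrightarrow> h \<in> hset M c c' \<Longrightarrow>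
      assoc M a' b' c' \<cdot> ((f \<otimes>\<^sub>m g) \<otimes>\<^sub>m h) = (f \<otimes>\<^sub>m (g \<otimes>\<^sub>m h)) \<cdot> assoc M a b c"
    and lunit_in_hset: "a \<in> Obj M \<Longrightarrow> lunit M a \<in> hset M (unit_obj M \<otimes> a) a"
    and lunit_iso: "a \<in> Obj M \<Longrightarrow> iso_arr M (lunit M a)"
    and lunit_natural: "f \<in> hset M a b \<Longrightarrow>
      lunit M b \<cdot> (Id M (unit_obj M) \<otimes>\<^sub>m f) = f \<cdot> lunit M a"
    and runit_in_hset: "a \<in> Obj M \<Longrightarrow> runit M a \<in> hset M (a \<otimes> unit_obj M) a"
    and runit_iso: "a \<in> Obj M \<Longrightarrow> iso_arr M (runit M a)"
    and runit_natural: "f \<in> hset M a b \<Longrightarrow>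
      runit M b \<cdot> (f \<otimes>\<^sub>m Id M (unit_obj M)) = f \<cdot> runit M a"
    and pentagon: "a \<in> Obj M \<Longrightarrow> b \<in> Obj M \<Longrightarrow> c \<in> Obj M \<Longrightarrow> d \<in> Obj M \<Longrightarrow>
      assoc M a b (c \<otimes> d) \<cdot> assoc M (a \<otimes> b) c d =
      (Id M a \<otimes>\<^sub>m assoc M b c d) \<cdot> assoc M a (b \<otimes> c) d \<cdot> (assoc M a b c \<otimes>\<^sub>m Id M d)"
    and triangle: "a \<in> Obj M \<Longrightarrow> b \<in> Obj M \<Longrightarrow>
      (Id M a \<otimes>\<^sub>m lunit M b) \<cdot> assoc M a (unit_obj M) b = runit M a \<otimes>\<^sub>m Id M b"
    and symm_in_hset: "a \<in> Obj M \<Longrightarrow> b \<in> Obj M \<Longrightarrow> symm M a b \<in> hset M (a \<otimes> b) (b \<otimes> a)"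
    and symm_natural: "f \<in> hset M a a' \<Longrightarrow> g \<in> hset M b b' \<Longrightarrow>
      symm M a' b' \<cdot> (f \<otimes>\<^sub>m g) = (g \<otimes>\<^sub>m f) \<cdot> symm M a b"
    and symm_symm: "a \<in> Obj M \<Longrightarrow> b \<in> Obj M \<Longrightarrow> symm M b a \<cdot> symm M a b = Id M (a \<otimes> b)"
    and hexagon: "a \<in> Obj M \<Longrightarrow> b \<in> Obj M \<Longrightarrow> c \<in> Obj M \<Longrightarrow>
      assoc M b c a \<cdot> symm M a (b \<otimes> c) \<cdot> assoc M a b c =
      (Id M b \<otimes>\<^sub>m symm M a c) \<cdot> assoc M b a c \<cdot> (symm M a b \<otimes>\<^sub>m Id M c)"

locale abelian_symmetric_monoidal_category =
  symmetric_monoidal_category M + abelian_category M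
  for M :: "('o, 'm, 'z) smc_scheme" (structure) +
  assumes tensor_left_additive:
      "a \<in> Obj M \<Longrightarrow> additive_functor M M (\<lambda>f. Id M a \<otimes>\<^sub>m f)"
    and tensor_left_exact:
      "a \<in> Obj M \<Longrightarrow> exact_functor M M (\<lambda>f. Id M a \<otimes>\<^sub>m f)"
    and tensor_right_additive:
      "a \<in> Obj M \<Longrightarrow> additive_functor M M (\<lambda>f. f \<otimes>\<^sub>m Id M a)"
    and tensor_right_exact:
      "a \<in> Obj M \<Longrightarrow> exact_functor M M (\<lambda>f. f \<otimes>\<^sub>m Id M a)"

text \<open>
  The arrow \<open>Id \<otimes> symm b c \<otimes> Id : (a \<otimes> b) \<otimes> (c \<otimes> d) \<rightarrow> (a \<otimes> c) \<otimes> (b \<otimes> d)\<close> with its associators.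
\<close>

definition midswap :: "('o, 'm, 'z) smc_scheme \<Rightarrow> 'o \<Rightarrow> 'o \<Rightarrow> 'o \<Rightarrow> 'o \<Rightarrow> 'm" where
  "midswap M a b c d =
    inv_arr M (assoc M a c (b \<otimes> d)) \<cdot>
    (Id M a \<otimes>\<^sub>m (assoc M c b d \<cdot> (symm M b c \<otimes>\<^sub>m Id M d) \<cdot> inv_arr M (assoc M b c d))) \<cdot>
    assoc M a b (c \<otimes> d)"
  for M (structure)


section \<open>Monoids, comonoids and Hopf monoids\<close>

record ('o, 'm) monoid_obj =
  mon_obj :: "'o"
  mon_mult :: "'m"
  mon_unit :: "'m"

record ('o, 'm) comonoid_obj =
  com_obj :: "'o"
  com_comult :: "'m"
  com_counit :: "'m"

record ('o, 'm) hopf_obj =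
  hopf_carrier :: "'o"
  hopf_mult :: "'m"
  hopf_unit :: "'m"
  hopf_comult :: "'m"
  hopf_counit :: "'m"
  hopf_antipode :: "'m"

definition hopf_monoid :: "('o, 'm) hopf_obj \<Rightarrow> ('o, 'm) monoid_obj" where
  "hopf_monoid A =
    \<lparr>mon_obj = hopf_carrier A, mon_mult = hopf_mult A, mon_unit = hopf_unit A\<rparr>"

definition hopf_comonoid :: "('o, 'm) hopf_obj \<Rightarrow> ('o, 'm) comonoid_obj" where
  "hopf_comonoid A =
    \<lparr>com_obj = hopf_carrier A, com_comult = hopf_comult A, com_counit = hopf_counit A\<rparr>"

definition is_monoid :: "('o, 'm, 'z) smc_scheme \<Rightarrow> ('o, 'm) monoid_obj \<Rightarrow> bool" where
  "is_monoid M K \<longleftrightarrow> (let a = mon_obj K; m = mon_mult K; u = mon_unit K in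
    a \<in> Obj M \<and> m \<in> hset M (a \<otimes> a) a \<and> u \<in> hset M (unit_obj M) a \<and>
    m \<cdot> (m \<otimes>\<^sub>m Id M a) = m \<cdot> (Id M a \<otimes>\<^sub>m m) \<cdot> assoc M a a a \<and>
    m \<cdot> (u \<otimes>\<^sub>m Id M a) = lunit M a \<and>
    m \<cdot> (Id M a \<otimes>\<^sub>m u) = runit M a)"
  for M (structure)

definition is_monoid_arr ::
  "('o, 'm, 'z) smc_scheme \<Rightarrow> ('o, 'm) monoid_obj \<Rightarrow> ('o, 'm) monoid_obj \<Rightarrow> 'm \<Rightarrow> bool" where
  "is_monoid_arr M K L f \<longleftrightarrow>
    f \<cdot> mon_mult K = mon_mult L \<cdot> (f \<otimes>\<^sub>m f) \<and> f \<cdot> mon_unit K = mon_unit L"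
  for M (structure)

definition is_comonoid :: "('o, 'm, 'z) smc_scheme \<Rightarrow> ('o, 'm) comonoid_obj \<Rightarrow> bool" where
  "is_comonoid M Q \<longleftrightarrow> (let q = com_obj Q; d = com_comult Q; e = com_counit Q in
    q \<in> Obj M \<and> d \<in> hset M q (q \<otimes> q) \<and> e \<in> hset M q (unit_obj M) \<and>
    assoc M q q q \<cdot> (d \<otimes>\<^sub>m Id M q) \<cdot> d = (Id M q \<otimes>\<^sub>m d) \<cdot> d \<and>
    lunit M q \<cdot> (e \<otimes>\<^sub>m Id M q) \<cdot> d = Id M q \<and>
    runit M q \<cdot> (Id M q \<otimes>\<^sub>m e) \<cdot> d = Id M q)"
  for M (structure)

definition is_cocommutative :: "('o, 'm, 'z) smc_scheme \<Rightarrow> ('o, 'm) comonoid_obj \<Rightarrow> bool" where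
  "is_cocommutative M Q \<longleftrightarrow> symm M (com_obj Q) (com_obj Q) \<cdot> com_comult Q = com_comult Q"
  for M (structure)

definition is_comonoid_arr ::
  "('o, 'm, 'z) smc_scheme \<Rightarrow> ('o, 'm) comonoid_obj \<Rightarrow> ('o, 'm) comonoid_obj \<Rightarrow> 'm \<Rightarrow> bool" where
  "is_comonoid_arr M Q R f \<longleftrightarrow>
    com_comult R \<cdot> f = (f \<otimes>\<^sub>m f) \<cdot> com_comult Q \<and> com_counit R \<cdot> f = com_counit Q"
  for M (structure)

definition is_bimonoid :: "('o, 'm, 'z) smc_scheme \<Rightarrow> ('o, 'm) hopf_obj \<Rightarrow> bool" where
  "is_bimonoid M A \<longleftrightarrow> is_monoid M (hopf_monoid A) \<and> is_comonoid M (hopf_comonoid A) \<and>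
    (let a = hopf_carrier A; m = hopf_mult A; u = hopf_unit A;
         d = hopf_comult A; e = hopf_counit A; I = unit_obj M in
      d \<cdot> m = (m \<otimes>\<^sub>m m) \<cdot> midswap M a a a a \<cdot> (d \<otimes>\<^sub>m d) \<and>
      d \<cdot> u \<cdot> lunit M I = u \<otimes>\<^sub>m u \<and>
      e \<cdot> m = lunit M I \<cdot> (e \<otimes>\<^sub>m e) \<and>
      e \<cdot> u = Id M I)"
  for M (structure)

definition is_hopf_monoid :: "('o, 'm, 'z) smc_scheme \<Rightarrow> ('o, 'm) hopf_obj \<Rightarrow> bool" where
  "is_hopf_monoid M A \<longleftrightarrow> is_bimonoid M A \<and>
    (let a = hopf_carrier A; m = hopf_mult A; u = hopf_unit A;
         d = hopf_comult A; e = hopf_counit A; S = hopf_antipode A in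
      S \<in> hset M a a \<and>
      m \<cdot> (S \<otimes>\<^sub>m Id M a) \<cdot> d = u \<cdot> e \<and>
      m \<cdot> (Id M a \<otimes>\<^sub>m S) \<cdot> d = u \<cdot> e)"
  for M (structure)

text \<open>
  Compatibility of a Hopf monoid morphism with the antipodes is automatic and not part of the
  definition.
\<close>

definition Hopf_coc ::
  "('o, 'm, 'z) smc_scheme \<Rightarrow>
    (('o, 'm) hopf_obj, ('o, 'm) hopf_obj \<times> 'm \<times> ('o, 'm) hopf_obj) cat" where
  "Hopf_coc M = struct_cat M
    {A. is_hopf_monoid M A \<and> is_cocommutative M (hopf_comonoid A)}
    hopf_carrier
    (\<lambda>A B f. is_monoid_arr M (hopf_monoid A) (hopf_monoid B) f \<and>
      is_comonoid_arr M (hopf_comonoid A) (hopf_comonoid B) f)"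


section \<open>Modules and comodules\<close>

definition is_left_module ::
  "('o, 'm, 'z) smc_scheme \<Rightarrow> ('o, 'm) monoid_obj \<Rightarrow> 'o \<times> 'm \<Rightarrow> bool" where
  "is_left_module M K = (\<lambda>(x, act). let k = mon_obj K in
    x \<in> Obj M \<and> act \<in> hset M (k \<otimes> x) x \<and>
    act \<cdot> (mon_mult K \<otimes>\<^sub>m Id M x) = act \<cdot> (Id M k \<otimes>\<^sub>m act) \<cdot> assoc M k k x \<and>
    act \<cdot> (mon_unit K \<otimes>\<^sub>m Id M x) = lunit M x)"
  for M (structure)

definition is_left_linear ::
  "('o, 'm, 'z) smc_scheme \<Rightarrow> ('o, 'm) monoid_obj \<Rightarrow> 'o \<times> 'm \<Rightarrow> 'o \<times> 'm \<Rightarrow> 'm \<Rightarrow> bool" where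
  "is_left_linear M K X Y f \<longleftrightarrow> f \<cdot> snd X = snd Y \<cdot> (Id M (mon_obj K) \<otimes>\<^sub>m f)"
  for M (structure)

definition is_right_module ::
  "('o, 'm, 'z) smc_scheme \<Rightarrow> ('o, 'm) monoid_obj \<Rightarrow> 'o \<times> 'm \<Rightarrow> bool" where
  "is_right_module M K = (\<lambda>(x, act). let k = mon_obj K in
    x \<in> Obj M \<and> act \<in> hset M (x \<otimes> k) x \<and>
    act \<cdot> (act \<otimes>\<^sub>m Id M k) = act \<cdot> (Id M x \<otimes>\<^sub>m mon_mult K) \<cdot> assoc M x k k \<and>
    act \<cdot> (Id M x \<otimes>\<^sub>m mon_unit K) = runit M x)"
  for M (structure)

definition is_right_comodule ::
  "('o, 'm, 'z) smc_scheme \<Rightarrow> ('o, 'm) comonoid_obj \<Rightarrow> 'o \<times> 'm \<Rightarrow> bool" where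
  "is_right_comodule M Q = (\<lambda>(v, coact). let q = com_obj Q in
    v \<in> Obj M \<and> coact \<in> hset M v (v \<otimes> q) \<and>
    assoc M v q q \<cdot> (coact \<otimes>\<^sub>m Id M q) \<cdot> coact = (Id M v \<otimes>\<^sub>m com_comult Q) \<cdot> coact \<and>
    runit M v \<cdot> (Id M v \<otimes>\<^sub>m com_counit Q) \<cdot> coact = Id M v)"
  for M (structure)

definition Right_Mod ::
  "('o, 'm, 'z) smc_scheme \<Rightarrow> ('o, 'm) monoid_obj \<Rightarrow>
    ('o \<times> 'm, ('o \<times> 'm) \<times> 'm \<times> ('o \<times> 'm)) cat" where
  "Right_Mod M K = struct_cat M {X. is_right_module M K X} fst
    (\<lambda>X Y f. f \<cdot> snd X = snd Y \<cdot> (f \<otimes>\<^sub>m Id M (mon_obj K)))"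
  for M (structure)

definition Right_Comod ::
  "('o, 'm, 'z) smc_scheme \<Rightarrow> ('o, 'm) comonoid_obj \<Rightarrow>
    ('o \<times> 'm, ('o \<times> 'm) \<times> 'm \<times> ('o \<times> 'm)) cat" where
  "Right_Comod M Q = struct_cat M {V. is_right_comodule M Q V} fst
    (\<lambda>V W f. snd W \<cdot> f = (f \<otimes>\<^sub>m Id M (com_obj Q)) \<cdot> snd V)"
  for M (structure)

text \<open>
  \<open>cotensor_incl M Q (w, l) (v, r)\<close> is a chosen equalizer arrow into \<open>v \<otimes> w\<close>, whose domain is the
  cotensor product; \<open>cotensor_arr M Q (w, l)\<close> is the action on arrows of the functor that it
  induces on right comodules. Dually for \<open>tensor_over_proj\<close> and \<open>tensor_over_arr\<close>.
\<close>

definition cotensor_incl ::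
  "('o, 'm, 'z) smc_scheme \<Rightarrow> ('o, 'm) comonoid_obj \<Rightarrow> 'o \<times> 'm \<Rightarrow> 'o \<times> 'm \<Rightarrow> 'm" where
  "cotensor_incl M Q = (\<lambda>(w, l) (v, r). SOME e. is_equalizer M
    (assoc M v (com_obj Q) w \<cdot> (r \<otimes>\<^sub>m Id M w)) (Id M v \<otimes>\<^sub>m l) e)"
  for M (structure)

definition cotensor_arr ::
  "('o, 'm, 'z) smc_scheme \<Rightarrow> ('o, 'm) comonoid_obj \<Rightarrow> 'o \<times> 'm \<Rightarrow>
    ('o \<times> 'm) \<times> 'm \<times> ('o \<times> 'm) \<Rightarrow> 'm" where
  "cotensor_arr M Q W = (\<lambda>(V, f, V').
    let e = cotensor_incl M Q W V; e' = cotensor_incl M Q W V' in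
    THE g. g \<in> hset M (Dom M e) (Dom M e') \<and> e' \<cdot> g = (f \<otimes>\<^sub>m Id M (fst W)) \<cdot> e)"
  for M (structure)

definition tensor_over_proj ::
  "('o, 'm, 'z) smc_scheme \<Rightarrow> ('o, 'm) monoid_obj \<Rightarrow> 'o \<times> 'm \<Rightarrow> 'o \<times> 'm \<Rightarrow> 'm" where
  "tensor_over_proj M K = (\<lambda>(x, l) (y, r). SOME p. is_coequalizer M
    (r \<otimes>\<^sub>m Id M x) ((Id M y \<otimes>\<^sub>m l) \<cdot> assoc M y (mon_obj K) x) p)"
  for M (structure)

definition tensor_over_arr ::
  "('o, 'm, 'z) smc_scheme \<Rightarrow> ('o, 'm) monoid_obj \<Rightarrow> 'o \<times> 'm \<Rightarrow>
    ('o \<times> 'm) \<times> 'm \<times> ('o \<times> 'm) \<Rightarrow> 'm" where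
  "tensor_over_arr M K X = (\<lambda>(Y, f, Y').
    let p = tensor_over_proj M K X Y; p' = tensor_over_proj M K X Y' in
    THE g. g \<in> hset M (Cod M p) (Cod M p') \<and> g \<cdot> p = p' \<cdot> (f \<otimes>\<^sub>m Id M (fst X)))"
  for M (structure)


section \<open>Module comonoids and the two conditions\<close>

record ('o, 'm) modcom_obj =
  modcom_comonoid :: "('o, 'm) comonoid_obj"
  modcom_act :: "'m"

definition modcom_module :: "('o, 'm) modcom_obj \<Rightarrow> 'o \<times> 'm" where
  "modcom_module X = (com_obj (modcom_comonoid X), modcom_act X)"

definition diagonal_module ::
  "('o, 'm, 'z) smc_scheme \<Rightarrow> ('o, 'm) hopf_obj \<Rightarrow> 'o \<times> 'm \<Rightarrow> 'o \<times> 'm" where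
  "diagonal_module M A = (\<lambda>(q, act). let a = hopf_carrier A in
    (q \<otimes> q, (act \<otimes>\<^sub>m act) \<cdot> midswap M a a q q \<cdot> (hopf_comult A \<otimes>\<^sub>m Id M (q \<otimes> q))))"
  for M (structure)

definition trivial_module :: "('o, 'm, 'z) smc_scheme \<Rightarrow> ('o, 'm) hopf_obj \<Rightarrow> 'o \<times> 'm" where
  "trivial_module M A =
    (unit_obj M, lunit M (unit_obj M) \<cdot> (hopf_counit A \<otimes>\<^sub>m Id M (unit_obj M)))"
  for M (structure)

definition is_module_comonoid ::
  "('o, 'm, 'z) smc_scheme \<Rightarrow> ('o, 'm) hopf_obj \<Rightarrow> ('o, 'm) modcom_obj \<Rightarrow> bool" where
  "is_module_comonoid M A X \<longleftrightarrow>
    (let Q = modcom_comonoid X; K = hopf_monoid A; V = modcom_module X in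
      is_comonoid M Q \<and> is_cocommutative M Q \<and> is_left_module M K V \<and>
      is_left_linear M K V (diagonal_module M A V) (com_comult Q) \<and>
      is_left_linear M K V (trivial_module M A) (com_counit Q))"

definition Comon_coc_mod ::
  "('o, 'm, 'z) smc_scheme \<Rightarrow> ('o, 'm) hopf_obj \<Rightarrow>
    (('o, 'm) modcom_obj, ('o, 'm) modcom_obj \<times> 'm \<times> ('o, 'm) modcom_obj) cat" where
  "Comon_coc_mod M A = struct_cat M
    {X. is_module_comonoid M A X}
    (\<lambda>X. com_obj (modcom_comonoid X))
    (\<lambda>X Y f. is_left_linear M (hopf_monoid A) (modcom_module X) (modcom_module Y) f \<and>
      is_comonoid_arr M (modcom_comonoid X) (modcom_comonoid Y) f)"

definition hopf_modcom :: "('o, 'm) hopf_obj \<Rightarrow> ('o, 'm) modcom_obj" where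
  "hopf_modcom A = \<lparr>modcom_comonoid = hopf_comonoid A, modcom_act = hopf_mult A\<rparr>"

definition faithful_coflatness :: "('o, 'm, 'z) smc_scheme \<Rightarrow> bool" where
  "faithful_coflatness M \<longleftrightarrow>
    (\<forall>A \<in> Obj (Hopf_coc M). \<forall>X. \<forall>\<pi> \<in> hset (Comon_coc_mod M A) (hopf_modcom A) X.
      epi_arr M (underlying \<pi>) \<longrightarrow>
      (let a = hopf_carrier A; Q = modcom_comonoid X;
           F = cotensor_arr M Q (a, (underlying \<pi> \<otimes>\<^sub>m Id M a) \<cdot> hopf_comult A) in
        preserves_epis (Right_Comod M Q) M F \<and> reflects_epis (Right_Comod M Q) M F))"
  for M (structure)

definition faithful_flatness :: "('o, 'm, 'z) smc_scheme \<Rightarrow> bool" where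
  "faithful_flatness M \<longleftrightarrow>
    (\<forall>A \<in> Obj (Hopf_coc M). \<forall>B. \<forall>i \<in> hset (Hopf_coc M) B A.
      mono_arr M (underlying i) \<longrightarrow>
      (let a = hopf_carrier A; K = hopf_monoid B;
           F = tensor_over_arr M K (a, hopf_mult A \<cdot> (underlying i \<otimes>\<^sub>m Id M a)) in
        preserves_monos (Right_Mod M K) M F \<and> reflects_monos (Right_Mod M K) M F))"
  for M (structure)

end

theory Submission
  imports Defs
begin

text \<open>
  Cocommutative comonoids form a cartesian category whose product is the tensor product of \<open>M\<close>,
  and cocommutative Hopf monoids are its internal groups, so one may calculate with generalized
  elements. Two facts identify the regular epimorphisms of Hopf monoids with the morphisms that
  are epic in \<open>M\<close>. First, a regular epimorphism is epic in \<open>M\<close>, since its image in \<open>M\<close> is a Hopf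
  submonoid. Second, let \<open>f : A \<rightarrow> B\<close> be epic in \<open>M\<close>. The cotensor product over \<open>B\<close> of two Hopf
  monoids is their pullback over \<open>B\<close>, and \<open>(-) \<box>\<^sub>B A\<close> reflects epimorphisms; after cotensoring with
  \<open>A\<close>, the difference of the two projections of \<open>A \<box>\<^sub>B A\<close> becomes a split epimorphism onto the
  kernel of \<open>f\<close> in \<open>M\<close>, so that \<open>f\<close> is the cokernel of its Hopf kernel. The same descent argument
  gives stability: the pullback of \<open>f\<close> along any \<open>g : V \<rightarrow> B\<close> is split after cotensoring with \<open>A\<close>,
  by the diagonal of \<open>A\<close> over \<open>B\<close>.
\<close>

section \<open>Categories\<close>

text \<open>The Hopf kernel of \<open>f\<close> is defined through the multiplication, the kernel in
  \<open>M\<close> through subtraction, and the kernel pair \<open>v\<close>, \<open>a\<close> of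
  \<open>f\<close> mediates between them. If \<open>h\<close> kills the Hopf kernel, then it kills
  the quotient \<open>v * S(a)\<close> in the convolution group, which factors through that kernel;
  so \<open>h \<cdot> v = h \<cdot> a\<close>. Hence \<open>h\<close> kills \<open>v - a\<close>,
  and since this difference is epic onto the kernel of \<open>f\<close> in \<open>M\<close>,
  \<open>h\<close> factors through \<open>f\<close> in \<open>M\<close>. The factor is a Hopf
  morphism because \<open>f\<close> is epic. Two obstacles shape the rest. The monoidal structure is
  not strict, so the string-diagram identities behind the cartesian structure are proved after a
  strictification. And the coflatness condition yields epimorphisms in the category of comodules,
  not in \<open>M\<close>: the arrows to be descended must be exhibited as comodule morphisms over
  \<open>B\<close>, and epimorphisms of comodules must be shown to be epic in
  \<open>M\<close>.\<close>

lemma in_hset: "f \<in> hset C a b \<longleftrightarrow> f \<in> Arr C \<and> Dom C f = a \<and> Cod C f = b"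
  by (auto simp: hset_def)

context category
begin

lemma Id_arr [simp]:
  assumes "a \<in> Obj C"
  shows "Id C a \<in> Arr C" "Dom C (Id C a) = a" "Cod C (Id C a) = a"
  using id_in_hset[OF assms] by (auto simp: in_hset)

lemma comp_arr [simp]:
  assumes "f \<in> Arr C" "g \<in> Arr C" "Cod C f = Dom C g"
  shows "g \<cdot> f \<in> Arr C" "Dom C (g \<cdot> f) = Dom C f" "Cod C (g \<cdot> f) = Cod C g"
  using comp_in_hset[of f "Dom C f" "Cod C f" g "Cod C g"] assms by (auto simp: in_hset)

lemma Dom_Obj [simp]: "f \<in> Arr C \<Longrightarrow> Dom C f \<in> Obj C"
  by (rule dom_in_Obj)

lemma Cod_Obj [simp]: "f \<in> Arr C \<Longrightarrow> Cod C f \<in> Obj C"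
  by (rule cod_in_Obj)

lemma comp_Id [simp]: "f \<in> Arr C \<Longrightarrow> Dom C f = a \<Longrightarrow> f \<cdot> Id C a = f"
  using comp_id[of f a "Cod C f"] by (auto simp: in_hset)

lemma Id_comp [simp]: "f \<in> Arr C \<Longrightarrow> Cod C f = a \<Longrightarrow> Id C a \<cdot> f = f"
  using id_comp[of f "Dom C f" a] by (auto simp: in_hset)

lemma assoc_comp [simp]:
  "f \<in> Arr C \<Longrightarrow> g \<in> Arr C \<Longrightarrow> h \<in> Arr C \<Longrightarrow> Cod C f = Dom C g \<Longrightarrow> Cod C g = Dom C h \<Longrightarrow>
    (h \<cdot> g) \<cdot> f = h \<cdot> g \<cdot> f"
  using comp_assoc[of f "Dom C f" "Cod C f" g "Cod C g" h "Cod C h"] by (auto simp: in_hset)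

text \<open>Composites are kept nested to the right by \<open>assoc_comp\<close>, so a rule for
  \<open>g \<cdot> f\<close> does not match inside a longer composite. This is its version with a
  continuation \<open>h\<close>.\<close>

lemma comp_tail:
  "g \<cdot> f = k \<Longrightarrow> f \<in> Arr C \<Longrightarrow> g \<in> Arr C \<Longrightarrow> Cod C f = Dom C g \<Longrightarrow> h \<in> Arr C \<Longrightarrow>
    Cod C h = Dom C f \<Longrightarrow> g \<cdot> f \<cdot> h = k \<cdot> h"
  by (metis assoc_comp)

lemma inverse_arrs_unique: "inverse_arrs C f g \<Longrightarrow> inverse_arrs C f h \<Longrightarrow> g = h"
  unfolding inverse_arrs_def in_hset by (metis Id_comp assoc_comp comp_Id)

lemma inv_arrI: "inverse_arrs C f g \<Longrightarrow> inv_arr C f = g"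
  unfolding inv_arr_def using inverse_arrs_unique by blast

lemma iso_inverse: "iso_arr C f \<Longrightarrow> inverse_arrs C f (inv_arr C f)"
  using inv_arrI by (auto simp: iso_arr_def)

lemma iso_is_arr [simp]: "iso_arr C f \<Longrightarrow> f \<in> Arr C"
  by (auto simp: iso_arr_def inverse_arrs_def)

lemma inv_arr [simp]:
  assumes "iso_arr C f"
  shows "inv_arr C f \<in> Arr C" "Dom C (inv_arr C f) = Cod C f" "Cod C (inv_arr C f) = Dom C f"
    "inv_arr C f \<cdot> f = Id C (Dom C f)" "f \<cdot> inv_arr C f = Id C (Cod C f)"
  using iso_inverse[OF assms] by (auto simp: inverse_arrs_def in_hset)

lemma inv_arr_cancel [simp]:
  assumes "iso_arr C f" "h \<in> Arr C"
  shows "Cod C h = Dom C f \<Longrightarrow> inv_arr C f \<cdot> f \<cdot> h = h" 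
    "Cod C h = Cod C f \<Longrightarrow> f \<cdot> inv_arr C f \<cdot> h = h"
  using assms by (simp_all flip: assoc_comp)

lemma iso_cancel_right:
  assumes "iso_arr C h" "f \<in> Arr C" "g \<in> Arr C" "Dom C f = Cod C h" "Dom C g = Cod C h" "f \<cdot> h = g \<cdot>
      h"
  shows "f = g"
proof -
  have "f = (f \<cdot> h) \<cdot> inv_arr C h" using assms(1-5) by simp
  also have "\<dots> = (g \<cdot> h) \<cdot> inv_arr C h" by (simp only: assms(6))
  also have "\<dots> = g" using assms(1-5) by simp
  finally show ?thesis .
qed

lemma iso_cancel_left:
  assumes "iso_arr C h" "f \<in> Arr C" "g \<in> Arr C" "Cod C f = Dom C h" "Cod C g = Dom C h" "h \<cdot> f = h \<cdot>
      g"
  shows "f = g"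
proof -
  have "f = inv_arr C h \<cdot> (h \<cdot> f)" using assms(1-5) by simp
  also have "\<dots> = inv_arr C h \<cdot> (h \<cdot> g)" by (simp only: assms(6))
  also have "\<dots> = g" using assms(1-5) by simp
  finally show ?thesis .
qed

lemma isoI:
  assumes "f \<in> Arr C" "g \<in> Arr C" "Dom C g = Cod C f" "Cod C g = Dom C f"
    "g \<cdot> f = Id C (Dom C f)" "f \<cdot> g = Id C (Cod C f)"
  shows "iso_arr C f" "inv_arr C f = g"
proof -
  have "inverse_arrs C f g"
    unfolding inverse_arrs_def in_hset using assms by blast
  then show "iso_arr C f" "inv_arr C f = g"
    using inv_arrI unfolding iso_arr_def by blast+
qed

lemma iso_Id [simp]: "a \<in> Obj C \<Longrightarrow> iso_arr C (Id C a)"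
  by (rule isoI(1)[of _ "Id C a"]) simp_all

lemma iso_comp:
  assumes "iso_arr C f" "iso_arr C g" "Cod C f = Dom C g"
  shows "iso_arr C (g \<cdot> f)"
  using assms by (intro isoI(1)[of _ "inv_arr C f \<cdot> inv_arr C g"]) simp_all

lemma iso_inv [simp]: "iso_arr C f \<Longrightarrow> iso_arr C (inv_arr C f)"
  by (rule isoI(1)[of _ f]) simp_all

end

section \<open>Coherence in symmetric monoidal categories\<close>

context symmetric_monoidal_category
begin

lemma unit_Obj [simp]: "unit_obj M \<in> Obj M"
  by (rule unit_obj_in_Obj)

lemma tensor_Obj [simp]: "a \<in> Obj M \<Longrightarrow> b \<in> Obj M \<Longrightarrow> a \<otimes> b \<in> Obj M"
  by (rule tensor_obj_in_Obj)

lemma tensor_arr [simp]: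
  assumes "f \<in> Arr M" "g \<in> Arr M"
  shows "f \<otimes>\<^sub>m g \<in> Arr M" "Dom M (f \<otimes>\<^sub>m g) = Dom M f \<otimes> Dom M g" "Cod M (f \<otimes>\<^sub>m g) = Cod M f \<otimes> Cod M g"
  using tensor_in_hset[of f "Dom M f" "Cod M f" g "Dom M g" "Cod M g"] assms by (auto simp: in_hset)

lemma tensor_Id [simp]: "a \<in> Obj M \<Longrightarrow> b \<in> Obj M \<Longrightarrow> Id M a \<otimes>\<^sub>m Id M b = Id M (a \<otimes> b)"
  by (rule tensor_id)

lemma interchange:
  assumes "f \<in> Arr M" "f' \<in> Arr M" "g \<in> Arr M" "g' \<in> Arr M" "Cod M f = Dom M f'" "Cod M g =
      Dom M g'"
  shows "(f' \<otimes>\<^sub>m g') \<cdot> (f \<otimes>\<^sub>m g) = (f' \<cdot> f) \<otimes>\<^sub>m (g' \<cdot> g)"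
    "h \<in> Arr M \<Longrightarrow> Cod M h = Dom M f \<otimes> Dom M g \<Longrightarrow>
      (f' \<otimes>\<^sub>m g') \<cdot> (f \<otimes>\<^sub>m g) \<cdot> h = ((f' \<cdot> f) \<otimes>\<^sub>m (g' \<cdot> g)) \<cdot> h"
  using tensor_comp[of f "Dom M f" "Dom M f'" f' "Cod M f'" g "Dom M g" "Dom M g'"
      g' "Cod M g'"] assms
  by (auto simp: in_hset simp flip: assoc_comp)

lemma assoc_arr [simp]:
  assumes "a \<in> Obj M" "b \<in> Obj M" "c \<in> Obj M"
  shows "iso_arr M (assoc M a b c)" "Dom M (assoc M a b c) = (a \<otimes> b) \<otimes> c" "Cod M (assoc M a b c) =
      a \<otimes> b \<otimes> c"
  using assoc_in_hset[OF assms] assoc_iso[OF assms] by (auto simp: in_hset)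

lemma lunit_arr [simp]:
  assumes "a \<in> Obj M"
  shows "iso_arr M (lunit M a)" "Dom M (lunit M a) = unit_obj M \<otimes> a" "Cod M (lunit M a) = a"
  using lunit_in_hset[OF assms] lunit_iso[OF assms] by (auto simp: in_hset)

lemma runit_arr [simp]:
  assumes "a \<in> Obj M"
  shows "iso_arr M (runit M a)" "Dom M (runit M a) = a \<otimes> unit_obj M" "Cod M (runit M a) = a"
  using runit_in_hset[OF assms] runit_iso[OF assms] by (auto simp: in_hset)

lemma symm_arr [simp]:
  assumes "a \<in> Obj M" "b \<in> Obj M"
  shows "symm M a b \<in> Arr M" "Dom M (symm M a b) = a \<otimes> b" "Cod M (symm M a b) = b \<otimes> a"
  using symm_in_hset[OF assms] by (auto simp: in_hset)

lemma symm_iso [simp]: "a \<in> Obj M \<Longrightarrow> b \<in> Obj M \<Longrightarrow> iso_arr M (symm M a b)"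
  by (rule isoI(1)[of _ "symm M b a"]) (simp_all add: symm_symm)

lemma assoc_nat:
  assumes "f \<in> Arr M" "g \<in> Arr M" "h \<in> Arr M"
    "Dom M f = a" "Dom M g = b" "Dom M h = c" "Cod M f = a'" "Cod M g = b'" "Cod M h = c'"
  shows "assoc M a' b' c' \<cdot> ((f \<otimes>\<^sub>m g) \<otimes>\<^sub>m h) = (f \<otimes>\<^sub>m g \<otimes>\<^sub>m h) \<cdot> assoc M a b c"
  using assms by (intro assoc_natural) (auto simp: in_hset)

lemma lunit_nat:
  assumes "f \<in> Arr M"
  shows "lunit M (Cod M f) \<cdot> (Id M (unit_obj M) \<otimes>\<^sub>m f) = f \<cdot> lunit M (Dom M f)"
  using assms by (intro lunit_natural) (auto simp: in_hset)

lemma runit_nat: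
  assumes "f \<in> Arr M"
  shows "runit M (Cod M f) \<cdot> (f \<otimes>\<^sub>m Id M (unit_obj M)) = f \<cdot> runit M (Dom M f)"
  using assms by (intro runit_natural) (auto simp: in_hset)

lemma symm_nat:
  assumes "f \<in> Arr M" "g \<in> Arr M"
  shows "symm M (Cod M f) (Cod M g) \<cdot> (f \<otimes>\<^sub>m g) = (g \<otimes>\<^sub>m f) \<cdot> symm M (Dom M f) (Dom M g)"
  using assms by (intro symm_natural) (auto simp: in_hset)

lemma tensor_iso [simp]: "iso_arr M f \<Longrightarrow> iso_arr M g \<Longrightarrow> iso_arr M (f \<otimes>\<^sub>m g)"
  by (rule isoI(1)[of _ "inv_arr M f \<otimes>\<^sub>m inv_arr M g"]) (simp_all add: interchange)

text \<open>Naturality of \<open>lunit\<close> exhibits \<open>Id \<otimes> f\<close> as a conjugate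
  of \<open>f\<close> by isomorphisms, so nothing is lost by tensoring with the unit.\<close>

lemma unit_tensor_faithful:
  assumes "f \<in> Arr M" "g \<in> Arr M" "Dom M f = Dom M g" "Cod M f = Cod M g"
    "Id M (unit_obj M) \<otimes>\<^sub>m f = Id M (unit_obj M) \<otimes>\<^sub>m g"
  shows "f = g"
proof (rule iso_cancel_right[of "lunit M (Dom M f)"])
  show "f \<cdot> lunit M (Dom M f) = g \<cdot> lunit M (Dom M f)"
    unfolding lunit_nat[OF assms(1), symmetric] assms(5)
    unfolding assms(3,4) by (rule lunit_nat[OF assms(2)])
qed (use assms(1-4) in simp_all)

lemma tensor_unit_faithful:
  assumes "f \<in> Arr M" "g \<in> Arr M" "Dom M f = Dom M g" "Cod M f = Cod M g"
    "f \<otimes>\<^sub>m Id M (unit_obj M) = g \<otimes>\<^sub>m Id M (unit_obj M)"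
  shows "f = g"
proof (rule iso_cancel_right[of "runit M (Dom M f)"])
  show "f \<cdot> runit M (Dom M f) = g \<cdot> runit M (Dom M f)"
    unfolding runit_nat[OF assms(1), symmetric] assms(5)
    unfolding assms(3,4) by (rule runit_nat[OF assms(2)])
qed (use assms(1-4) in simp_all)

text \<open>Kelly's argument. The triangle axiom has the unit in the middle only; the law with the
  unit in front follows after one more unit is tensored on the left, where pentagon and triangle
  apply.\<close>

lemma lunit_tensor:
  assumes [simp]: "a \<in> Obj M" "b \<in> Obj M"
  shows "lunit M (a \<otimes> b) \<cdot> assoc M (unit_obj M) a b = lunit M a \<otimes>\<^sub>m Id M b"
proof (rule unit_tensor_faithful)
  let ?I = "unit_obj M"
  \<comment> \<open>Both sides are compared after the invertible \<open>?c\<close>, which completes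
    the left one to a side of the pentagon for \<open>1, 1, a, b\<close>.\<close>
  let ?c = "assoc M ?I (?I \<otimes> a) b \<cdot> (assoc M ?I ?I a \<otimes>\<^sub>m Id M b)"
  have "(Id M ?I \<otimes>\<^sub>m (lunit M (a \<otimes> b) \<cdot> assoc M ?I a b)) \<cdot> ?c =
      (Id M ?I \<otimes>\<^sub>m lunit M (a \<otimes> b)) \<cdot> (Id M ?I \<otimes>\<^sub>m assoc M ?I a b) \<cdot> ?c"
    by (simp add: interchange)
  also have "\<dots> = (Id M ?I \<otimes>\<^sub>m lunit M (a \<otimes> b)) \<cdot> assoc M ?I ?I (a \<otimes> b) \<cdot> assoc M (?I \<otimes> ?I) a b"
    by (simp add: pentagon)
  also have "\<dots> = (runit M ?I \<otimes>\<^sub>m Id M (a \<otimes> b)) \<cdot> assoc M (?I \<otimes> ?I) a b"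
    by (simp add: triangle flip: assoc_comp)
  also have "\<dots> = assoc M ?I a b \<cdot> ((runit M ?I \<otimes>\<^sub>m Id M a) \<otimes>\<^sub>m Id M b)"
    by (subst assoc_nat[of _ _ _ "?I \<otimes> ?I" a b]) simp_all
  also have "\<dots> = assoc M ?I a b \<cdot> ((Id M ?I \<otimes>\<^sub>m lunit M a) \<otimes>\<^sub>m Id M b) \<cdot> (assoc M ?I ?I a \<otimes>\<^sub>m Id M b)"
    by (simp add: interchange triangle)
  also have "\<dots> = (assoc M ?I a b \<cdot> ((Id M ?I \<otimes>\<^sub>m lunit M a) \<otimes>\<^sub>m Id M b)) \<cdot>
      (assoc M ?I ?I a \<otimes>\<^sub>m Id M b)"
    by simp
  also have "\<dots> = (Id M ?I \<otimes>\<^sub>m (lunit M a \<otimes>\<^sub>m Id M b)) \<cdot> ?c"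
    by (subst assoc_nat[of _ _ _ ?I "?I \<otimes> a" b]) simp_all
  finally show "Id M ?I \<otimes>\<^sub>m (lunit M (a \<otimes> b) \<cdot> assoc M ?I a b) = Id M ?I \<otimes>\<^sub>m (lunit M a \<otimes>\<^sub>m Id M b)"
    by (rule iso_cancel_right[rotated -1]) (simp_all add: iso_comp)
qed simp_all

end

text \<open>
  Associators and unitors are eliminated by flattening: a tensor word \<open>t\<close> acts on objects \<open>x\<close> by
  \<open>nf_obj t x\<close>, which brackets \<open>t \<otimes> x\<close> to the right and drops the units of \<open>t\<close>. Transported along
  \<open>flat t x : t \<otimes> x \<rightarrow> nf_obj t x\<close>, all structural arrows become identities, so that an equation of
  arrows may be checked on the transported arrows \<open>hat e x\<close>.
\<close>

datatype 'o tree = Leaf 'o | Unit | Node "'o tree" "'o tree"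

text \<open>Boundaries are words and not objects, because an object does not determine a bracketing.
  A generator therefore carries the two words between which it is to be read.\<close>

datatype ('o, 'm) expr =
    Gen "'o tree" "'o tree" 'm
  | Ide "'o tree"
  | Seq "('o, 'm) expr" "('o, 'm) expr"
  | Par "('o, 'm) expr" "('o, 'm) expr"
  | Asc "'o tree" "'o tree" "'o tree"
  | AscI "'o tree" "'o tree" "'o tree"
  | Lun "'o tree"
  | Run "'o tree"

primrec edom :: "('o, 'm) expr \<Rightarrow> 'o tree" where
  "edom (Gen s t f) = s"
| "edom (Ide t) = t"
| "edom (Seq g f) = edom f"
| "edom (Par f g) = Node (edom f) (edom g)"
| "edom (Asc s t u) = Node (Node s t) u"
| "edom (AscI s t u) = Node s (Node t u)"
| "edom (Lun t) = Node Unit t"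
| "edom (Run t) = Node t Unit"

primrec ecod :: "('o, 'm) expr \<Rightarrow> 'o tree" where
  "ecod (Gen s t f) = t"
| "ecod (Ide t) = t"
| "ecod (Seq g f) = ecod g"
| "ecod (Par f g) = Node (ecod f) (ecod g)"
| "ecod (Asc s t u) = Node s (Node t u)"
| "ecod (AscI s t u) = Node (Node s t) u"
| "ecod (Lun t) = t"
| "ecod (Run t) = t"

context symmetric_monoidal_category
begin

primrec obj_of :: "'o tree \<Rightarrow> 'o" where
  "obj_of (Leaf a) = a"
| "obj_of Unit = unit_obj M"
| "obj_of (Node s t) = obj_of s \<otimes> obj_of t"

primrec wf_tree :: "'o tree \<Rightarrow> bool" where
  "wf_tree (Leaf a) \<longleftrightarrow> a \<in> Obj M"
| "wf_tree Unit \<longleftrightarrow> True"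
| "wf_tree (Node s t) \<longleftrightarrow> wf_tree s \<and> wf_tree t"

text \<open>This is strictification by the action of the category on itself: a word becomes an
  endofunctor, with \<open>nf_obj\<close> on objects and \<open>nf_arr\<close> on arrows, and
  composition of endofunctors is strictly associative and unital.\<close>

primrec nf_obj :: "'o tree \<Rightarrow> 'o \<Rightarrow> 'o" where
  "nf_obj (Leaf a) x = a \<otimes> x"
| "nf_obj Unit x = x"
| "nf_obj (Node s t) x = nf_obj s (nf_obj t x)"

primrec nf_arr :: "'o tree \<Rightarrow> 'm \<Rightarrow> 'm" where
  "nf_arr (Leaf a) k = Id M a \<otimes>\<^sub>m k"
| "nf_arr Unit k = k"
| "nf_arr (Node s t) k = nf_arr s (nf_arr t k)"

primrec flat :: "'o tree \<Rightarrow> 'o \<Rightarrow> 'm" where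
  "flat (Leaf a) x = Id M (a \<otimes> x)"
| "flat Unit x = lunit M x"
| "flat (Node s t) x =
    flat s (nf_obj t x) \<cdot> (Id M (obj_of s) \<otimes>\<^sub>m flat t x) \<cdot> assoc M (obj_of s) (obj_of t) x"

primrec wf_expr :: "('o, 'm) expr \<Rightarrow> bool" where
  "wf_expr (Gen s t f) \<longleftrightarrow> wf_tree s \<and> wf_tree t \<and> f \<in> Arr M \<and> Dom M f = obj_of s \<and> Cod M f =
      obj_of t"
| "wf_expr (Ide t) \<longleftrightarrow> wf_tree t"
| "wf_expr (Seq g f) \<longleftrightarrow> wf_expr g \<and> wf_expr f \<and> ecod f = edom g"
| "wf_expr (Par f g) \<longleftrightarrow> wf_expr f \<and> wf_expr g"
| "wf_expr (Asc s t u) \<longleftrightarrow> wf_tree s \<and> wf_tree t \<and> wf_tree u"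
| "wf_expr (AscI s t u) \<longleftrightarrow> wf_tree s \<and> wf_tree t \<and> wf_tree u"
| "wf_expr (Lun t) \<longleftrightarrow> wf_tree t"
| "wf_expr (Run t) \<longleftrightarrow> wf_tree t"

primrec arr_of :: "('o, 'm) expr \<Rightarrow> 'm" where
  "arr_of (Gen s t f) = f"
| "arr_of (Ide t) = Id M (obj_of t)"
| "arr_of (Seq g f) = arr_of g \<cdot> arr_of f"
| "arr_of (Par f g) = arr_of f \<otimes>\<^sub>m arr_of g"
| "arr_of (Asc s t u) = assoc M (obj_of s) (obj_of t) (obj_of u)"
| "arr_of (AscI s t u) = inv_arr M (assoc M (obj_of s) (obj_of t) (obj_of u))"
| "arr_of (Lun t) = lunit M (obj_of t)"
| "arr_of (Run t) = runit M (obj_of t)"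

definition hgen :: "'o tree \<Rightarrow> 'o tree \<Rightarrow> 'm \<Rightarrow> 'o \<Rightarrow> 'm" where
  "hgen s t f x = flat t x \<cdot> (f \<otimes>\<^sub>m Id M x) \<cdot> inv_arr M (flat s x)"

text \<open>The clause for \<open>Par\<close> is the horizontal composite of natural
  transformations, with the second factor applied first. Performing them in the other order gives
  the same arrow by naturality, as in \<open>hgen_nat\<close>.\<close>

primrec hat :: "('o, 'm) expr \<Rightarrow> 'o \<Rightarrow> 'm" where
  "hat (Gen s t f) x = hgen s t f x"
| "hat (Ide t) x = Id M (nf_obj t x)"
| "hat (Seq g f) x = hat g x \<cdot> hat f x"
| "hat (Par f g) x = hat f (nf_obj (ecod g) x) \<cdot> nf_arr (edom f) (hat g x)"
| "hat (Asc s t u) x = Id M (nf_obj s (nf_obj t (nf_obj u x)))"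
| "hat (AscI s t u) x = Id M (nf_obj s (nf_obj t (nf_obj u x)))"
| "hat (Lun t) x = Id M (nf_obj t x)"
| "hat (Run t) x = Id M (nf_obj t x)"

lemma obj_of_Obj [simp]: "wf_tree t \<Longrightarrow> obj_of t \<in> Obj M"
  by (induction t) auto

lemma nf_obj_Obj [simp]: "wf_tree t \<Longrightarrow> x \<in> Obj M \<Longrightarrow> nf_obj t x \<in> Obj M"
  by (induction t arbitrary: x) auto

lemma nf_arr_arr [simp]:
  assumes "wf_tree t" "k \<in> Arr M"
  shows "nf_arr t k \<in> Arr M" "Dom M (nf_arr t k) = nf_obj t (Dom M k)" "Cod M (nf_arr t k) =
      nf_obj t (Cod M k)"
proof -
  have "nf_arr t k \<in> Arr M \<and> Dom M (nf_arr t k) = nf_obj t (Dom M k) \<and> Cod M (nf_arr t k) =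
      nf_obj t (Cod M k)"
    using assms by (induction t arbitrary: k) auto
  then show "nf_arr t k \<in> Arr M" "Dom M (nf_arr t k) = nf_obj t (Dom M k)" "Cod M (nf_arr t k) =
      nf_obj t (Cod M k)"
    by auto
qed

lemma nf_arr_comp:
  "wf_tree t \<Longrightarrow> k \<in> Arr M \<Longrightarrow> l \<in> Arr M \<Longrightarrow> Cod M l = Dom M k \<Longrightarrow> nf_arr t (k \<cdot> l) = nf_arr t k \<cdot>
      nf_arr t l"
  by (induction t arbitrary: k l) (auto simp: interchange)

lemma nf_arr_Id [simp]: "wf_tree t \<Longrightarrow> x \<in> Obj M \<Longrightarrow> nf_arr t (Id M x) = Id M (nf_obj t x)"
  by (induction t arbitrary: x) auto

lemma flat_iso [simp]:
  assumes "wf_tree t" "x \<in> Obj M"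
  shows "iso_arr M (flat t x)" "Dom M (flat t x) = obj_of t \<otimes> x" "Cod M (flat t x) = nf_obj t x"
proof -
  have "iso_arr M (flat t x) \<and> Dom M (flat t x) = obj_of t \<otimes> x \<and> Cod M (flat t x) = nf_obj t x"
    using assms
  proof (induction t arbitrary: x)
    case (Node s t)
    then show ?case by (auto intro!: iso_comp)
  qed auto
  then show "iso_arr M (flat t x)" "Dom M (flat t x) = obj_of t \<otimes> x" "Cod M (flat t x) = nf_obj t x"
    by auto
qed

text \<open>Lets an arrow that acts behind the word \<open>t\<close> pass the flattening of
  \<open>t\<close>; the \<open>Par\<close> case of \<open>hat_correct\<close> rests on this.\<close>

lemma flat_nat:
  "wf_tree t \<Longrightarrow> k \<in> Arr M \<Longrightarrow> flat t (Cod M k) \<cdot> (Id M (obj_of t) \<otimes>\<^sub>m k) = nf_arr t k \<cdot>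
      flat t (Dom M k)"
proof (induction t arbitrary: k)
  case (Node s t)
  let ?s = "obj_of s" and ?t = "obj_of t"
  have [simp]: "wf_tree s" "wf_tree t" "k \<in> Arr M" using Node by auto
  have "flat (Node s t) (Cod M k) \<cdot> (Id M (obj_of (Node s t)) \<otimes>\<^sub>m k) =
      flat s (nf_obj t (Cod M k)) \<cdot> (Id M ?s \<otimes>\<^sub>m flat t (Cod M k)) \<cdot>
      (assoc M ?s ?t (Cod M k) \<cdot> ((Id M ?s \<otimes>\<^sub>m Id M ?t) \<otimes>\<^sub>m k))"
    by simp
  also have "\<dots> = flat s (nf_obj t (Cod M k)) \<cdot> (Id M ?s \<otimes>\<^sub>m flat t (Cod M k)) \<cdot>
      (Id M ?s \<otimes>\<^sub>m Id M ?t \<otimes>\<^sub>m k) \<cdot> assoc M ?s ?t (Dom M k)"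
    by (subst assoc_nat[of _ _ _ ?s ?t "Dom M k"]) simp_all
  also have "\<dots> = flat s (nf_obj t (Cod M k)) \<cdot> (Id M ?s \<otimes>\<^sub>m nf_arr t k) \<cdot>
      (Id M ?s \<otimes>\<^sub>m flat t (Dom M k)) \<cdot> assoc M ?s ?t (Dom M k)"
    by (simp add: interchange Node.IH)
  also have "\<dots> = (flat s (Cod M (nf_arr t k)) \<cdot> (Id M ?s \<otimes>\<^sub>m nf_arr t k)) \<cdot>
      (Id M ?s \<otimes>\<^sub>m flat t (Dom M k)) \<cdot> assoc M ?s ?t (Dom M k)"
    by simp
  also have "\<dots> = nf_arr (Node s t) k \<cdot> flat (Node s t) (Dom M k)"
    by (subst Node.IH(1)) simp_all
  finally show ?case .
qed (auto simp: lunit_nat)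

lemma hgen_arr [simp]:
  assumes "wf_tree s" "wf_tree t" "f \<in> Arr M" "Dom M f = obj_of s" "Cod M f = obj_of t" "x \<in> Obj M"
  shows "hgen s t f x \<in> Arr M" "Dom M (hgen s t f x) = nf_obj s x" "Cod M (hgen s t f x) =
      nf_obj t x"
  using assms by (auto simp: hgen_def)

lemma flat_nat':
  assumes "wf_tree t" "k \<in> Arr M"
  shows "inv_arr M (flat t (Cod M k)) \<cdot> nf_arr t k = (Id M (obj_of t) \<otimes>\<^sub>m k) \<cdot>
      inv_arr M (flat t (Dom M k))"
proof (rule iso_cancel_left[of "flat t (Cod M k)"])
  have "flat t (Cod M k) \<cdot> (Id M (obj_of t) \<otimes>\<^sub>m k) \<cdot> inv_arr M (flat t (Dom M k)) =
      (flat t (Cod M k) \<cdot> (Id M (obj_of t) \<otimes>\<^sub>m k)) \<cdot> inv_arr M (flat t (Dom M k))"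
    using assms by simp
  also have "\<dots> = nf_arr t k" 
    using assms by (subst flat_nat) simp_all
  finally show "flat t (Cod M k) \<cdot> inv_arr M (flat t (Cod M k)) \<cdot> nf_arr t k =
      flat t (Cod M k) \<cdot> (Id M (obj_of t) \<otimes>\<^sub>m k) \<cdot> inv_arr M (flat t (Dom M k))"
    using assms by simp
qed (use assms in simp_all)

text \<open>What remains of the interchange law after flattening: arrows that act on different
  tensor factors slide past each other.\<close>

lemma hgen_nat:
  assumes [simp]: "wf_tree s" "wf_tree t" "f \<in> Arr M" "Dom M f = obj_of s" "Cod M f = obj_of t"
      "k \<in> Arr M"
  shows "hgen s t f (Cod M k) \<cdot> nf_arr s k = nf_arr t k \<cdot> hgen s t f (Dom M k)"
proof -
  have "hgen s t f (Cod M k) \<cdot> nf_arr s k =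
      flat t (Cod M k) \<cdot> (f \<otimes>\<^sub>m Id M (Cod M k)) \<cdot> (Id M (obj_of s) \<otimes>\<^sub>m k) \<cdot>
          inv_arr M (flat s (Dom M k))"
    by (simp add: hgen_def flat_nat')
  also have "\<dots> = flat t (Cod M k) \<cdot> (Id M (obj_of t) \<otimes>\<^sub>m k) \<cdot> (f \<otimes>\<^sub>m Id M (Dom M k)) \<cdot>
      inv_arr M (flat s (Dom M k))"
    by (simp add: interchange)
  also have "\<dots> = (flat t (Cod M k) \<cdot> (Id M (obj_of t) \<otimes>\<^sub>m k)) \<cdot> (f \<otimes>\<^sub>m Id M (Dom M k)) \<cdot>
      inv_arr M (flat s (Dom M k))"
    by simp
  also have "\<dots> = nf_arr t k \<cdot> hgen s t f (Dom M k)"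
    by (subst flat_nat) (simp_all add: hgen_def)
  finally show ?thesis .
qed

lemma wf_expr_arr [simp]:
  assumes "wf_expr e"
  shows "wf_tree (edom e)" "wf_tree (ecod e)" "arr_of e \<in> Arr M" "Dom M (arr_of e) =
      obj_of (edom e)"
    "Cod M (arr_of e) = obj_of (ecod e)"
proof -
  have "wf_tree (edom e) \<and> wf_tree (ecod e) \<and> arr_of e \<in> Arr M \<and> Dom M (arr_of e) =
      obj_of (edom e) \<and>
    Cod M (arr_of e) = obj_of (ecod e)"
    using assms by (induction e) auto
  then show "wf_tree (edom e)" "wf_tree (ecod e)" "arr_of e \<in> Arr M" "Dom M (arr_of e) =
      obj_of (edom e)"
    "Cod M (arr_of e) = obj_of (ecod e)" by auto
qed

lemma hat_arr [simp]:
  assumes "wf_expr e" "x \<in> Obj M"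
  shows "hat e x \<in> Arr M" "Dom M (hat e x) = nf_obj (edom e) x" "Cod M (hat e x) =
      nf_obj (ecod e) x"
proof -
  have "hat e x \<in> Arr M \<and> Dom M (hat e x) = nf_obj (edom e) x \<and> Cod M (hat e x) = nf_obj (ecod e) x"
    using assms by (induction e arbitrary: x) auto
  then show "hat e x \<in> Arr M" "Dom M (hat e x) = nf_obj (edom e) x" "Cod M (hat e x) =
      nf_obj (ecod e) x"
    by auto
qed

text \<open>The pentagon says precisely that the two ways of bracketing
  \<open>((s \<otimes> t) \<otimes> u) \<otimes> x\<close> to the right agree.\<close>

lemma flat_assoc:
  assumes [simp]: "wf_tree s" "wf_tree t" "wf_tree u" "x \<in> Obj M"
  shows "flat (Node s (Node t u)) x \<cdot> (assoc M (obj_of s) (obj_of t) (obj_of u) \<otimes>\<^sub>m Id M x) =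
    flat (Node (Node s t) u) x"
proof -
  let ?s = "obj_of s" and ?t = "obj_of t" and ?u = "obj_of u" and ?y = "nf_obj u x"
  have "flat (Node s (Node t u)) x \<cdot> (assoc M ?s ?t ?u \<otimes>\<^sub>m Id M x) =
      flat s (nf_obj t ?y) \<cdot> (Id M ?s \<otimes>\<^sub>m flat t ?y) \<cdot> (Id M ?s \<otimes>\<^sub>m Id M ?t \<otimes>\<^sub>m flat u x) \<cdot>
      ((Id M ?s \<otimes>\<^sub>m assoc M ?t ?u x) \<cdot> assoc M ?s (?t \<otimes> ?u) x \<cdot> (assoc M ?s ?t ?u \<otimes>\<^sub>m Id M x))"
    by (simp add: interchange)
  also have "\<dots> = flat s (nf_obj t ?y) \<cdot> (Id M ?s \<otimes>\<^sub>m flat t ?y) \<cdot>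
      ((Id M ?s \<otimes>\<^sub>m Id M ?t \<otimes>\<^sub>m flat u x) \<cdot> assoc M ?s ?t (?u \<otimes> x)) \<cdot> assoc M (?s \<otimes> ?t) ?u x"
    by (subst pentagon[symmetric]) simp_all
  also have "\<dots> = flat (Node (Node s t) u) x"
    by (subst assoc_nat[symmetric, of _ _ _ _ _ _ ?s ?t ?y]) simp_all
  finally show ?thesis .
qed

lemma flat_lunit:
  assumes [simp]: "wf_tree t" "x \<in> Obj M"
  shows "flat t x \<cdot> (lunit M (obj_of t) \<otimes>\<^sub>m Id M x) = flat (Node Unit t) x"
proof -
  have "flat (Node Unit t) x = (lunit M (Cod M (flat t x)) \<cdot> (Id M (unit_obj M) \<otimes>\<^sub>m flat t x)) \<cdot>
      assoc M (unit_obj M) (obj_of t) x"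
    by simp
  also have "\<dots> = flat t x \<cdot> (lunit M (obj_of t) \<otimes>\<^sub>m Id M x)"
    by (subst lunit_nat) (simp_all flip: lunit_tensor)
  finally show ?thesis ..
qed

lemma flat_runit:
  assumes [simp]: "wf_tree t" "x \<in> Obj M"
  shows "flat t x \<cdot> (runit M (obj_of t) \<otimes>\<^sub>m Id M x) = flat (Node t Unit) x"
  by (simp flip: triangle)

text \<open>By induction, \<open>hat\<close> is conjugation by flattenings. In the
  \<open>Par\<close> case, naturality of the associator and \<open>flat_nat\<close> allow the two
  factors to be flattened one after the other; the structural arrows are absorbed into
  \<open>flat\<close>.\<close>

lemma hat_correct:
  "wf_expr e \<Longrightarrow> x \<in> Obj M \<Longrightarrow> flat (ecod e) x \<cdot> (arr_of e \<otimes>\<^sub>m Id M x) = hat e x \<cdot> flat (edom e) x"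
proof (induction e arbitrary: x)
  case (Gen s t f)
  then show ?case by (simp add: hgen_def)
next
  case (Seq g f)
  have [simp]: "wf_expr g" "wf_expr f" "ecod f = edom g" "x \<in> Obj M" using Seq by auto
  have "flat (ecod (Seq g f)) x \<cdot> (arr_of (Seq g f) \<otimes>\<^sub>m Id M x) =
      (flat (ecod g) x \<cdot> (arr_of g \<otimes>\<^sub>m Id M x)) \<cdot> (arr_of f \<otimes>\<^sub>m Id M x)"
    by (simp add: interchange)
  also have "\<dots> = hat g x \<cdot> flat (ecod f) x \<cdot> (arr_of f \<otimes>\<^sub>m Id M x)"
    by (subst Seq.IH(1)) simp_all
  also have "\<dots> = hat (Seq g f) x \<cdot> flat (edom f) x"
    by (subst Seq.IH(2)) simp_all
  finally show ?case by simp
next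
  case (Par f g)
  have [simp]: "wf_expr g" "wf_expr f" "x \<in> Obj M" using Par by auto
  let ?s = "obj_of (edom f)" and ?s' = "obj_of (ecod f)" and ?t = "obj_of (edom g)"
      and ?t' = "obj_of (ecod g)"
  have "flat (ecod (Par f g)) x \<cdot> (arr_of (Par f g) \<otimes>\<^sub>m Id M x) =
      flat (ecod f) (nf_obj (ecod g) x) \<cdot> (Id M ?s' \<otimes>\<^sub>m flat (ecod g) x) \<cdot>
        (assoc M ?s' ?t' x \<cdot> ((arr_of f \<otimes>\<^sub>m arr_of g) \<otimes>\<^sub>m Id M x))"
    by simp
  also have "\<dots> = flat (ecod f) (nf_obj (ecod g) x) \<cdot>
      ((Id M ?s' \<otimes>\<^sub>m flat (ecod g) x) \<cdot> (arr_of f \<otimes>\<^sub>m arr_of g \<otimes>\<^sub>m Id M x)) \<cdot> assoc M ?s ?t x"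
    by (subst assoc_nat[of _ _ _ ?s ?t x]) simp_all
  also have "\<dots> = flat (ecod f) (nf_obj (ecod g) x) \<cdot> (arr_of f \<otimes>\<^sub>m (hat g x \<cdot> flat (edom g) x)) \<cdot>
      assoc M ?s ?t x"
    by (simp add: interchange Par.IH)
  also have "\<dots> = (flat (ecod f) (nf_obj (ecod g) x) \<cdot> (arr_of f \<otimes>\<^sub>m Id M (nf_obj (ecod g) x))) \<cdot>
      (Id M ?s \<otimes>\<^sub>m hat g x) \<cdot> (Id M ?s \<otimes>\<^sub>m flat (edom g) x) \<cdot> assoc M ?s ?t x"
    by (simp add: interchange)
  also have "\<dots> = hat f (nf_obj (ecod g) x) \<cdot> (flat (edom f) (Cod M (hat g x)) \<cdot>
      (Id M ?s \<otimes>\<^sub>m hat g x)) \<cdot>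
      (Id M ?s \<otimes>\<^sub>m flat (edom g) x) \<cdot> assoc M ?s ?t x"
    by (subst Par.IH) simp_all
  also have "\<dots> = hat (Par f g) x \<cdot> flat (edom (Par f g)) x"
    by (subst flat_nat) simp_all
  finally show ?case .
next
  case (Asc s t u)
  then show ?case using flat_assoc[of s t u x] by (simp del: flat.simps)
next
  case (AscI s t u)
  have [simp]: "wf_tree s" "wf_tree t" "wf_tree u" "x \<in> Obj M" using AscI by auto
  let ?a = "assoc M (obj_of s) (obj_of t) (obj_of u)"
  have "flat (Node (Node s t) u) x \<cdot> (inv_arr M ?a \<otimes>\<^sub>m Id M x) =
      flat (Node s (Node t u)) x \<cdot> (?a \<otimes>\<^sub>m Id M x) \<cdot> (inv_arr M ?a \<otimes>\<^sub>m Id M x)"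
    by (subst flat_assoc[symmetric]) (simp_all del: flat.simps)
  also have "\<dots> = flat (Node s (Node t u)) x"
    by (simp add: interchange del: flat.simps)
  finally show ?case by (simp del: flat.simps)
next
  case (Lun t)
  then show ?case using flat_lunit[of t x] by (simp del: flat.simps)
next
  case (Run t)
  then show ?case using flat_runit[of t x] by (simp del: flat.simps)
qed simp_all

theorem arr_of_eq_iff:
  assumes "wf_expr e" "wf_expr e'" "edom e = edom e'" "ecod e = ecod e'"
  shows "arr_of e = arr_of e' \<longleftrightarrow> (\<forall>x \<in> Obj M. hat e x = hat e' x)"
proof
  assume eq: "arr_of e = arr_of e'"
  show "\<forall>x \<in> Obj M. hat e x = hat e' x"
  proof
    fix x assume "x \<in> Obj M"
    then show "hat e x = hat e' x"
    proof (intro iso_cancel_right[of "flat (edom e') x" "hat e x"])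
      show "hat e x \<cdot> flat (edom e') x = hat e' x \<cdot> flat (edom e') x"
        using hat_correct[OF assms(1) \<open>x \<in> Obj M\<close>] hat_correct[OF assms(2) \<open>x \<in> Obj M\<close>]
        unfolding eq assms(3,4) by (rule trans[OF sym])
    qed (use assms in simp_all)
  qed
next
  assume eq: "\<forall>x \<in> Obj M. hat e x = hat e' x"
  \<comment> \<open>The single instance \<open>x = ?I\<close> suffices here, because tensoring with
    the unit on the right is faithful.\<close>
  let ?I = "unit_obj M"
  have "flat (ecod e') ?I \<cdot> (arr_of e \<otimes>\<^sub>m Id M ?I) = flat (ecod e') ?I \<cdot> (arr_of e' \<otimes>\<^sub>m Id M ?I)"
    using hat_correct[OF assms(1) unit_Obj] hat_correct[OF assms(2) unit_Obj]
    unfolding bspec[OF eq unit_Obj] assms(3,4) by (rule trans[OF _ sym])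
  then have "arr_of e \<otimes>\<^sub>m Id M ?I = arr_of e' \<otimes>\<^sub>m Id M ?I"
    by (rule iso_cancel_left[rotated -1]) (use assms in simp_all)
  then show "arr_of e = arr_of e'"
    by (rule tensor_unit_faithful[rotated -1]) (use assms in simp_all)
qed

lemma arr_eqI:
  assumes "wf_expr e" "wf_expr e'" "edom e = edom e'" "ecod e = ecod e'"
    and "arr_of e = f" "arr_of e' = g" "\<And>x. x \<in> Obj M \<Longrightarrow> hat e x = hat e' x"
  shows "f = g"
  using arr_of_eq_iff[OF assms(1-4)] assms(5-7) by blast

lemma hat_eqI:
  assumes "arr_of e = arr_of e'" "wf_expr e" "wf_expr e'" "edom e = edom e'" "ecod e = ecod e'"
      "x \<in> Obj M"
  shows "hat e x = hat e' x"
  using arr_of_eq_iff[OF assms(2-5)] assms(1,6) by blast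

lemma lunit_runit_unit: "lunit M (unit_obj M) = runit M (unit_obj M)"
  by (rule arr_eqI[of "Lun Unit" "Run Unit"]) simp_all

end

section \<open>Cocommutative comonoids\<close>

definition comon_coc :: "('o, 'm, 'z) smc_scheme \<Rightarrow> ('o, 'm) comonoid_obj \<Rightarrow> bool" where
  "comon_coc M X \<longleftrightarrow> is_comonoid M X \<and> is_cocommutative M X"

definition comon_hom ::
  "('o, 'm, 'z) smc_scheme \<Rightarrow> ('o, 'm) comonoid_obj \<Rightarrow> ('o, 'm) comonoid_obj \<Rightarrow> 'm \<Rightarrow> bool" where
  "comon_hom M X Y f \<longleftrightarrow> f \<in> hset M (com_obj X) (com_obj Y) \<and> is_comonoid_arr M X Y f"

definition comon_prod ::
  "('o, 'm, 'z) smc_scheme \<Rightarrow> ('o, 'm) comonoid_obj \<Rightarrow> ('o, 'm) comonoid_obj \<Rightarrow> ('o, 'm) comonoid_obj"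
where
  "comon_prod M X Y =
    \<lparr>com_obj = com_obj X \<otimes> com_obj Y,
     com_comult = midswap M (com_obj X) (com_obj X) (com_obj Y) (com_obj Y) \<cdot>
         (com_comult X \<otimes>\<^sub>m com_comult Y),
     com_counit = lunit M (unit_obj M) \<cdot> (com_counit X \<otimes>\<^sub>m com_counit Y)\<rparr>"
  for M (structure)

definition proj1 ::
  "('o, 'm, 'z) smc_scheme \<Rightarrow> ('o, 'm) comonoid_obj \<Rightarrow> ('o, 'm) comonoid_obj \<Rightarrow> 'm" where
  "proj1 M X Y = runit M (com_obj X) \<cdot> (Id M (com_obj X) \<otimes>\<^sub>m com_counit Y)"
  for M (structure)

definition proj2 ::
  "('o, 'm, 'z) smc_scheme \<Rightarrow> ('o, 'm) comonoid_obj \<Rightarrow> ('o, 'm) comonoid_obj \<Rightarrow> 'm" where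
  "proj2 M X Y = lunit M (com_obj Y) \<cdot> (com_counit X \<otimes>\<^sub>m Id M (com_obj Y))"
  for M (structure)

definition pairing :: "('o, 'm, 'z) smc_scheme \<Rightarrow> ('o, 'm) comonoid_obj \<Rightarrow> 'm \<Rightarrow> 'm \<Rightarrow> 'm" where
  "pairing M T f g = (f \<otimes>\<^sub>m g) \<cdot> com_comult T"
  for M (structure)

lemma comon_prod_simps [simp]: "com_obj (comon_prod M X Y) = tensor_obj M (com_obj X) (com_obj Y)"
  by (simp add: comon_prod_def)

section \<open>Symmetries in flattened form\<close>

context symmetric_monoidal_category
begin

lemma whisker_comp:
  "a \<in> Obj M \<Longrightarrow> f \<in> Arr M \<Longrightarrow> g \<in> Arr M \<Longrightarrow> Cod M f = Dom M g \<Longrightarrow>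
    Id M a \<otimes>\<^sub>m (g \<cdot> f) = (Id M a \<otimes>\<^sub>m g) \<cdot> (Id M a \<otimes>\<^sub>m f)"
  by (simp add: interchange)

text \<open>The symmetry is not removed by flattening. It is treated as a generator between
  composite words, so that its axioms can be restated without associators.\<close>

definition shat :: "'o tree \<Rightarrow> 'o tree \<Rightarrow> 'o \<Rightarrow> 'm" where
  "shat s t = hgen (Node s t) (Node t s) (symm M (obj_of s) (obj_of t))"

lemma shat_arr [simp]:
  assumes "wf_tree s" "wf_tree t" "x \<in> Obj M"
  shows "shat s t x \<in> Arr M" "Dom M (shat s t x) = nf_obj s (nf_obj t x)"
    "Cod M (shat s t x) = nf_obj t (nf_obj s x)"
  using assms by (simp_all add: shat_def)

lemma shat_nat:
  assumes "wf_tree s" "wf_tree t" "k \<in> Arr M"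
  shows "shat s t (Cod M k) \<cdot> nf_arr s (nf_arr t k) = nf_arr t (nf_arr s k) \<cdot> shat s t (Dom M k)"
  using hgen_nat[of "Node s t" "Node t s" "symm M (obj_of s) (obj_of t)" k] assms
  by (simp add: shat_def)

lemma shat_shat:
  assumes "wf_tree s" "wf_tree t" "x \<in> Obj M"
  shows "shat t s x \<cdot> shat s t x = Id M (nf_obj s (nf_obj t x))"
  using hat_eqI[of "Seq (Gen (Node t s) (Node s t) (symm M (obj_of t) (obj_of s)))
      (Gen (Node s t) (Node t s) (symm M (obj_of s) (obj_of t)))" "Ide (Node s t)" x] assms
  by (simp add: shat_def symm_symm)

lemma shat_slide1:
  assumes "wf_tree s" "wf_tree s'" "wf_tree t" "f \<in> Arr M" "Dom M f = obj_of s" "Cod M f =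
      obj_of s'" "x \<in> Obj M"
  shows "shat s' t x \<cdot> hgen s s' f (nf_obj t x) = nf_arr t (hgen s s' f x) \<cdot> shat s t x"
  using hat_eqI[of "Seq (Gen (Node s' t) (Node t s') (symm M (obj_of s') (obj_of t))) (Par (Gen s s'
      f) (Ide t))"
      "Seq (Par (Ide t) (Gen s s' f)) (Gen (Node s t) (Node t s) (symm M (obj_of s) (obj_of t)))" x]
    symm_nat[of f "Id M (obj_of t)"] assms
  by (simp add: shat_def)

lemma shat_slide2:
  assumes "wf_tree s" "wf_tree s'" "wf_tree t" "f \<in> Arr M" "Dom M f = obj_of s" "Cod M f =
      obj_of s'" "x \<in> Obj M"
  shows "shat t s' x \<cdot> nf_arr t (hgen s s' f x) = hgen s s' f (nf_obj t x) \<cdot> shat t s x"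
  using hat_eqI[of "Seq (Gen (Node t s') (Node s' t) (symm M (obj_of t) (obj_of s'))) (Par (Ide t)
      (Gen s s' f))"
      "Seq (Par (Gen s s' f) (Ide t)) (Gen (Node t s) (Node s t) (symm M (obj_of t) (obj_of s)))" x]
    symm_nat[of "Id M (obj_of t)" f] assms
  by (simp add: shat_def)

text \<open>The hexagon with its three associators turned into identities.\<close>

lemma shat_hexagon1:
  assumes "wf_tree s" "wf_tree t" "wf_tree u" "x \<in> Obj M"
  shows "shat s (Node t u) x = nf_arr t (shat s u x) \<cdot> shat s t (nf_obj u x)"
  using hat_eqI[of "Seq (Asc t u s) (Seq (Gen (Node s (Node t u)) (Node (Node t u) s) (symm M
      (obj_of s) (obj_of t \<otimes> obj_of u))) (Asc s t u))"
      "Seq (Par (Ide t) (Gen (Node s u) (Node u s) (symm M (obj_of s) (obj_of u)))) (Seq (Asc t s u)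
          
        (Par (Gen (Node s t) (Node t s) (symm M (obj_of s) (obj_of t))) (Ide u)))" x]
    hexagon[of "obj_of s" "obj_of t" "obj_of u"] assms
  by (simp add: shat_def)

text \<open>The second hexagon is the inverse of the first one, since a symmetry is inverted by
  exchanging its arguments.\<close>

lemma shat_hexagon2:
  assumes [simp]: "wf_tree s" "wf_tree t" "wf_tree u" "x \<in> Obj M"
  shows "shat (Node s t) u x = shat s u (nf_obj t x) \<cdot> nf_arr s (shat t u x)"
proof -
  have 1: "nf_arr s (shat u t x) \<cdot> nf_arr s (shat t u x) = Id M (nf_obj s (nf_obj t (nf_obj u x)))"
    by (simp add: shat_shat flip: nf_arr_comp)
  have "shat s u (nf_obj t x) \<cdot> nf_arr s (shat t u x) =
      (shat (Node s t) u x \<cdot> shat u (Node s t) x) \<cdot> shat s u (nf_obj t x) \<cdot> nf_arr s (shat t u x)"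
    by (subst shat_shat) simp_all
  also have "\<dots> = shat (Node s t) u x \<cdot> nf_arr s (shat u t x) \<cdot>
      (shat u s (nf_obj t x) \<cdot> shat s u (nf_obj t x)) \<cdot> nf_arr s (shat t u x)"
    by (simp add: shat_hexagon1)
  also have "\<dots> = shat (Node s t) u x"
    by (simp add: shat_shat 1)
  finally show ?thesis ..
qed

text \<open>Read as a generator, the unitor of the unit still has a trivial transport, because
  \<open>Lun Unit\<close> denotes the same arrow. This lets \<open>shat_slide2\<close> be applied to
  it.\<close>

lemma hgen_lunit: "x \<in> Obj M \<Longrightarrow> hgen (Node Unit Unit) Unit (lunit M (unit_obj M)) x = Id M x"
  using hat_eqI[of "Gen (Node Unit Unit) Unit (lunit M (unit_obj M))" "Lun Unit" x] by simp

text \<open>By naturality along \<open>1 \<otimes> 1 \<cong> 1\<close> and the hexagon, \<open>shat s Unit x\<close> is idempotent.\<close>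

lemma shat_unit:
  assumes [simp]: "wf_tree s" "x \<in> Obj M"
  shows "shat s Unit x = Id M (nf_obj s x)" "shat Unit s x = Id M (nf_obj s x)"
proof -
  have "shat s Unit x \<cdot> shat s Unit x = shat s Unit x"
    using shat_slide2[of "Node Unit Unit" Unit s "lunit M (unit_obj M)" x]
    by (simp add: hgen_lunit shat_hexagon1)
  then have "shat Unit s x \<cdot> shat s Unit x \<cdot> shat s Unit x = shat Unit s x \<cdot> shat s Unit x" by simp
  then have "(shat Unit s x \<cdot> shat s Unit x) \<cdot> shat s Unit x = shat Unit s x \<cdot> shat s Unit x"
    by simp
  then show 1: "shat s Unit x = Id M (nf_obj s x)" by (simp add: shat_shat del: assoc_comp)
  show "shat Unit s x = Id M (nf_obj s x)" using shat_shat[of s Unit x] by (simp add: 1)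
qed

definition mid_expr :: "'o tree \<Rightarrow> 'o tree \<Rightarrow> 'o tree \<Rightarrow> 'o tree \<Rightarrow> ('o, 'm) expr" where
  "mid_expr a b c d = Seq (AscI a c (Node b d)) (Seq (Par (Ide a) (Seq (Asc c b d)
    (Seq (Par (Gen (Node b c) (Node c b) (symm M (obj_of b) (obj_of c))) (Ide d)) (AscI b c d))))
    (Asc a b (Node c d)))"

lemma mid_expr [simp]:
  assumes "wf_tree a" "wf_tree b" "wf_tree c" "wf_tree d"
  shows "wf_expr (mid_expr a b c d)" "edom (mid_expr a b c d) = Node (Node a b) (Node c d)"
    "ecod (mid_expr a b c d) = Node (Node a c) (Node b d)"
    "arr_of (mid_expr a b c d) = midswap M (obj_of a) (obj_of b) (obj_of c) (obj_of d)"
    "x \<in> Obj M \<Longrightarrow> hat (mid_expr a b c d) x = nf_arr a (shat b c (nf_obj d x))"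
  using assms by (simp_all add: mid_expr_def midswap_def shat_def)

lemma midswap_arr [simp]:
  assumes "a \<in> Obj M" "b \<in> Obj M" "c \<in> Obj M" "d \<in> Obj M"
  shows "midswap M a b c d \<in> Arr M" "Dom M (midswap M a b c d) = (a \<otimes> b) \<otimes> (c \<otimes> d)"
    "Cod M (midswap M a b c d) = (a \<otimes> c) \<otimes> (b \<otimes> d)"
  using assms wf_expr_arr(3-5)[of "mid_expr (Leaf a) (Leaf b) (Leaf c) (Leaf d)"] by simp_all

lemma midswap_nat:
  assumes [simp]: "f \<in> Arr M" "g \<in> Arr M" "h \<in> Arr M" "k \<in> Arr M" and
    "Dom M f = a" "Dom M g = b" "Dom M h = c" "Dom M k = d" "Cod M f = a'" "Cod M g = b'" "Cod M h =
        c'" "Cod M k = d'"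
  shows "midswap M a' b' c' d' \<cdot> ((f \<otimes>\<^sub>m g) \<otimes>\<^sub>m (h \<otimes>\<^sub>m k)) =
    ((f \<otimes>\<^sub>m h) \<otimes>\<^sub>m (g \<otimes>\<^sub>m k)) \<cdot> midswap M a b c d"
proof -
  have o [simp]: "a \<in> Obj M" "b \<in> Obj M" "c \<in> Obj M" "d \<in> Obj M" "a' \<in> Obj M" "b' \<in> Obj M"
      "c' \<in> Obj M" "d' \<in> Obj M"
    using assms by auto
  let ?f = "Gen (Leaf a) (Leaf a') f" and ?g = "Gen (Leaf b) (Leaf b') g"
    and ?h = "Gen (Leaf c) (Leaf c') h" and ?k = "Gen (Leaf d) (Leaf d') k"
  let ?F = "hgen (Leaf a) (Leaf a') f" and ?G = "hgen (Leaf b) (Leaf b') g"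
    and ?H = "hgen (Leaf c) (Leaf c') h" and ?K = "hgen (Leaf d) (Leaf d') k"
  show ?thesis
  proof (rule arr_eqI[of "Seq (mid_expr (Leaf a') (Leaf b') (Leaf c') (Leaf d')) (Par (Par ?f ?g)
      (Par ?h ?k))"
        "Seq (Par (Par ?f ?h) (Par ?g ?k)) (mid_expr (Leaf a) (Leaf b) (Leaf c) (Leaf d))"])
    fix x assume x [simp]: "x \<in> Obj M"
    have 1: "?F y \<cdot> (Id M a \<otimes>\<^sub>m l) = (Id M a' \<otimes>\<^sub>m l) \<cdot> ?F (Dom M l)"
      if "l \<in> Arr M" "Cod M l = y" for l y
      using hgen_nat[of "Leaf a" "Leaf a'" f l] assms that by simp
    \<comment> \<open>The equation on the strands behind \<open>f\<close>: \<open>g\<close> and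
      \<open>h\<close> slide through the crossing by \<open>shat_slide1\<close> and
      \<open>shat_slide2\<close>, and \<open>k\<close> acts behind it.\<close>
    have 3: "shat (Leaf b') (Leaf c') (d' \<otimes> x) \<cdot> ?G (c' \<otimes> d' \<otimes> x) \<cdot> (Id M b \<otimes>\<^sub>m (?H (d' \<otimes> x) \<cdot>
        (Id M c \<otimes>\<^sub>m ?K x))) =
       ?H (b' \<otimes> d' \<otimes> x) \<cdot> (Id M c \<otimes>\<^sub>m (?G (d' \<otimes> x) \<cdot> (Id M b \<otimes>\<^sub>m ?K x))) \<cdot>
           shat (Leaf b) (Leaf c) (d \<otimes> x)"
    proof -
      have "shat (Leaf b') (Leaf c') (d' \<otimes> x) \<cdot> ?G (c' \<otimes> d' \<otimes> x) \<cdot> (Id M b \<otimes>\<^sub>m (?H (d' \<otimes> x) \<cdot>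
          (Id M c \<otimes>\<^sub>m ?K x))) =
        (shat (Leaf b') (Leaf c') (d' \<otimes> x) \<cdot> ?G (nf_obj (Leaf c') (d' \<otimes> x))) \<cdot>
            (Id M b \<otimes>\<^sub>m (?H (d' \<otimes> x) \<cdot> (Id M c \<otimes>\<^sub>m ?K x)))"
        using assms by simp
      also have "\<dots> = (Id M c' \<otimes>\<^sub>m ?G (d' \<otimes> x)) \<cdot> (shat (Leaf b) (Leaf c') (d' \<otimes> x) \<cdot>
          nf_arr (Leaf b) (?H (d' \<otimes> x))) \<cdot> (Id M b \<otimes>\<^sub>m Id M c \<otimes>\<^sub>m ?K x)"
        using assms by (subst shat_slide1) (simp_all add: whisker_comp)
      also have "\<dots> = (Id M c' \<otimes>\<^sub>m ?G (d' \<otimes> x)) \<cdot> ?H (b \<otimes> d' \<otimes> x) \<cdot>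
          (shat (Leaf b) (Leaf c) (Cod M (?K x)) \<cdot> nf_arr (Leaf b) (nf_arr (Leaf c) (?K x)))"
        using assms by (subst shat_slide2) (simp_all)
      also have "\<dots> = ((Id M c' \<otimes>\<^sub>m ?G (d' \<otimes> x)) \<cdot> ?H (Dom M (?G (d' \<otimes> x)))) \<cdot>
          (Id M c \<otimes>\<^sub>m Id M b \<otimes>\<^sub>m ?K x) \<cdot> shat (Leaf b) (Leaf c) (d \<otimes> x)"
        using assms by (subst shat_nat) (simp_all)
      also have "(Id M c' \<otimes>\<^sub>m ?G (d' \<otimes> x)) \<cdot> ?H (Dom M (?G (d' \<otimes> x))) = ?H (b' \<otimes> d' \<otimes> x) \<cdot>
          (Id M c \<otimes>\<^sub>m ?G (d' \<otimes> x))"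
        using assms hgen_nat[of "Leaf c" "Leaf c'" h "?G (d' \<otimes> x)"] by simp
      finally show ?thesis using assms by (simp add: whisker_comp)
    qed
    show "hat (Seq (mid_expr (Leaf a') (Leaf b') (Leaf c') (Leaf d')) (Par (Par ?f ?g) (Par ?h ?k)))
        x =
      hat (Seq (Par (Par ?f ?h) (Par ?g ?k)) (mid_expr (Leaf a) (Leaf b) (Leaf c) (Leaf d))) x"
      using assms arg_cong[OF 3, of "\<lambda>l. (Id M a' \<otimes>\<^sub>m l) \<cdot> ?F (b \<otimes> c \<otimes> d \<otimes> x)"]
      by (simp add: 1 comp_tail[OF 1] whisker_comp)
  qed (use assms in simp_all)
qed

section \<open>Comonoid structures in flattened form\<close>

lemma comon_cocD:
  assumes "comon_coc M X"
  shows "com_obj X \<in> Obj M" "com_comult X \<in> Arr M" "Dom M (com_comult X) = com_obj X"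
    "Cod M (com_comult X) = com_obj X \<otimes> com_obj X" "com_counit X \<in> Arr M" "Dom M (com_counit X) =
        com_obj X"
    "Cod M (com_counit X) = unit_obj M"
    "assoc M (com_obj X) (com_obj X) (com_obj X) \<cdot> (com_comult X \<otimes>\<^sub>m Id M (com_obj X)) \<cdot>
        com_comult X =
      (Id M (com_obj X) \<otimes>\<^sub>m com_comult X) \<cdot> com_comult X"
    "lunit M (com_obj X) \<cdot> (com_counit X \<otimes>\<^sub>m Id M (com_obj X)) \<cdot> com_comult X = Id M (com_obj X)"
    "runit M (com_obj X) \<cdot> (Id M (com_obj X) \<otimes>\<^sub>m com_counit X) \<cdot> com_comult X = Id M (com_obj X)"
    "symm M (com_obj X) (com_obj X) \<cdot> com_comult X = com_comult X"
  using assms by (auto simp: comon_coc_def is_comonoid_def is_cocommutative_def Let_def in_hset)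

text \<open>Only one counit law is assumed. Cocommutativity carries it to the other one, because
  composing \<open>lunit\<close> with the symmetry gives \<open>runit\<close>.\<close>

lemma comon_cocI:
  assumes "com_obj X = x" "com_comult X = d" "com_counit X = e"
    "x \<in> Obj M" "d \<in> Arr M" "Dom M d = x" "Cod M d = x \<otimes> x" "e \<in> Arr M" "Dom M e = x"
    "Cod M e = unit_obj M" "assoc M x x x \<cdot> (d \<otimes>\<^sub>m Id M x) \<cdot> d = (Id M x \<otimes>\<^sub>m d) \<cdot> d"
    "lunit M x \<cdot> (e \<otimes>\<^sub>m Id M x) \<cdot> d = Id M x" "symm M x x \<cdot> d = d"
  shows "comon_coc M X"
proof -
  have "runit M x \<cdot> (Id M x \<otimes>\<^sub>m e) \<cdot> d = lunit M x \<cdot> (e \<otimes>\<^sub>m Id M x) \<cdot> d"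
  proof -
    have [simp]: "lunit M x \<cdot> symm M x (unit_obj M) = runit M x"
      using assms(4) shat_unit[of "Leaf x"]
      by (rule_tac arr_eqI[of "Seq (Lun (Leaf x)) (Gen (Node (Leaf x) Unit) (Node Unit (Leaf x))
          (symm M x (unit_obj M)))" "Run (Leaf x)"])
        (simp_all add: shat_def)
    have "runit M x \<cdot> (Id M x \<otimes>\<^sub>m e) \<cdot> d = lunit M x \<cdot> (symm M x (Cod M e) \<cdot> (Id M x \<otimes>\<^sub>m e)) \<cdot> d"
      using assms by (simp flip: assoc_comp)
    also have "\<dots> = lunit M x \<cdot> (e \<otimes>\<^sub>m Id M x) \<cdot> (symm M x x \<cdot> d)"
      using assms(4-10) symm_nat[of "Id M x" e] by simp
    finally show ?thesis by (simp only: assms(13))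
  qed
  then show ?thesis
    using assms by (simp add: comon_coc_def is_comonoid_def is_cocommutative_def Let_def in_hset)
qed

definition dhat :: "('o, 'm) comonoid_obj \<Rightarrow> 'o \<Rightarrow> 'm" where
  "dhat X = hgen (Leaf (com_obj X)) (Node (Leaf (com_obj X)) (Leaf (com_obj X))) (com_comult X)"

definition ehat :: "('o, 'm) comonoid_obj \<Rightarrow> 'o \<Rightarrow> 'm" where
  "ehat X = hgen (Leaf (com_obj X)) Unit (com_counit X)"

abbreviation symm_hat :: "'o \<Rightarrow> 'o \<Rightarrow> 'o \<Rightarrow> 'm" where
  "symm_hat x y \<equiv> shat (Leaf x) (Leaf y)"

lemma hat_comonoid_arr [simp]:
  assumes "comon_coc M X" "z \<in> Obj M"
  shows "dhat X z \<in> Arr M" "Dom M (dhat X z) = com_obj X \<otimes> z" "Cod M (dhat X z) =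
      com_obj X \<otimes> com_obj X \<otimes> z"
    "ehat X z \<in> Arr M" "Dom M (ehat X z) = com_obj X \<otimes> z" "Cod M (ehat X z) = z"
  using comon_cocD[OF assms(1)] assms(2) by (simp_all add: dhat_def ehat_def)

lemma hat_comonoid:
  assumes X: "comon_coc M X" and z [simp]: "z \<in> Obj M" and x: "x = com_obj X"
  shows "dhat X (x \<otimes> z) \<cdot> dhat X z = (Id M x \<otimes>\<^sub>m dhat X z) \<cdot> dhat X z"
    "ehat X (x \<otimes> z) \<cdot> dhat X z = Id M (x \<otimes> z)"
    "(Id M x \<otimes>\<^sub>m ehat X z) \<cdot> dhat X z = Id M (x \<otimes> z)"
    "symm_hat x x z \<cdot> dhat X z = dhat X z"
proof -
  note [simp] = comon_cocD[OF X, folded x]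
  let ?x = "Leaf x"
  let ?d = "Gen ?x (Node ?x ?x) (com_comult X)" and ?e = "Gen ?x Unit (com_counit X)"
  show "dhat X (x \<otimes> z) \<cdot> dhat X z = (Id M x \<otimes>\<^sub>m dhat X z) \<cdot> dhat X z"
    using hat_eqI[of "Seq (Asc ?x ?x ?x) (Seq (Par ?d (Ide ?x)) ?d)" "Seq (Par (Ide ?x) ?d) ?d" z]
    by (simp add: dhat_def flip: x)
  show "ehat X (x \<otimes> z) \<cdot> dhat X z = Id M (x \<otimes> z)"
    using hat_eqI[of "Seq (Lun ?x) (Seq (Par ?e (Ide ?x)) ?d)" "Ide ?x" z]
    by (simp add: dhat_def ehat_def flip: x)
  show "(Id M x \<otimes>\<^sub>m ehat X z) \<cdot> dhat X z = Id M (x \<otimes> z)"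
    using hat_eqI[of "Seq (Run ?x) (Seq (Par (Ide ?x) ?e) ?d)" "Ide ?x" z]
    by (simp add: dhat_def ehat_def flip: x)
  show "symm_hat x x z \<cdot> dhat X z = dhat X z"
    using hat_eqI[of "Seq (Gen (Node ?x ?x) (Node ?x ?x) (symm M x x)) ?d" ?d z]
    by (simp add: dhat_def shat_def flip: x)
qed

lemma hat_comonoid_nat:
  assumes X: "comon_coc M X" and "k \<in> Arr M" and x: "x = com_obj X" and "Cod M k = z'" "Dom M k = z"
  shows "dhat X z' \<cdot> (Id M x \<otimes>\<^sub>m k) = (Id M x \<otimes>\<^sub>m Id M x \<otimes>\<^sub>m k) \<cdot> dhat X z"
    "ehat X z' \<cdot> (Id M x \<otimes>\<^sub>m k) = k \<cdot> ehat X z"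
  using comon_cocD[OF X] hgen_nat[of "Leaf x" "Node (Leaf x) (Leaf x)" "com_comult X" k]
    hgen_nat[of "Leaf x" Unit "com_counit X" k] assms(2-5)
  by (simp_all add: dhat_def ehat_def)

text \<open>A comultiplication that passes a crossing duplicates it, and a counit that passes a
  crossing removes it: this is naturality of the symmetry, followed by a hexagon or by
  \<open>shat_unit\<close>.\<close>

lemma hat_comonoid_symm:
  assumes X: "comon_coc M X" and z [simp]: "z \<in> Obj M" and x: "x = com_obj X"
      and y [simp]: "y \<in> Obj M"
  shows "(Id M y \<otimes>\<^sub>m dhat X z) \<cdot> symm_hat x y z =
      symm_hat x y (x \<otimes> z) \<cdot> (Id M x \<otimes>\<^sub>m symm_hat x y z) \<cdot> dhat X (y \<otimes> z)"
    "dhat X (y \<otimes> z) \<cdot> symm_hat y x z =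
      (Id M x \<otimes>\<^sub>m symm_hat y x z) \<cdot> symm_hat y x (x \<otimes> z) \<cdot> (Id M y \<otimes>\<^sub>m dhat X z)"
    "(Id M y \<otimes>\<^sub>m ehat X z) \<cdot> symm_hat x y z = ehat X (y \<otimes> z)"
    "ehat X (y \<otimes> z) \<cdot> symm_hat y x z = Id M y \<otimes>\<^sub>m ehat X z"
proof -
  note [simp] = comon_cocD[OF X, folded x]
  let ?x = "Leaf x" and ?y = "Leaf y"
  show "(Id M y \<otimes>\<^sub>m dhat X z) \<cdot> symm_hat x y z =
      symm_hat x y (x \<otimes> z) \<cdot> (Id M x \<otimes>\<^sub>m symm_hat x y z) \<cdot> dhat X (y \<otimes> z)"
    using shat_slide1[of ?x "Node ?x ?x" ?y "com_comult X" z]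
      by (simp add: dhat_def shat_hexagon2 flip: x)
  show "dhat X (y \<otimes> z) \<cdot> symm_hat y x z =
      (Id M x \<otimes>\<^sub>m symm_hat y x z) \<cdot> symm_hat y x (x \<otimes> z) \<cdot> (Id M y \<otimes>\<^sub>m dhat X z)"
    using shat_slide2[of ?x "Node ?x ?x" ?y "com_comult X" z]
      by (simp add: dhat_def shat_hexagon1 flip: x)
  show "(Id M y \<otimes>\<^sub>m ehat X z) \<cdot> symm_hat x y z = ehat X (y \<otimes> z)"
    using shat_slide1[of ?x Unit ?y "com_counit X" z] by (simp add: ehat_def shat_unit flip: x)
  show "ehat X (y \<otimes> z) \<cdot> symm_hat y x z = Id M y \<otimes>\<^sub>m ehat X z"
    using shat_slide2[of ?x Unit ?y "com_counit X" z] by (simp add: ehat_def shat_unit flip: x)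
qed

lemma symm_hat_nat:
  assumes "x \<in> Obj M" "y \<in> Obj M" "k \<in> Arr M" "Cod M k = z'" "Dom M k = z"
  shows "symm_hat x y z' \<cdot> (Id M x \<otimes>\<^sub>m Id M y \<otimes>\<^sub>m k) = (Id M y \<otimes>\<^sub>m Id M x \<otimes>\<^sub>m k) \<cdot> symm_hat x y z"
  using shat_nat[of "Leaf x" "Leaf y" k] assms by simp

lemma whisker_eq:
  assumes "f \<cdot> g = h" "f \<in> Arr M" "g \<in> Arr M" "a \<in> Obj M" "Cod M g = Dom M f"
  shows "(Id M a \<otimes>\<^sub>m f) \<cdot> (Id M a \<otimes>\<^sub>m g) = Id M a \<otimes>\<^sub>m h"
  unfolding assms(1)[symmetric] by (rule whisker_comp[symmetric]) (use assms in simp_all)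

context
  fixes X Y :: "('o, 'm) comonoid_obj" and x y
  assumes X: "comon_coc M X" and Y: "comon_coc M Y" and x: "x = com_obj X" and y: "y = com_obj Y"
begin

private lemma obj [simp]: "x \<in> Obj M" "y \<in> Obj M" "com_obj X = x" "com_obj Y = y"
  using comon_cocD[OF X] comon_cocD[OF Y] x y by auto

text \<open>The flattened comultiplication of \<open>X \<otimes> Y\<close>: split both strands, then
  exchange the middle pair.\<close>

definition prod_hat :: "'o \<Rightarrow> 'm" where
  "prod_hat z = (Id M x \<otimes>\<^sub>m symm_hat x y (y \<otimes> z)) \<cdot> dhat X (y \<otimes> y \<otimes> z) \<cdot> (Id M x \<otimes>\<^sub>m dhat Y z)"

private abbreviation (input) "s \<equiv> symm_hat x y"
private abbreviation (input) "wx k \<equiv> Id M x \<otimes>\<^sub>m k"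
private abbreviation (input) "wy k \<equiv> Id M y \<otimes>\<^sub>m k"

lemma prod_hat_arr [simp]:
  assumes "z \<in> Obj M"
  shows "prod_hat z \<in> Arr M" "Dom M (prod_hat z) = x \<otimes> y \<otimes> z" "Cod M (prod_hat z) =
      x \<otimes> y \<otimes> x \<otimes> y \<otimes> z"
  using assms X Y by (simp_all add: prod_hat_def)

text \<open>Operations on different strands commute. The equations are oriented for rewriting:
  comultiplications of \<open>X\<close> move towards the source and crossings towards the target.
  The primed versions are the same rules under further whiskering.\<close>

private lemma rules:
  shows hx: "k \<in> Arr M \<Longrightarrow> Cod M k = z' \<Longrightarrow> dhat X z' \<cdot> wx k = wx (wx k) \<cdot> dhat X (Dom M k)"
    and hx': "k \<in> Arr M \<Longrightarrow> Cod M k = z' \<Longrightarrow> wx (dhat X z') \<cdot> wx (wx k) = wx (wx (wx k)) \<cdot>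
        wx (dhat X (Dom M k))"
    and hs: "k \<in> Arr M \<Longrightarrow> Dom M k = z' \<Longrightarrow> wy (wx k) \<cdot> s z' = s (Cod M k) \<cdot> wx (wy k)"
    and hs': "k \<in> Arr M \<Longrightarrow> Dom M k = z' \<Longrightarrow> wx (wy (wx k)) \<cdot> wx (s z') = wx (s (Cod M k)) \<cdot>
        wx (wx (wy k))"
    and hs'': "k \<in> Arr M \<Longrightarrow> Dom M k = z' \<Longrightarrow> wx (wx (wy (wx k))) \<cdot> wx (wx (s z')) =
        wx (wx (s (Cod M k))) \<cdot> wx (wx (wx (wy k)))"
proof -
  show 1: "dhat X z' \<cdot> wx k = wx (wx k) \<cdot> dhat X (Dom M k)" if "k \<in> Arr M" "Cod M k = z'" for k z'
    using hat_comonoid_nat(1)[OF X that(1) refl that(2) refl] by simp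
  show 2: "wy (wx k) \<cdot> s z' = s (Cod M k) \<cdot> wx (wy k)" if "k \<in> Arr M" "Dom M k = z'" for k z'
    using symm_hat_nat[of x y k, OF _ _ that(1) refl that(2)] by simp
  show "wx (dhat X z') \<cdot> wx (wx k) = wx (wx (wx k)) \<cdot> wx (dhat X (Dom M k))"
    if "k \<in> Arr M" "Cod M k = z'" for k z'
    using whisker_eq[OF 1[OF that], of x] that(1) X by (auto simp: whisker_comp that(2)[symmetric])
  show 3: "wx (wy (wx k)) \<cdot> wx (s z') = wx (s (Cod M k)) \<cdot> wx (wx (wy k))"
    if "k \<in> Arr M" "Dom M k = z'" for k z'
    using whisker_eq[OF 2[OF that], of x] that(1) by (simp add: whisker_comp that(2)[symmetric])
  show "wx (wx (wy (wx k))) \<cdot> wx (wx (s z')) = wx (wx (s (Cod M k))) \<cdot> wx (wx (wx (wy k)))"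
    if "k \<in> Arr M" "Dom M k = z'" for k z'
    using whisker_eq[OF 3[OF that], of x] that(1) by (simp add: whisker_comp that(2)[symmetric])
qed

text \<open>Both sides are sorted into comultiplications first and crossings last. What then remains
  is coassociativity of \<open>X\<close> and of \<open>Y\<close>, in \<open>cX\<close> and
  \<open>cY\<close>.\<close>

lemma prod_hat_coassoc:
  assumes z [simp]: "z \<in> Obj M"
  shows "prod_hat (x \<otimes> y \<otimes> z) \<cdot> prod_hat z = wx (wy (prod_hat z)) \<cdot> prod_hat z"
proof -
  note [simp] = X Y
  note n = whisker_comp
  note e1 = hat_comonoid_symm(2)[OF Y _ refl, of "y \<otimes> z" x, simplified]
  note e2 = hat_comonoid_symm(1)[OF X _ refl, of "y \<otimes> z" y, simplified]
  have e1'': "wx (wx (dhat Y (x \<otimes> y \<otimes> z))) \<cdot> wx (wx (s (y \<otimes> z))) =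
      wx (wx (wy (s (y \<otimes> z)))) \<cdot> wx (wx (s (y \<otimes> y \<otimes> z))) \<cdot> wx (wx (wx (dhat Y (y \<otimes> z))))"
    using whisker_eq[OF whisker_eq[OF e1, of x], of x] by (simp add: n)
  have e2': "wx (wy (dhat X (y \<otimes> z))) \<cdot> wx (s (y \<otimes> z)) =
      wx (s (x \<otimes> y \<otimes> z)) \<cdot> wx (wx (s (y \<otimes> z))) \<cdot> wx (dhat X (y \<otimes> y \<otimes> z))"
    using whisker_eq[OF e2, of x] by (simp add: n)
  have cY: "wx (wx (wx (dhat Y (y \<otimes> z)))) \<cdot> wx (wx (wx (dhat Y z))) = wx (wx (wx (wy (dhat Y z)))) \<cdot>
      wx (wx (wx (dhat Y z)))"
    using whisker_eq[OF whisker_eq[OF whisker_eq[OF hat_comonoid(1)[OF Y z refl], of x], of x],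
        of x] by (simp add: n)
  have cX: "dhat X (x \<otimes> y \<otimes> z) \<cdot> dhat X (y \<otimes> z) = wx (dhat X (y \<otimes> z)) \<cdot> dhat X (y \<otimes> z)"
    using hat_comonoid(1)[OF X, of "y \<otimes> z"] by simp
  show ?thesis
    by (simp add: prod_hat_def n rules cX cY e1'' e2'
      comp_tail[OF hx] comp_tail[OF hx'] comp_tail[OF hs] comp_tail[OF hs'] comp_tail[OF hs'']
          comp_tail[OF cX] comp_tail[OF cY]
      comp_tail[OF e1''] comp_tail[OF e2'])
qed

private lemma ex:
  assumes k: "k \<in> Arr M" "Cod M k = z'"
  shows "ehat X z' \<cdot> wx k = k \<cdot> ehat X (Dom M k)" "wx (ehat X z') \<cdot> wx (wx k) = wx k \<cdot>
      wx (ehat X (Dom M k))"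
proof -
  show 1: "ehat X z' \<cdot> wx k = k \<cdot> ehat X (Dom M k)"
    using hat_comonoid_nat(2)[OF X k(1) refl k(2) refl] by simp
  show "wx (ehat X z') \<cdot> wx (wx k) = wx k \<cdot> wx (ehat X (Dom M k))"
    using whisker_eq[OF 1, of x] k(1) X by (auto simp: whisker_comp k(2)[symmetric])
qed

private lemma erules:
  assumes z [simp]: "z \<in> Obj M"
  shows "wx (ehat Y (x \<otimes> z)) \<cdot> wx (s z) = wx (wx (ehat Y z))"
    and "wx (wy (ehat X z)) \<cdot> wx (s z) = wx (ehat X (y \<otimes> z))"
    and "ehat X (x \<otimes> z) \<cdot> dhat X z = Id M (x \<otimes> z)" "wx (ehat X z) \<cdot> dhat X z = Id M (x \<otimes> z)"
    and "wx (ehat Y (y \<otimes> z)) \<cdot> wx (dhat Y z) = Id M (x \<otimes> y \<otimes> z)"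
    and "wx (wx (ehat Y (y \<otimes> z))) \<cdot> wx (wx (dhat Y z)) = Id M (x \<otimes> x \<otimes> y \<otimes> z)"
    and "wx (wx (wy (ehat Y z))) \<cdot> wx (wx (dhat Y z)) = Id M (x \<otimes> x \<otimes> y \<otimes> z)"
proof -
  note [simp] = X Y
  show "wx (ehat Y (x \<otimes> z)) \<cdot> wx (s z) = wx (wx (ehat Y z))"
    using whisker_eq[OF hat_comonoid_symm(4)[OF Y z refl, of x], of x] by simp
  show "wx (wy (ehat X z)) \<cdot> wx (s z) = wx (ehat X (y \<otimes> z))"
    using whisker_eq[OF hat_comonoid_symm(3)[OF X z refl, of y], of x] by simp
  show "ehat X (x \<otimes> z) \<cdot> dhat X z = Id M (x \<otimes> z)" "wx (ehat X z) \<cdot> dhat X z = Id M (x \<otimes> z)"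
    using hat_comonoid(2,3)[OF X z] by simp_all
  show 2: "wx (ehat Y (y \<otimes> z)) \<cdot> wx (dhat Y z) = Id M (x \<otimes> y \<otimes> z)"
    using whisker_eq[OF hat_comonoid(2)[OF Y z refl], of x] by simp
  show "wx (wx (ehat Y (y \<otimes> z))) \<cdot> wx (wx (dhat Y z)) = Id M (x \<otimes> x \<otimes> y \<otimes> z)"
    using whisker_eq[OF 2, of x] by simp
  show "wx (wx (wy (ehat Y z))) \<cdot> wx (wx (dhat Y z)) = Id M (x \<otimes> x \<otimes> y \<otimes> z)"
    using whisker_eq[OF whisker_eq[OF hat_comonoid(3)[OF Y z refl], of x], of x] by simp
qed

lemma prod_hat_counit:
  assumes z [simp]: "z \<in> Obj M"
  shows "ehat X (x \<otimes> y \<otimes> z) \<cdot> wx (ehat Y (x \<otimes> y \<otimes> z)) \<cdot> prod_hat z = Id M (x \<otimes> y \<otimes> z)"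
  using X Y by (simp add: prod_hat_def hx comp_tail[OF hx] ex ex[THEN comp_tail] erules erules[THEN
      comp_tail])

text \<open>The hexagons split the exchange of \<open>x y\<close> with \<open>x y\<close> into four
  crossings. One cancels the crossing inside \<open>prod_hat\<close>, the two between equal letters
  are absorbed by cocommutativity, and the last one restores the crossing of
  \<open>prod_hat\<close>.\<close>

lemma prod_hat_symm:
  assumes z [simp]: "z \<in> Obj M"
  shows "shat (Node (Leaf x) (Leaf y)) (Node (Leaf x) (Leaf y)) z \<cdot> prod_hat z = prod_hat z"
proof -
  note [simp] = X Y
  have 1: "wx (symm_hat y x (y \<otimes> z)) \<cdot> wx (symm_hat x y (y \<otimes> z)) = Id M (x \<otimes> x \<otimes> y \<otimes> y \<otimes> z)"
    using whisker_eq[OF shat_shat[of "Leaf x" "Leaf y" "y \<otimes> z"], of x] by simp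
  have 2: "wx (wx (symm_hat y y z)) \<cdot> wx (wx (dhat Y z)) = wx (wx (dhat Y z))"
    using whisker_eq[OF whisker_eq[OF hat_comonoid(4)[OF Y z refl], of x], of x] by simp
  have 3: "symm_hat x x w \<cdot> dhat X w = dhat X w" if "w \<in> Obj M" for w
    using hat_comonoid(4)[OF X that refl] by simp
  have 4: "symm_hat x x w \<cdot> wx (wx k) = wx (wx k) \<cdot> symm_hat x x (Dom M k)"
    if "k \<in> Arr M" "Cod M k = w" for k w
    using symm_hat_nat[of x x k] that by simp
  show ?thesis
    by (simp add: prod_hat_def shat_hexagon1 shat_hexagon2 whisker_comp 1 2 3 4 comp_tail[OF 1]
        comp_tail[OF 2] comp_tail[OF 3] comp_tail[OF 4]
        hx comp_tail[OF hx])
qed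

text \<open>The flattened compatibility of \<open>proj1\<close> with comultiplications: discarding
  both copies of \<open>y\<close> amounts to discarding \<open>y\<close> before any
  splitting.\<close>

lemma prod_hat_proj1:
  assumes z [simp]: "z \<in> Obj M"
  shows "wx (ehat Y (x \<otimes> z)) \<cdot> wx (wy (wx (ehat Y z))) \<cdot> prod_hat z = dhat X z \<cdot> wx (ehat Y z)"
  using X Y by (simp add: prod_hat_def hx hs' comp_tail[OF hx] comp_tail[OF hs'] ex ex[THEN
      comp_tail] erules erules[THEN comp_tail])

text \<open>The same compatibility for \<open>proj2\<close>, with both copies of \<open>x\<close>
  discarded.\<close>

lemma prod_hat_proj2:
  assumes z [simp]: "z \<in> Obj M"
  shows "ehat X (y \<otimes> y \<otimes> z) \<cdot> wx (wy (ehat X (y \<otimes> z))) \<cdot> prod_hat z = dhat Y z \<cdot> ehat X (y \<otimes> z)"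
  using X Y by (simp add: prod_hat_def hx comp_tail[OF hx] ex ex[THEN comp_tail] erules erules[THEN
      comp_tail])

text \<open>The flattened form of \<open>pairing_proj\<close>: of the two copies of
  \<open>x \<otimes> y\<close>, keep \<open>x\<close> from the first and \<open>y\<close> from the
  second.\<close>

lemma prod_hat_pairing:
  assumes z [simp]: "z \<in> Obj M"
  shows "wx (ehat Y (y \<otimes> z)) \<cdot> wx (wy (ehat X (y \<otimes> z))) \<cdot> prod_hat z = Id M (x \<otimes> y \<otimes> z)"
  using X Y by (simp add: prod_hat_def hx comp_tail[OF hx] ex ex[THEN comp_tail] erules erules[THEN
      comp_tail])

declare obj [simp del] prod_hat_arr [simp del]

end

end

section \<open>The cartesian structure on cocommutative comonoids\<close>

definition comon_one :: "('o, 'm, 'z) smc_scheme \<Rightarrow> ('o, 'm) comonoid_obj" where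
  "comon_one M = \<lparr>com_obj = unit_obj M, com_comult = inv_arr M (lunit M (unit_obj M)), com_counit =
      Id M (unit_obj M)\<rparr>"

context symmetric_monoidal_category
begin

lemma comon_homD:
  assumes "comon_hom M X Y f"
  shows "f \<in> Arr M" "Dom M f = com_obj X" "Cod M f = com_obj Y"
    "com_comult Y \<cdot> f = (f \<otimes>\<^sub>m f) \<cdot> com_comult X" "com_counit Y \<cdot> f = com_counit X"
  using assms by (auto simp: comon_hom_def is_comonoid_arr_def in_hset)

lemma comon_homI:
  assumes "f \<in> Arr M" "Dom M f = com_obj X" "Cod M f = com_obj Y"
    "com_comult Y \<cdot> f = (f \<otimes>\<^sub>m f) \<cdot> com_comult X" "com_counit Y \<cdot> f = com_counit X"
  shows "comon_hom M X Y f"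
  using assms by (auto simp: comon_hom_def is_comonoid_arr_def in_hset)

context
  fixes X Y
  assumes X: "comon_coc M X" and Y: "comon_coc M Y"
begin

private abbreviation (input) "x \<equiv> com_obj X"
private abbreviation (input) "y \<equiv> com_obj Y"
private abbreviation (input) "lx \<equiv> Leaf x"
private abbreviation (input) "ly \<equiv> Leaf y"
private abbreviation (input) "t \<equiv> Node lx ly"
private abbreviation (input) "d \<equiv> Seq (mid_expr lx lx ly ly)
  (Par (Gen lx (Node lx lx) (com_comult X)) (Gen ly (Node ly ly) (com_comult Y)))"
private abbreviation (input) "e \<equiv> Seq (Lun Unit) (Par (Gen lx Unit (com_counit X)) (Gen ly Unit
    (com_counit Y)))"
private abbreviation (input) "p1 \<equiv> Seq (Run lx) (Par (Ide lx) (Gen ly Unit (com_counit Y)))"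
private abbreviation (input) "p2 \<equiv> Seq (Lun ly) (Par (Gen lx Unit (com_counit X)) (Ide ly))"

private lemma XY_arrs [simp]: "x \<in> Obj M" "y \<in> Obj M" "com_comult X \<in> Arr M" "com_comult Y \<in> Arr M"
  "Dom M (com_comult X) = x" "Dom M (com_comult Y) = y" "Cod M (com_comult X) = x \<otimes> x"
      "Cod M (com_comult Y) = y \<otimes> y"
  "com_counit X \<in> Arr M" "com_counit Y \<in> Arr M" "Dom M (com_counit X) = x" "Dom M (com_counit Y) =
      y"
  "Cod M (com_counit X) = unit_obj M" "Cod M (com_counit Y) = unit_obj M"
  using comon_cocD(1-7)[OF X] comon_cocD(1-7)[OF Y] by simp_all

private lemma hat_exprs:
  assumes "z \<in> Obj M"
  shows "hat d z = prod_hat X Y x y z" "hat e z = ehat X z \<cdot> (Id M x \<otimes>\<^sub>m ehat Y z)"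
    "hat p1 z = Id M x \<otimes>\<^sub>m ehat Y z" "hat p2 z = ehat X (y \<otimes> z)"
  using assms by (simp_all add: prod_hat_def[OF X Y] dhat_def ehat_def)

private lemma hat_par: "hat (Par f g) z = hat f (nf_obj (ecod g) z) \<cdot> nf_arr (edom f) (hat g z)"
  by simp

text \<open>Restricted instances of the clause for \<open>Seq\<close>. None of them matches
  \<open>d\<close>, \<open>e\<close>, \<open>p1\<close> or \<open>p2\<close> at the root, so these
  stay folded and can be rewritten by \<open>hat_exprs\<close>.\<close>

private lemma hat_seq:
  "hat (Seq (Asc s u v) f) z = hat (Asc s u v) z \<cdot> hat f z"
  "hat (Seq (Lun s) (Seq k f)) z = hat (Lun s) z \<cdot> hat (Seq k f) z"
  "hat (Seq (Par k g) f) z = hat (Par k g) z \<cdot> hat f z"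
  "hat (Seq (Gen s u m) f) z = hat (Gen s u m) z \<cdot> hat f z"
  by simp_all

lemma comon_prod_coc: "comon_coc M (comon_prod M X Y)"
proof -
  let ?X = "comon_prod M X Y"
  note [simp] = prod_hat_arr[OF X Y] comon_prod_def[of M X Y] hat_comonoid_arr[OF X]
      hat_comonoid_arr[OF Y]
  note [simp del] = hat.simps(3,4)
  show ?thesis
  proof (rule comon_cocI[OF refl refl refl])
    show "assoc M (com_obj ?X) (com_obj ?X) (com_obj ?X) \<cdot> (com_comult ?X \<otimes>\<^sub>m Id M (com_obj ?X)) \<cdot>
        com_comult ?X =
        (Id M (com_obj ?X) \<otimes>\<^sub>m com_comult ?X) \<cdot> com_comult ?X"
      by (rule arr_eqI[of "Seq (Asc t t t) (Seq (Par d (Ide t)) d)" "Seq (Par (Ide t) d) d"])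
        (use prod_hat_coassoc[OF X Y refl refl] in \<open>simp_all add: hat_exprs hat_par hat_seq\<close>)
    show "lunit M (com_obj ?X) \<cdot> (com_counit ?X \<otimes>\<^sub>m Id M (com_obj ?X)) \<cdot> com_comult ?X =
        Id M (com_obj ?X)"
      by (rule arr_eqI[of "Seq (Lun t) (Seq (Par e (Ide t)) d)" "Ide t"])
        (use prod_hat_counit[OF X Y refl refl] in \<open>simp_all add: hat_exprs hat_par hat_seq\<close>)
    show "symm M (com_obj ?X) (com_obj ?X) \<cdot> com_comult ?X = com_comult ?X"
      by (rule arr_eqI[of "Seq (Gen (Node t t) (Node t t) (symm M (x \<otimes> y) (x \<otimes> y))) d" d])
        (use prod_hat_symm[OF X Y refl refl] in \<open>simp_all add: hat_exprs hat_par hat_seq shat_def\<close>)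
  qed simp_all
qed

lemma proj_arr [simp]:
  "proj1 M X Y \<in> Arr M" "Dom M (proj1 M X Y) = x \<otimes> y" "Cod M (proj1 M X Y) = x"
  "proj2 M X Y \<in> Arr M" "Dom M (proj2 M X Y) = x \<otimes> y" "Cod M (proj2 M X Y) = y"
  by (simp_all add: proj1_def proj2_def)

lemma proj1_hom: "comon_hom M (comon_prod M X Y) X (proj1 M X Y)"
proof (rule comon_homI)
  note [simp] = prod_hat_arr[OF X Y] comon_prod_def[of M X Y] proj1_def[of M X Y]
      hat_comonoid_arr[OF X] hat_comonoid_arr[OF Y]
  have "com_counit X \<cdot> proj1 M X Y = (runit M (Cod M (com_counit X)) \<cdot>
      (com_counit X \<otimes>\<^sub>m Id M (unit_obj M))) \<cdot> (Id M x \<otimes>\<^sub>m com_counit Y)"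
    by (subst runit_nat) simp_all
  also have "\<dots> = lunit M (unit_obj M) \<cdot> (com_counit X \<otimes>\<^sub>m com_counit Y)"
    by (simp add: interchange lunit_runit_unit)
  finally show "com_counit X \<cdot> proj1 M X Y = com_counit (comon_prod M X Y)" by simp
  note [simp del] = hat.simps(3,4)
  show "com_comult X \<cdot> proj1 M X Y = (proj1 M X Y \<otimes>\<^sub>m proj1 M X Y) \<cdot> com_comult (comon_prod M X Y)"
    by (rule arr_eqI[of "Seq (Gen lx (Node lx lx) (com_comult X)) p1" "Seq (Par p1 p1) d"])
      (use prod_hat_proj1[OF X Y refl refl] in \<open>simp_all add: hat_exprs hat_par hat_seq dhat_def\<close>)
qed simp_all

lemma proj2_hom: "comon_hom M (comon_prod M X Y) Y (proj2 M X Y)"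
proof (rule comon_homI)
  note [simp] = prod_hat_arr[OF X Y] comon_prod_def[of M X Y] proj2_def[of M X Y]
      hat_comonoid_arr[OF X] hat_comonoid_arr[OF Y]
  have "com_counit Y \<cdot> proj2 M X Y = (lunit M (Cod M (com_counit Y)) \<cdot>
      (Id M (unit_obj M) \<otimes>\<^sub>m com_counit Y)) \<cdot> (com_counit X \<otimes>\<^sub>m Id M y)"
    by (subst lunit_nat) simp_all
  also have "\<dots> = lunit M (unit_obj M) \<cdot> (com_counit X \<otimes>\<^sub>m com_counit Y)"
    by (simp add: interchange)
  finally show "com_counit Y \<cdot> proj2 M X Y = com_counit (comon_prod M X Y)" by simp
  note [simp del] = hat.simps(3,4)
  show "com_comult Y \<cdot> proj2 M X Y = (proj2 M X Y \<otimes>\<^sub>m proj2 M X Y) \<cdot> com_comult (comon_prod M X Y)"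
    by (rule arr_eqI[of "Seq (Gen ly (Node ly ly) (com_comult Y)) p2" "Seq (Par p2 p2) d"])
      (use prod_hat_proj2[OF X Y refl refl] in \<open>simp_all add: hat_exprs hat_par hat_seq dhat_def\<close>)
qed simp_all

lemma pairing_proj: "pairing M (comon_prod M X Y) (proj1 M X Y) (proj2 M X Y) = Id M (x \<otimes> y)"
proof -
  note [simp] = prod_hat_arr[OF X Y] comon_prod_def[of M X Y] proj1_def[of M X Y] proj2_def[of M X
      Y] hat_comonoid_arr[OF X] hat_comonoid_arr[OF Y]
  note [simp del] = hat.simps(3,4)
  show ?thesis
    by (rule arr_eqI[of "Seq (Par p1 p2) d" "Ide t"])
      (use prod_hat_pairing[OF X Y refl refl] in \<open>simp_all add: hat_exprs hat_par hat_seq dhat_def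
          pairing_def\<close>)
qed

declare XY_arrs [simp del]

end

text \<open>The four copies made by iterated comultiplication are interchangeable. Equivalently, a
  cocommutative comultiplication respects comultiplications; this is the key to
  \<open>pairing_hom\<close>.\<close>

lemma comult_comult:
  assumes X: "comon_coc M X"
  shows "midswap M (com_obj X) (com_obj X) (com_obj X) (com_obj X) \<cdot>
      (com_comult X \<otimes>\<^sub>m com_comult X) \<cdot> com_comult X =
    (com_comult X \<otimes>\<^sub>m com_comult X) \<cdot> com_comult X"
proof -
  let ?x = "com_obj X" and ?l = "Leaf (com_obj X)"
  note [simp] = comon_cocD(1-7)[OF X]
  let ?d = "Gen ?l (Node ?l ?l) (com_comult X)"
  show ?thesis
  proof (rule arr_eqI[of "Seq (mid_expr ?l ?l ?l ?l) (Seq (Par ?d ?d) ?d)" "Seq (Par ?d ?d) ?d"])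
    fix z assume [simp]: "z \<in> Obj M"
    have [simp]: "hgen ?l (Node ?l ?l) (com_comult X) w = dhat X w" for w
      by (simp_all add: dhat_def)
    note [simp] = hat_comonoid_arr[OF X]
    have c: "dhat X (?x \<otimes> w) \<cdot> dhat X w = (Id M ?x \<otimes>\<^sub>m dhat X w) \<cdot> dhat X w" if "w \<in> Obj M" for w
      by (rule hat_comonoid(1)[OF X that refl])
    \<comment> \<open>Coassociativity arranges that the two middle strands come out of one
      comultiplication, which then absorbs the crossing by cocommutativity.\<close>
    have 1: "dhat X (?x \<otimes> ?x \<otimes> z) \<cdot> (Id M ?x \<otimes>\<^sub>m dhat X z) \<cdot> dhat X z =
        (Id M ?x \<otimes>\<^sub>m dhat X (?x \<otimes> z)) \<cdot> dhat X (?x \<otimes> z) \<cdot> dhat X z"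
    proof -
      have "dhat X (?x \<otimes> ?x \<otimes> z) \<cdot> (Id M ?x \<otimes>\<^sub>m dhat X z) \<cdot> dhat X z =
          (dhat X (?x \<otimes> ?x \<otimes> z) \<cdot> dhat X (?x \<otimes> z)) \<cdot> dhat X z"
        by (simp add: c[of z, symmetric])
      also have "\<dots> = (Id M ?x \<otimes>\<^sub>m dhat X (?x \<otimes> z)) \<cdot> dhat X (?x \<otimes> z) \<cdot> dhat X z"
        by (subst c) simp_all
      finally show ?thesis .
    qed
    have 2: "(Id M ?x \<otimes>\<^sub>m symm_hat ?x ?x (?x \<otimes> z)) \<cdot> (Id M ?x \<otimes>\<^sub>m dhat X (?x \<otimes> z)) =
        Id M ?x \<otimes>\<^sub>m dhat X (?x \<otimes> z)"
      using whisker_eq[OF hat_comonoid(4)[OF X _ refl], of "?x \<otimes> z" ?x] by simp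
    show "hat (Seq (mid_expr ?l ?l ?l ?l) (Seq (Par ?d ?d) ?d)) z = hat (Seq (Par ?d ?d) ?d) z"
      by (simp add: 1 2 comp_tail[OF 2])
  qed simp_all
qed

lemma hgen_lunit_inv: "x \<in> Obj M \<Longrightarrow> hgen Unit (Node Unit Unit) (inv_arr M (lunit M (unit_obj M))) x =
    Id M x"
  using hat_eqI[of "Seq (Lun Unit) (Gen Unit (Node Unit Unit) (inv_arr M (lunit M (unit_obj M))))"
      "Ide Unit" x] by simp

lemma comon_one_simps [simp]:
  "com_obj (comon_one M) = unit_obj M" "com_comult (comon_one M) = inv_arr M (lunit M (unit_obj M))"
  "com_counit (comon_one M) = Id M (unit_obj M)"
  by (simp_all add: comon_one_def)

lemma comon_one_coc: "comon_coc M (comon_one M)"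
proof (rule comon_cocI[OF refl refl refl])
  let ?I = "unit_obj M" and ?d = "inv_arr M (lunit M (unit_obj M))"
  let ?e = "Gen Unit (Node Unit Unit) ?d"
  show "assoc M (com_obj (comon_one M)) (com_obj (comon_one M)) (com_obj (comon_one M)) \<cdot>
      (com_comult (comon_one M) \<otimes>\<^sub>m Id M (com_obj (comon_one M))) \<cdot> com_comult (comon_one M) =
      (Id M (com_obj (comon_one M)) \<otimes>\<^sub>m com_comult (comon_one M)) \<cdot> com_comult (comon_one M)"
    by (rule arr_eqI[of "Seq (Asc Unit Unit Unit) (Seq (Par ?e (Ide Unit)) ?e)"
        "Seq (Par (Ide Unit) ?e) ?e"])
      (simp_all add: hgen_lunit_inv)
  show "symm M (com_obj (comon_one M)) (com_obj (comon_one M)) \<cdot> com_comult (comon_one M) =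
      com_comult (comon_one M)"
    by (rule arr_eqI[of "Seq (Gen (Node Unit Unit) (Node Unit Unit) (symm M ?I ?I)) ?e" ?e])
      (use shat_unit[of Unit] in \<open>simp_all add: hgen_lunit_inv shat_def\<close>)
qed simp_all

lemma comon_hom_Id: "comon_coc M X \<Longrightarrow> comon_hom M X X (Id M (com_obj X))"
  by (rule comon_homI) (simp_all add: comon_cocD(1-7))

lemma comon_hom_comp:
  assumes f: "comon_hom M X Y f" and g: "comon_hom M Y Z g"
      and "comon_coc M X" "comon_coc M Y" "comon_coc M Z"
  shows "comon_hom M X Z (g \<cdot> f)"
proof (rule comon_homI)
  note [simp] = comon_homD(1-3)[OF f] comon_homD(1-3)[OF g] comon_cocD(1-7)[OF assms(3)]
      comon_cocD(1-7)[OF assms(4)]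
    comon_cocD(1-7)[OF assms(5)]
  show "com_comult Z \<cdot> g \<cdot> f = ((g \<cdot> f) \<otimes>\<^sub>m (g \<cdot> f)) \<cdot> com_comult X"
    using comp_tail[OF comon_homD(4)[OF g], of f] comon_homD(4)[OF f] by (simp add: interchange)
  show "com_counit Z \<cdot> g \<cdot> f = com_counit X"
    using comp_tail[OF comon_homD(5)[OF g], of f] comon_homD(5)[OF f] by simp
qed (use comon_homD[OF f] comon_homD[OF g] in simp_all)

lemma comon_hom_counit: "comon_coc M X \<Longrightarrow> comon_hom M X (comon_one M) (com_counit X)"
proof (rule comon_homI)
  assume X: "comon_coc M X"
  note [simp] = comon_cocD(1-7)[OF X]
  let ?I = "unit_obj M" and ?e = "com_counit X"
  have "lunit M ?I \<cdot> (?e \<otimes>\<^sub>m ?e) \<cdot> com_comult X =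
      (lunit M (Cod M ?e) \<cdot> (Id M ?I \<otimes>\<^sub>m ?e)) \<cdot> (?e \<otimes>\<^sub>m Id M (com_obj X)) \<cdot> com_comult X"
    by (simp add: interchange)
  also have "\<dots> = ?e"
    by (subst lunit_nat) (simp_all add: comon_cocD(9)[OF X])
  finally have "(?e \<otimes>\<^sub>m ?e) \<cdot> com_comult X = inv_arr M (lunit M ?I) \<cdot> ?e"
    by (intro iso_cancel_left[of "lunit M ?I" "(?e \<otimes>\<^sub>m ?e) \<cdot> com_comult X" "inv_arr M (lunit M ?I) \<cdot>
        ?e"]) simp_all
  then show "com_comult (comon_one M) \<cdot> ?e = (?e \<otimes>\<^sub>m ?e) \<cdot> com_comult X" by simp
qed (simp_all add: comon_cocD(1-7))

lemma comon_hom_inverse: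
  assumes f: "comon_hom M X Y f" and i: "iso_arr M f" and X: "comon_coc M X" and Y: "comon_coc M Y"
  shows "comon_hom M Y X (inv_arr M f)"
proof (rule comon_homI)
  note [simp] = comon_homD(1-3)[OF f] comon_cocD(1-7)[OF X] comon_cocD(1-7)[OF Y] i
  have "com_comult X \<cdot> inv_arr M f = (inv_arr M f \<otimes>\<^sub>m inv_arr M f) \<cdot> ((f \<otimes>\<^sub>m f) \<cdot> com_comult X) \<cdot>
      inv_arr M f"
    by (simp add: interchange)
  also have "\<dots> = (inv_arr M f \<otimes>\<^sub>m inv_arr M f) \<cdot> com_comult Y"
    by (subst comon_homD(4)[OF f, symmetric]) simp
  finally show "com_comult X \<cdot> inv_arr M f = (inv_arr M f \<otimes>\<^sub>m inv_arr M f) \<cdot> com_comult Y" .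
  show "com_counit X \<cdot> inv_arr M f = com_counit Y"
    by (subst comon_homD(5)[OF f, symmetric]) simp
qed (use comon_homD[OF f] i in simp_all)

lemma pairing_arr [simp]:
  assumes "comon_coc M T" "f \<in> Arr M" "g \<in> Arr M" "Dom M f = com_obj T" "Dom M g = com_obj T"
  shows "pairing M T f g \<in> Arr M" "Dom M (pairing M T f g) = com_obj T" "Cod M (pairing M T f g) =
      Cod M f \<otimes> Cod M g"
  using assms comon_cocD(1-7)[OF assms(1)] by (simp_all add: pairing_def)

lemma tensor_pairing:
  assumes "comon_coc M T" "f \<in> Arr M" "g \<in> Arr M" "Dom M f = com_obj T" "Dom M g = com_obj T"
    "h \<in> Arr M" "k \<in> Arr M" "Dom M h = Cod M f" "Dom M k = Cod M g"
  shows "(h \<otimes>\<^sub>m k) \<cdot> pairing M T f g = pairing M T (h \<cdot> f) (k \<cdot> g)"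
  using assms comon_cocD(1-7)[OF assms(1)] by (simp add: pairing_def interchange)

text \<open>Substitution into a pair uses \<open>t\<close> twice, which is where its compatibility
  with the comultiplications enters.\<close>

lemma pairing_comp:
  assumes "comon_coc M T" "f \<in> Arr M" "g \<in> Arr M" "Dom M f = com_obj T" "Dom M g = com_obj T"
    and t: "comon_hom M S T t" and S: "comon_coc M S"
  shows "pairing M T f g \<cdot> t = pairing M S (f \<cdot> t) (g \<cdot> t)"
  using assms comon_cocD(1-7)[OF assms(1)] comon_cocD(1-7)[OF S] comon_homD[OF t]
  by (simp add: pairing_def interchange)

lemma counit_pairing1:
  assumes T: "comon_coc M T" and [simp]: "f \<in> Arr M" "Dom M f = com_obj T" "Cod M f = x"
  shows "runit M x \<cdot> pairing M T f (com_counit T) = f"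
proof -
  note [simp] = comon_cocD(1-7)[OF T]
  have [simp]: "x \<in> Obj M" using Cod_Obj[of f] by simp
  have "runit M x \<cdot> pairing M T f (com_counit T) =
      (runit M (Cod M f) \<cdot> (f \<otimes>\<^sub>m Id M (unit_obj M))) \<cdot> (Id M (com_obj T) \<otimes>\<^sub>m com_counit T) \<cdot>
          com_comult T"
    by (simp add: pairing_def interchange)
  also have "\<dots> = f" by (subst runit_nat) (simp_all add: comon_cocD(10)[OF T])
  finally show ?thesis .
qed

lemma counit_pairing2:
  assumes T: "comon_coc M T" and [simp]: "f \<in> Arr M" "Dom M f = com_obj T" "Cod M f = x"
  shows "lunit M x \<cdot> pairing M T (com_counit T) f = f"
proof -
  note [simp] = comon_cocD(1-7)[OF T]
  have [simp]: "x \<in> Obj M" using Cod_Obj[of f] by simp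
  have "lunit M x \<cdot> pairing M T (com_counit T) f =
      (lunit M (Cod M f) \<cdot> (Id M (unit_obj M) \<otimes>\<^sub>m f)) \<cdot> (com_counit T \<otimes>\<^sub>m Id M (com_obj T)) \<cdot>
          com_comult T"
    by (simp add: pairing_def interchange)
  also have "\<dots> = f" by (subst lunit_nat) (simp_all add: comon_cocD(9)[OF T])
  finally show ?thesis .
qed

lemma symm_pairing:
  assumes T: "comon_coc M T" and [simp]: "f \<in> Arr M" "g \<in> Arr M" "Dom M f = com_obj T" "Dom M g =
      com_obj T"
    and "Cod M f = x" "Cod M g = y"
  shows "symm M x y \<cdot> pairing M T f g = pairing M T g f"
proof -
  note [simp] = comon_cocD(1-7)[OF T]
  have "symm M x y \<cdot> pairing M T f g = (symm M (Cod M f) (Cod M g) \<cdot> (f \<otimes>\<^sub>m g)) \<cdot> com_comult T"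
    by (simp add: pairing_def assms(6,7)[symmetric])
  also have "\<dots> = pairing M T g f"
    by (subst symm_nat) (simp_all add: pairing_def comon_cocD(11)[OF T])
  finally show ?thesis .
qed

lemma assoc_pairing:
  assumes T: "comon_coc M T" and [simp]: "f \<in> Arr M" "g \<in> Arr M" "h \<in> Arr M" "Dom M f = com_obj T"
      "Dom M g = com_obj T"
    "Dom M h = com_obj T" and "Cod M f = x" "Cod M g = y" "Cod M h = z"
  shows "assoc M x y z \<cdot> pairing M T (pairing M T f g) h = pairing M T f (pairing M T g h)"
proof -
  let ?t = "com_obj T"
  note [simp] = comon_cocD(1-7)[OF T] assms(8-10)[symmetric]
  have "assoc M x y z \<cdot> pairing M T (pairing M T f g) h =
      (assoc M (Cod M f) (Cod M g) (Cod M h) \<cdot> ((f \<otimes>\<^sub>m g) \<otimes>\<^sub>m h)) \<cdot> (com_comult T \<otimes>\<^sub>m Id M ?t) \<cdot>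
          com_comult T"
    by (simp add: pairing_def interchange)
  also have "\<dots> = (f \<otimes>\<^sub>m g \<otimes>\<^sub>m h) \<cdot> assoc M ?t ?t ?t \<cdot> (com_comult T \<otimes>\<^sub>m Id M ?t) \<cdot> com_comult T"
    by (subst assoc_nat[of f g h ?t ?t ?t]) simp_all
  also have "\<dots> = pairing M T f (pairing M T g h)"
    by (simp add: comon_cocD(8)[OF T] pairing_def interchange)
  finally show ?thesis .
qed

text \<open>Cocommutativity of \<open>T\<close> enters through \<open>comult_comult\<close>.
  Together with \<open>proj_pairing\<close> and \<open>pairing_eta\<close> this makes the tensor
  product a categorical product.\<close>

lemma pairing_hom:
  assumes f: "comon_hom M T X f" and g: "comon_hom M T Y g"
    and T: "comon_coc M T" and X: "comon_coc M X" and Y: "comon_coc M Y"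
  shows "comon_hom M T (comon_prod M X Y) (pairing M T f g)"
proof (rule comon_homI)
  let ?t = "com_obj T"
  note [simp] = comon_cocD(1-7)[OF T] comon_cocD(1-7)[OF X] comon_cocD(1-7)[OF Y] comon_homD(1-3)[OF
      f] comon_homD(1-3)[OF g] T
  have "com_comult (comon_prod M X Y) \<cdot> pairing M T f g =
      midswap M (com_obj X) (com_obj X) (com_obj Y) (com_obj Y) \<cdot> ((com_comult X \<cdot>
          f) \<otimes>\<^sub>m (com_comult Y \<cdot> g)) \<cdot> com_comult T"
    by (simp add: comon_prod_def pairing_def interchange)
  also have "\<dots> = (midswap M (com_obj X) (com_obj X) (com_obj Y) (com_obj Y) \<cdot>
      ((f \<otimes>\<^sub>m f) \<otimes>\<^sub>m (g \<otimes>\<^sub>m g))) \<cdot>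
      (com_comult T \<otimes>\<^sub>m com_comult T) \<cdot> com_comult T"
    by (simp add: comon_homD(4)[OF f] comon_homD(4)[OF g] interchange)
  also have "\<dots> = ((f \<otimes>\<^sub>m g) \<otimes>\<^sub>m (f \<otimes>\<^sub>m g)) \<cdot> midswap M ?t ?t ?t ?t \<cdot> (com_comult T \<otimes>\<^sub>m com_comult T) \<cdot>
      com_comult T"
    by (subst midswap_nat[of f f g g ?t ?t ?t ?t]) simp_all
  also have "\<dots> = (pairing M T f g \<otimes>\<^sub>m pairing M T f g) \<cdot> com_comult T"
    by (simp add: comult_comult[OF T] interchange pairing_def)
  finally show "com_comult (comon_prod M X Y) \<cdot> pairing M T f g =
      (pairing M T f g \<otimes>\<^sub>m pairing M T f g) \<cdot> com_comult T" .
  have "com_counit (comon_prod M X Y) \<cdot> pairing M T f g = lunit M (unit_obj M) \<cdot>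
      pairing M T (com_counit T) (com_counit T)"
    using comon_homD(5)[OF f] comon_homD(5)[OF g] by (simp add: comon_prod_def tensor_pairing)
  then show "com_counit (comon_prod M X Y) \<cdot> pairing M T f g = com_counit T"
    by (simp add: counit_pairing2[OF T])
qed (use comon_homD[OF f] comon_homD[OF g] T in simp_all)

lemma proj_pairing:
  assumes f: "comon_hom M T X f" and g: "comon_hom M T Y g"
    and T: "comon_coc M T" and X: "comon_coc M X" and Y: "comon_coc M Y"
  shows "proj1 M X Y \<cdot> pairing M T f g = f" "proj2 M X Y \<cdot> pairing M T f g = g"
proof -
  note [simp] = comon_cocD(1-7)[OF T] comon_cocD(1-7)[OF X] comon_cocD(1-7)[OF Y] comon_homD(1-3)[OF
      f] comon_homD(1-3)[OF g] T
    comon_homD(5)[OF f] comon_homD(5)[OF g]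
  show "proj1 M X Y \<cdot> pairing M T f g = f" "proj2 M X Y \<cdot> pairing M T f g = g"
    by (simp_all add: proj1_def proj2_def tensor_pairing counit_pairing1 counit_pairing2)
qed

lemma pairing_eta:
  assumes h: "comon_hom M T (comon_prod M X Y) h"
    and T: "comon_coc M T" and X: "comon_coc M X" and Y: "comon_coc M Y"
  shows "pairing M T (proj1 M X Y \<cdot> h) (proj2 M X Y \<cdot> h) = h"
proof -
  note [simp] = comon_cocD(1)[OF X] comon_cocD(1)[OF Y] comon_homD(1-3)[OF h] proj_arr[OF X Y] T
      comon_prod_coc[OF X Y]
  have "pairing M T (proj1 M X Y \<cdot> h) (proj2 M X Y \<cdot> h) =
      pairing M (comon_prod M X Y) (proj1 M X Y) (proj2 M X Y) \<cdot> h"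
    by (subst pairing_comp[OF _ _ _ _ _ h T]) simp_all
  then show ?thesis by (simp add: pairing_proj[OF X Y])
qed

lemma prod_hom_eqI:
  assumes "comon_hom M T (comon_prod M X Y) h" "comon_hom M T (comon_prod M X Y) k"
    and "comon_coc M T" "comon_coc M X" "comon_coc M Y"
    and "proj1 M X Y \<cdot> h = proj1 M X Y \<cdot> k" "proj2 M X Y \<cdot> h = proj2 M X Y \<cdot> k"
  shows "h = k"
  using pairing_eta[OF assms(1,3-5)] pairing_eta[OF assms(2,3-5)] unfolding assms(6,7)
    by (rule trans[OF sym])

text \<open>Expresses tensored arrows through projections and pairings, so that
  \<open>tensor_hom\<close> needs no further diagram.\<close>

lemma tensor_eq_pairing:
  assumes "f \<in> Arr M" "g \<in> Arr M" "Dom M f = com_obj X" "Dom M g = com_obj Y" and X: "comon_coc M X"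
      and Y: "comon_coc M Y"
  shows "f \<otimes>\<^sub>m g = pairing M (comon_prod M X Y) (f \<cdot> proj1 M X Y) (g \<cdot> proj2 M X Y)"
  using tensor_pairing[OF comon_prod_coc[OF X Y], of "proj1 M X Y" "proj2 M X Y"
      f g] assms comon_cocD(1)[OF X] comon_cocD(1)[OF Y] proj_arr[OF X Y]
  by (simp add: pairing_proj[OF X Y])

lemma tensor_hom:
  assumes f: "comon_hom M X X' f" and g: "comon_hom M Y Y' g"
    and X: "comon_coc M X" and Y: "comon_coc M Y" and X': "comon_coc M X'" and Y': "comon_coc M Y'"
  shows "comon_hom M (comon_prod M X Y) (comon_prod M X' Y') (f \<otimes>\<^sub>m g)"
  unfolding tensor_eq_pairing[OF comon_homD(1)[OF f] comon_homD(1)[OF g] comon_homD(2)[OF f]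
      comon_homD(2)[OF g] X Y]
  by (intro pairing_hom comon_hom_comp[OF _ f] comon_hom_comp[OF _ g] proj1_hom proj2_hom
      comon_prod_coc assms)

lemma assoc_hom:
  assumes X: "comon_coc M X" and Y: "comon_coc M Y" and Z: "comon_coc M Z"
  shows "comon_hom M (comon_prod M (comon_prod M X Y) Z) (comon_prod M X (comon_prod M Y Z)) (assoc
      M (com_obj X) (com_obj Y) (com_obj Z))"
proof -
  let ?T = "comon_prod M (comon_prod M X Y) Z"
  have XY: "comon_coc M (comon_prod M X Y)" and T: "comon_coc M ?T" by (intro comon_prod_coc assms)+
  let ?p = "proj1 M (comon_prod M X Y) Z"
  let ?x = "proj1 M X Y \<cdot> ?p" and ?y = "proj2 M X Y \<cdot> ?p" and ?z = "proj2 M (comon_prod M X Y) Z"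
  have p: "comon_hom M ?T (comon_prod M X Y) ?p" by (intro proj1_hom XY assms)
  have x: "comon_hom M ?T X ?x" by (intro comon_hom_comp[OF p] proj1_hom XY assms T)
  have y: "comon_hom M ?T Y ?y" by (intro comon_hom_comp[OF p] proj2_hom XY assms T)
  have z: "comon_hom M ?T Z ?z" by (intro proj2_hom XY assms)
  note [simp] = comon_cocD(1)[OF X] comon_cocD(1)[OF Y] comon_cocD(1)[OF Z] 
  \<comment> \<open>The identity of the triple product is written as a nested pair, on which the
    associator is computed by \<open>assoc_pairing\<close>.\<close>
  have 1: "pairing M ?T (pairing M ?T ?x ?y) ?z = Id M (com_obj ?T)"
    using pairing_proj[OF XY Z] by (simp add: pairing_eta[OF p T X Y])
  have "assoc M (com_obj X) (com_obj Y) (com_obj Z) = assoc M (com_obj X) (com_obj Y) (com_obj Z) \<cdot>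
      Id M (com_obj ?T)"
    by simp
  also have "\<dots> = pairing M ?T ?x (pairing M ?T ?y ?z)"
    unfolding 1[symmetric] by (rule assoc_pairing[OF T]) (use comon_homD[OF x] comon_homD[OF y]
        comon_homD[OF z] in simp_all)
  finally show ?thesis
    by (simp only:) (intro pairing_hom x y z T comon_prod_coc assms)
qed

lemma runit_eq_proj: "comon_coc M X \<Longrightarrow> runit M (com_obj X) = proj1 M X (comon_one M)"
  by (simp add: proj1_def comon_cocD(1))

lemma lunit_eq_proj: "comon_coc M X \<Longrightarrow> lunit M (com_obj X) = proj2 M (comon_one M) X"
  by (simp add: proj2_def comon_cocD(1))

lemma runit_hom: "comon_coc M X \<Longrightarrow> comon_hom M (comon_prod M X (comon_one M)) X (runit M (com_obj
    X))"
  unfolding runit_eq_proj by (intro proj1_hom comon_one_coc)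

lemma lunit_hom: "comon_coc M X \<Longrightarrow> comon_hom M (comon_prod M (comon_one M) X) X (lunit M (com_obj
    X))"
  unfolding lunit_eq_proj by (intro proj2_hom comon_one_coc)

end

section \<open>Cocommutative Hopf monoids\<close>

lemma hopf_comonoid_simps [simp]:
  "com_obj (hopf_comonoid A) = hopf_carrier A" "com_comult (hopf_comonoid A) = hopf_comult A"
  "com_counit (hopf_comonoid A) = hopf_counit A"
  by (simp_all add: hopf_comonoid_def)

lemma hopf_monoid_simps [simp]:
  "mon_obj (hopf_monoid A) = hopf_carrier A" "mon_mult (hopf_monoid A) = hopf_mult A"
  "mon_unit (hopf_monoid A) = hopf_unit A"
  by (simp_all add: hopf_monoid_def)

definition hopf_coc :: "('o, 'm, 'z) smc_scheme \<Rightarrow> ('o, 'm) hopf_obj \<Rightarrow> bool" where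
  "hopf_coc M A \<longleftrightarrow> is_hopf_monoid M A \<and> is_cocommutative M (hopf_comonoid A)"

definition hopf_hom ::
  "('o, 'm, 'z) smc_scheme \<Rightarrow> ('o, 'm) hopf_obj \<Rightarrow> ('o, 'm) hopf_obj \<Rightarrow> 'm \<Rightarrow> bool" where
  "hopf_hom M A B f \<longleftrightarrow>
    comon_hom M (hopf_comonoid A) (hopf_comonoid B) f \<and>
        is_monoid_arr M (hopf_monoid A) (hopf_monoid B) f"

text \<open>Convolution. For generalized elements over \<open>T\<close> this is the multiplication
  of the internal group \<open>A\<close>.\<close>

definition conv ::
  "('o, 'm, 'z) smc_scheme \<Rightarrow> ('o, 'm) hopf_obj \<Rightarrow> ('o, 'm) comonoid_obj \<Rightarrow> 'm \<Rightarrow> 'm \<Rightarrow> 'm" where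
  "conv M A T f g = hopf_mult A \<cdot> pairing M T f g"
  for M (structure)

context symmetric_monoidal_category
begin

lemma hopf_cocD:
  assumes "hopf_coc M A"
  shows "hopf_carrier A \<in> Obj M" "hopf_mult A \<in> Arr M" "Dom M (hopf_mult A) =
      hopf_carrier A \<otimes> hopf_carrier A"
    "Cod M (hopf_mult A) = hopf_carrier A" "hopf_unit A \<in> Arr M" "Dom M (hopf_unit A) = unit_obj M"
    "Cod M (hopf_unit A) = hopf_carrier A" "hopf_comult A \<in> Arr M" "Dom M (hopf_comult A) =
        hopf_carrier A"
    "Cod M (hopf_comult A) = hopf_carrier A \<otimes> hopf_carrier A" "hopf_counit A \<in> Arr M"
    "Dom M (hopf_counit A) = hopf_carrier A" "Cod M (hopf_counit A) = unit_obj M"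
    "hopf_antipode A \<in> Arr M" "Dom M (hopf_antipode A) = hopf_carrier A" "Cod M (hopf_antipode A) =
        hopf_carrier A"
  using assms
  by (auto simp: hopf_coc_def is_hopf_monoid_def is_bimonoid_def is_monoid_def is_comonoid_def
      Let_def in_hset)

lemma hopf_coc_comon: "hopf_coc M A \<Longrightarrow> comon_coc M (hopf_comonoid A)"
  by (simp add: hopf_coc_def comon_coc_def is_hopf_monoid_def is_bimonoid_def)

lemma hopf_monoid_laws:
  assumes "hopf_coc M A"
  shows "hopf_mult A \<cdot> (hopf_mult A \<otimes>\<^sub>m Id M (hopf_carrier A)) =
      hopf_mult A \<cdot> (Id M (hopf_carrier A) \<otimes>\<^sub>m hopf_mult A) \<cdot>
          assoc M (hopf_carrier A) (hopf_carrier A) (hopf_carrier A)"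
    "hopf_mult A \<cdot> (hopf_unit A \<otimes>\<^sub>m Id M (hopf_carrier A)) = lunit M (hopf_carrier A)"
    "hopf_mult A \<cdot> (Id M (hopf_carrier A) \<otimes>\<^sub>m hopf_unit A) = runit M (hopf_carrier A)"
  using assms by (auto simp: hopf_coc_def is_hopf_monoid_def is_bimonoid_def is_monoid_def Let_def)

lemma hopf_antipode_laws:
  assumes A: "hopf_coc M A"
  shows "conv M A (hopf_comonoid A) (hopf_antipode A) (Id M (hopf_carrier A)) = hopf_unit A \<cdot>
      hopf_counit A"
    "conv M A (hopf_comonoid A) (Id M (hopf_carrier A)) (hopf_antipode A) = hopf_unit A \<cdot>
        hopf_counit A"
  using assms by (auto simp: hopf_coc_def is_hopf_monoid_def Let_def conv_def pairing_def)

lemma hopf_mult_hom: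
  assumes A: "hopf_coc M A"
  shows "comon_hom M (comon_prod M (hopf_comonoid A) (hopf_comonoid A)) (hopf_comonoid A) (hopf_mult
      A)"
  by (rule comon_homI) (use A in \<open>auto simp: hopf_cocD(1-16)[OF A] comon_prod_def hopf_coc_def
      is_hopf_monoid_def is_bimonoid_def Let_def\<close>)

lemma hopf_unit_hom:
  assumes A: "hopf_coc M A"
  shows "comon_hom M (comon_one M) (hopf_comonoid A) (hopf_unit A)"
proof (rule comon_homI)
  note [simp] = hopf_cocD[OF A]
  let ?u = "hopf_unit A" and ?l = "lunit M (unit_obj M)"
  have u: "hopf_comult A \<cdot> ?u \<cdot> ?l = ?u \<otimes>\<^sub>m ?u" "hopf_counit A \<cdot> ?u = Id M (unit_obj M)"
    using A by (auto simp: hopf_coc_def is_hopf_monoid_def is_bimonoid_def Let_def)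
  have "hopf_comult A \<cdot> ?u = (hopf_comult A \<cdot> ?u \<cdot> ?l) \<cdot> inv_arr M ?l" by simp
  then show "com_comult (hopf_comonoid A) \<cdot> ?u = (?u \<otimes>\<^sub>m ?u) \<cdot> com_comult (comon_one M)"
    by (simp add: u(1))
  show "com_counit (hopf_comonoid A) \<cdot> ?u = com_counit (comon_one M)" by (simp add: u(2))
qed (simp_all add: hopf_cocD(1-16)[OF A])

text \<open>Cocommutative Hopf monoids as group objects: the bimonoid axioms say that multiplication
  and unit are comonoid morphisms. For the antipode this is derived later, in
  \<open>antipode_hom\<close>.\<close>

lemma hopf_cocI:
  assumes C: "comon_coc M (hopf_comonoid A)"
    and m: "comon_hom M (comon_prod M (hopf_comonoid A) (hopf_comonoid A)) (hopf_comonoid A)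
        (hopf_mult A)"
    and u: "comon_hom M (comon_one M) (hopf_comonoid A) (hopf_unit A)"
    and S: "hopf_antipode A \<in> Arr M" "Dom M (hopf_antipode A) = hopf_carrier A"
        "Cod M (hopf_antipode A) = hopf_carrier A"
    and laws: "hopf_mult A \<cdot> (hopf_mult A \<otimes>\<^sub>m Id M (hopf_carrier A)) =
      hopf_mult A \<cdot> (Id M (hopf_carrier A) \<otimes>\<^sub>m hopf_mult A) \<cdot>
          assoc M (hopf_carrier A) (hopf_carrier A) (hopf_carrier A)"
    "hopf_mult A \<cdot> (hopf_unit A \<otimes>\<^sub>m Id M (hopf_carrier A)) = lunit M (hopf_carrier A)"
    "hopf_mult A \<cdot> (Id M (hopf_carrier A) \<otimes>\<^sub>m hopf_unit A) = runit M (hopf_carrier A)"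
    "conv M A (hopf_comonoid A) (hopf_antipode A) (Id M (hopf_carrier A)) = hopf_unit A \<cdot>
        hopf_counit A"
    "conv M A (hopf_comonoid A) (Id M (hopf_carrier A)) (hopf_antipode A) = hopf_unit A \<cdot>
        hopf_counit A"
  shows "hopf_coc M A"
proof -
  note [simp] = comon_cocD(1-7)[OF C, simplified] comon_homD(1-3)[OF m,
      simplified] comon_homD(1-3)[OF u, simplified] S
  have "hopf_comult A \<cdot> hopf_unit A \<cdot> lunit M (unit_obj M) = (hopf_comult A \<cdot> hopf_unit A) \<cdot>
      lunit M (unit_obj M)" by simp
  also have "\<dots> = hopf_unit A \<otimes>\<^sub>m hopf_unit A"
    using comon_homD(4)[OF u] by (simp del: assoc_comp) simp
  finally have 1: "hopf_comult A \<cdot> hopf_unit A \<cdot> lunit M (unit_obj M) = hopf_unit A \<otimes>\<^sub>m hopf_unit A"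
      .
  have 2: "is_comonoid M (hopf_comonoid A)" "is_cocommutative M (hopf_comonoid A)"
    using C by (auto simp: comon_coc_def)
  show ?thesis
    using laws comon_homD(4,5)[OF m] comon_homD(5)[OF u]
    by (simp add: hopf_coc_def is_hopf_monoid_def is_bimonoid_def is_monoid_def Let_def conv_def
        pairing_def 1 2 in_hset comon_prod_def)
qed

section \<open>Convolution calculus\<close>

lemma conv_hom:
  assumes "hopf_coc M A" "comon_coc M T" "comon_hom M T (hopf_comonoid A) f"
      "comon_hom M T (hopf_comonoid A) g"
  shows "comon_hom M T (hopf_comonoid A) (conv M A T f g)"
  unfolding conv_def
  by (intro comon_hom_comp[OF pairing_hom[OF assms(3,4)] hopf_mult_hom] assms hopf_coc_comon
      comon_prod_coc)

lemma conv_assoc: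
  assumes A: "hopf_coc M A" and T: "comon_coc M T"
    and [simp]: "f \<in> Arr M" "g \<in> Arr M" "h \<in> Arr M" "Dom M f = com_obj T" "Dom M g = com_obj T"
        "Dom M h = com_obj T"
      "Cod M f = hopf_carrier A" "Cod M g = hopf_carrier A" "Cod M h = hopf_carrier A"
  shows "conv M A T (conv M A T f g) h = conv M A T f (conv M A T g h)"
proof -
  note [simp] = hopf_cocD[OF A] T A
  let ?m = "hopf_mult A" and ?a = "hopf_carrier A"
  have "conv M A T (conv M A T f g) h = (?m \<cdot> (?m \<otimes>\<^sub>m Id M ?a)) \<cdot> pairing M T (pairing M T f g) h"
    by (simp add: conv_def tensor_pairing)
  also have "\<dots> = ?m \<cdot> (Id M ?a \<otimes>\<^sub>m ?m) \<cdot> assoc M ?a ?a ?a \<cdot> pairing M T (pairing M T f g) h"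
    by (subst hopf_monoid_laws(1)[OF A]) simp
  also have "\<dots> = conv M A T f (conv M A T g h)"
    by (simp add: assoc_pairing conv_def tensor_pairing)
  finally show ?thesis .
qed

lemma conv_unit:
  assumes A: "hopf_coc M A" and T: "comon_coc M T"
      and [simp]: "f \<in> Arr M" "Dom M f = com_obj T" "Cod M f = hopf_carrier A"
  shows "conv M A T (hopf_unit A \<cdot> com_counit T) f = f" "conv M A T f (hopf_unit A \<cdot> com_counit T) =
      f"
proof -
  note [simp] = hopf_cocD[OF A] T A comon_cocD(1-7)[OF T]
  let ?m = "hopf_mult A" and ?a = "hopf_carrier A" and ?u = "hopf_unit A"
  have "conv M A T (?u \<cdot> com_counit T) f = (?m \<cdot> (?u \<otimes>\<^sub>m Id M ?a)) \<cdot> pairing M T (com_counit T) f"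
    by (simp add: conv_def tensor_pairing)
  then show "conv M A T (hopf_unit A \<cdot> com_counit T) f = f"
    unfolding hopf_monoid_laws(2)[OF A] by (simp add: counit_pairing2)
  have "conv M A T f (?u \<cdot> com_counit T) = (?m \<cdot> (Id M ?a \<otimes>\<^sub>m ?u)) \<cdot> pairing M T f (com_counit T)"
    by (simp add: conv_def tensor_pairing)
  then show "conv M A T f (hopf_unit A \<cdot> com_counit T) = f"
    unfolding hopf_monoid_laws(3)[OF A] by (simp add: counit_pairing1)
qed

lemma conv_comp:
  assumes A: "hopf_coc M A" and "comon_coc M T" "f \<in> Arr M" "g \<in> Arr M" "Dom M f = com_obj T"
      "Dom M g = com_obj T"
    "Cod M f = hopf_carrier A" "Cod M g = hopf_carrier A" and t: "comon_hom M S T t" "comon_coc M S"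
  shows "conv M A T f g \<cdot> t = conv M A S (f \<cdot> t) (g \<cdot> t)"
  unfolding conv_def pairing_comp[OF assms(2-6) t, symmetric]
  by (rule assoc_comp) (use assms hopf_cocD[OF A] comon_homD[OF t(1)] in simp_all)

lemma conv_antipode:
  assumes A: "hopf_coc M A" and T: "comon_coc M T" and f: "comon_hom M T (hopf_comonoid A) f"
  shows "conv M A T (hopf_antipode A \<cdot> f) f = hopf_unit A \<cdot> com_counit T"
    "conv M A T f (hopf_antipode A \<cdot> f) = hopf_unit A \<cdot> com_counit T"
proof -
  note [simp] = hopf_cocD[OF A] T A comon_homD(1-3)[OF f, simplified] comon_homD(5)[OF f,
      simplified] hopf_coc_comon[OF A]
  show "conv M A T (hopf_antipode A \<cdot> f) f = hopf_unit A \<cdot> com_counit T"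
    using conv_comp[OF A hopf_coc_comon[OF A] _ _ _ _ _ _ f T, of "hopf_antipode A"
        "Id M (hopf_carrier A)"]
      hopf_antipode_laws(1)[OF A] by simp
  show "conv M A T f (hopf_antipode A \<cdot> f) = hopf_unit A \<cdot> com_counit T"
    using conv_comp[OF A hopf_coc_comon[OF A] _ _ _ _ _ _ f T, of "Id M (hopf_carrier A)"
        "hopf_antipode A"]
      hopf_antipode_laws(2)[OF A] by simp
qed

text \<open>A left inverse and a right inverse of the same \<open>g\<close> agree, by associativity
  of convolution. Convolution identities thereby become equations between arrows.\<close>

lemma conv_inverse_unique:
  assumes A: "hopf_coc M A" and T: "comon_coc M T"
    and f: "f \<in> Arr M" "g \<in> Arr M" "h \<in> Arr M" "Dom M f = com_obj T" "Dom M g = com_obj T"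
        "Dom M h = com_obj T"
      "Cod M f = hopf_carrier A" "Cod M g = hopf_carrier A" "Cod M h = hopf_carrier A"
    and fg: "conv M A T f g = hopf_unit A \<cdot> com_counit T"
        and gh: "conv M A T g h = hopf_unit A \<cdot> com_counit T"
  shows "f = h"
proof -
  have "f = conv M A T f (hopf_unit A \<cdot> com_counit T)"
    by (rule conv_unit(2)[OF A T, symmetric]) (use f in simp_all)
  also have "\<dots> = conv M A T (conv M A T f g) h" unfolding gh[symmetric]
    by (rule conv_assoc[OF A T, symmetric]) (use f in simp_all)
  also have "\<dots> = h" unfolding fg by (rule conv_unit(1)[OF A T]) (use f in simp_all)
  finally show ?thesis .
qed

lemma hopf_homD:
  assumes "hopf_hom M A B f"
  shows "f \<in> Arr M" "Dom M f = hopf_carrier A" "Cod M f = hopf_carrier B"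
      "comon_hom M (hopf_comonoid A) (hopf_comonoid B) f"
    "f \<cdot> hopf_mult A = hopf_mult B \<cdot> (f \<otimes>\<^sub>m f)" "f \<cdot> hopf_unit A = hopf_unit B" "hopf_counit B \<cdot> f =
        hopf_counit A"
  using assms comon_homD[of "hopf_comonoid A" "hopf_comonoid B" f]
    by (auto simp: hopf_hom_def is_monoid_arr_def)

lemma conv_hopf_hom:
  assumes A: "hopf_coc M A" and B: "hopf_coc M B" and T: "comon_coc M T" and h: "hopf_hom M A B h"
    and f: "f \<in> Arr M" "g \<in> Arr M" "Dom M f = com_obj T" "Dom M g = com_obj T"
    "Cod M f = hopf_carrier A" "Cod M g = hopf_carrier A"
  shows "h \<cdot> conv M A T f g = conv M B T (h \<cdot> f) (h \<cdot> g)"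
proof -
  note [simp] = hopf_homD(1-3)[OF h] f hopf_cocD[OF A] hopf_cocD[OF B] T
  have "h \<cdot> conv M A T f g = (h \<cdot> hopf_mult A) \<cdot> pairing M T f g" by (simp add: conv_def)
  also have "\<dots> = conv M B T (h \<cdot> f) (h \<cdot> g)"
    unfolding hopf_homD(5)[OF h] by (simp add: conv_def tensor_pairing)
  finally show ?thesis .
qed

text \<open>Under convolution one side is a left inverse of \<open>h\<close> and the other a right
  inverse.\<close>

lemma hopf_hom_antipode:
  assumes A: "hopf_coc M A" and B: "hopf_coc M B" and h: "hopf_hom M A B h"
  shows "h \<cdot> hopf_antipode A = hopf_antipode B \<cdot> h"
proof (rule conv_inverse_unique[OF B hopf_coc_comon[OF A]])
  note [simp] = hopf_homD(1-3,6)[OF h] hopf_cocD[OF A] hopf_cocD[OF B] hopf_coc_comon[OF A]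
  have "conv M B (hopf_comonoid A) (h \<cdot> hopf_antipode A) (h \<cdot> Id M (hopf_carrier A)) = h \<cdot>
      (hopf_unit A \<cdot> hopf_counit A)"
    unfolding hopf_antipode_laws(1)[OF A, symmetric]
      by (rule conv_hopf_hom[OF A B _ h, symmetric]) simp_all
  then show "conv M B (hopf_comonoid A) (h \<cdot> hopf_antipode A) h = hopf_unit B \<cdot>
      com_counit (hopf_comonoid A)"
    using comp_tail[OF hopf_homD(6)[OF h], of "hopf_counit A"] by simp
  show "conv M B (hopf_comonoid A) h (hopf_antipode B \<cdot> h) = hopf_unit B \<cdot>
      com_counit (hopf_comonoid A)"
    by (rule conv_antipode(2)[OF B _ hopf_homD(4)[OF h]]) simp
qed (use hopf_homD(1-3)[OF h] hopf_cocD[OF A] hopf_cocD[OF B] in simp_all)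

lemma runit_tensor:
  "a \<in> Obj M \<Longrightarrow> b \<in> Obj M \<Longrightarrow> (Id M a \<otimes>\<^sub>m runit M b) \<cdot> assoc M a b (unit_obj M) = runit M (a \<otimes> b)"
  by (rule arr_eqI[of "Seq (Par (Ide (Leaf a)) (Run (Leaf b))) (Asc (Leaf a) (Leaf b) Unit)"
      "Run (Node (Leaf a) (Leaf b))"]) simp_all

text \<open>In elements, \<open>shear A k\<close> is \<open>(a, b) \<mapsto> (a\<^sub>1, k(a\<^sub>2) b)\<close>.\<close>

definition shear :: "('o, 'm) hopf_obj \<Rightarrow> 'm \<Rightarrow> 'm" where
  "shear A k = (Id M (hopf_carrier A) \<otimes>\<^sub>m hopf_mult A) \<cdot>
      assoc M (hopf_carrier A) (hopf_carrier A) (hopf_carrier A) \<cdot>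
    (pairing M (hopf_comonoid A) (Id M (hopf_carrier A)) k \<otimes>\<^sub>m Id M (hopf_carrier A))"

context
  fixes A a
  assumes A: "hopf_coc M A" and a: "a = hopf_carrier A"
begin

private lemma A_arrs: "a \<in> Obj M" "hopf_carrier A = a"
  "hopf_mult A \<in> Arr M" "Dom M (hopf_mult A) = a \<otimes> a" "Cod M (hopf_mult A) = a"
  "hopf_unit A \<in> Arr M" "Dom M (hopf_unit A) = unit_obj M" "Cod M (hopf_unit A) = a"
  "hopf_antipode A \<in> Arr M" "Dom M (hopf_antipode A) = a" "Cod M (hopf_antipode A) = a"
  "hopf_counit A \<in> Arr M" "Dom M (hopf_counit A) = a" "Cod M (hopf_counit A) = unit_obj M"
  "comon_coc M (hopf_comonoid A)" "hopf_coc M A"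
  using hopf_cocD[OF A] hopf_coc_comon[OF A] A a by auto

lemma shear_arr:
  assumes "k \<in> Arr M" "Dom M k = a" "Cod M k = a"
  shows "shear A k \<in> Arr M" "Dom M (shear A k) = a \<otimes> a" "Cod M (shear A k) = a \<otimes> a"
  using assms by (simp_all add: shear_def A_arrs)

text \<open>Since composition of shears is convolution of their parameters, convolution inverses
  give inverse shears. In elements both sides send \<open>(a, b)\<close> to
  \<open>(a_1, k(a_2) l(a_3) b)\<close>.\<close>

lemma shear_shear:
  assumes [simp]: "k \<in> Arr M" "Dom M k = a" "Cod M k = a" "l \<in> Arr M" "Dom M l = a" "Cod M l = a"
  shows "shear A k \<cdot> shear A l = shear A (conv M A (hopf_comonoid A) k l)"
proof -
  note [simp] = A_arrs
  let ?m = "hopf_mult A" and ?p = "pairing M (hopf_comonoid A)" and ?i = "Id M a"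
  have "shear A k \<cdot> shear A l = (?i \<otimes>\<^sub>m ?m) \<cdot> (assoc M a a a \<cdot> ((?i \<otimes>\<^sub>m ?i) \<otimes>\<^sub>m ?m)) \<cdot>
      ((?p ?i k \<otimes>\<^sub>m (?i \<otimes>\<^sub>m ?i)) \<cdot> assoc M a a a) \<cdot> (?p ?i l \<otimes>\<^sub>m ?i)"
    by (simp add: shear_def interchange)
  also have "\<dots> = (?i \<otimes>\<^sub>m ?m) \<cdot> (?i \<otimes>\<^sub>m ?i \<otimes>\<^sub>m ?m) \<cdot> assoc M a a (a \<otimes> a) \<cdot>
      ((?p ?i k \<otimes>\<^sub>m (?i \<otimes>\<^sub>m ?i)) \<cdot> assoc M a a a) \<cdot> (?p ?i l \<otimes>\<^sub>m ?i)"
    by (subst assoc_nat[of _ _ _ a a "a \<otimes> a"]) simp_all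
  also have "\<dots> = (?i \<otimes>\<^sub>m ?m) \<cdot> (?i \<otimes>\<^sub>m ?i \<otimes>\<^sub>m ?m) \<cdot> (assoc M a a (a \<otimes> a) \<cdot> assoc M (a \<otimes> a) a a) \<cdot>
      ((?p ?i k \<otimes>\<^sub>m ?i) \<otimes>\<^sub>m ?i) \<cdot> (?p ?i l \<otimes>\<^sub>m ?i)"
    by (subst assoc_nat[symmetric, of _ _ _ _ _ _ "a \<otimes> a" a a]) simp_all
  also have "\<dots> = (?i \<otimes>\<^sub>m (?m \<cdot> (?i \<otimes>\<^sub>m ?m) \<cdot> assoc M a a a)) \<cdot> assoc M a (a \<otimes> a) a \<cdot>
      ((assoc M a a a \<cdot> (?p ?i k \<otimes>\<^sub>m ?i) \<cdot> ?p ?i l) \<otimes>\<^sub>m ?i)"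
    by (simp add: pentagon interchange)
  also have "\<dots> = (?i \<otimes>\<^sub>m (?m \<cdot> (?m \<otimes>\<^sub>m ?i))) \<cdot> assoc M a (a \<otimes> a) a \<cdot> (?p ?i (?p k l) \<otimes>\<^sub>m ?i)"
    by (simp add: hopf_monoid_laws(1)[OF A, simplified] tensor_pairing assoc_pairing)
  also have "\<dots> = (?i \<otimes>\<^sub>m ?m) \<cdot> ((?i \<otimes>\<^sub>m ?m \<otimes>\<^sub>m ?i) \<cdot> assoc M a (a \<otimes> a) a) \<cdot> (?p ?i (?p k l) \<otimes>\<^sub>m ?i)"
    by (simp add: interchange)
  also have "\<dots> = (?i \<otimes>\<^sub>m ?m) \<cdot> assoc M a a a \<cdot> (((?i \<otimes>\<^sub>m ?m) \<cdot> ?p ?i (?p k l)) \<otimes>\<^sub>m ?i)"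
    by (subst assoc_nat[symmetric, of _ _ _ _ _ _ a a a]) (simp_all add: interchange)
  also have "\<dots> = shear A (conv M A (hopf_comonoid A) k l)"
    by (simp add: shear_def conv_def tensor_pairing)
  finally show ?thesis .
qed

lemma shear_unit: "shear A (hopf_unit A \<cdot> hopf_counit A) = Id M (a \<otimes> a)"
proof -
  note [simp] = A_arrs
  let ?m = "hopf_mult A" and ?p = "pairing M (hopf_comonoid A)" and ?i = "Id M a"
      and ?u = "hopf_unit A"
  have "shear A (?u \<cdot> hopf_counit A) = (?i \<otimes>\<^sub>m ?m) \<cdot> (assoc M a a a \<cdot> ((?i \<otimes>\<^sub>m ?u) \<otimes>\<^sub>m ?i)) \<cdot>
      (?p ?i (hopf_counit A) \<otimes>\<^sub>m ?i)"
    by (simp add: shear_def interchange tensor_pairing)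
  also have "\<dots> = (?i \<otimes>\<^sub>m (?m \<cdot> (?u \<otimes>\<^sub>m ?i))) \<cdot> assoc M a (unit_obj M) a \<cdot>
      (?p ?i (hopf_counit A) \<otimes>\<^sub>m ?i)"
    by (subst assoc_nat[of _ _ _ a "unit_obj M" a]) (simp_all add: interchange)
  also have "\<dots> = ((?i \<otimes>\<^sub>m lunit M a) \<cdot> assoc M a (unit_obj M) a) \<cdot> (?p ?i (hopf_counit A) \<otimes>\<^sub>m ?i)"
    by (simp add: hopf_monoid_laws(2)[OF A, simplified])
  also have "\<dots> = (runit M a \<cdot> ?p ?i (hopf_counit A)) \<otimes>\<^sub>m ?i"
    by (subst triangle) (simp_all add: interchange)
  also have "\<dots> = Id M (a \<otimes> a)"
    using counit_pairing1[of "hopf_comonoid A" ?i a] by simp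
  finally show ?thesis .
qed

text \<open>
  The shear of the identity is an invertible comonoid morphism, and the antipode is recovered from
  its inverse.
\<close>

lemma antipode_hom: "comon_hom M (hopf_comonoid A) (hopf_comonoid A) (hopf_antipode A)"
proof -
  note [simp] = A_arrs shear_arr
  let ?m = "hopf_mult A" and ?p = "pairing M (hopf_comonoid A)" and ?i = "Id M a"
      and ?u = "hopf_unit A"
    and ?S = "hopf_antipode A" and ?C = "hopf_comonoid A" and ?I = "unit_obj M"
  note i = comon_hom_Id[of ?C, simplified]
  \<comment> \<open>The antipode laws make \<open>?S\<close> and \<open>?i\<close> convolution
    inverses, and \<open>shear_unit\<close> turns the neutral element into the identity.\<close>
  have iso: "iso_arr M (shear A ?i)" "inv_arr M (shear A ?i) = shear A ?S"
    using isoI[of "shear A ?i" "shear A ?S"] hopf_antipode_laws[OF A, simplified]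
    by (simp_all add: shear_shear shear_unit)
  have c: "comon_coc M ?C" "comon_coc M (comon_prod M ?C ?C)"
      "comon_coc M (comon_prod M ?C (comon_prod M ?C ?C))"
    "comon_coc M (comon_prod M (comon_prod M ?C ?C) ?C)"
    by (intro comon_prod_coc A_arrs(15))+
  have "comon_hom M (comon_prod M ?C ?C) (comon_prod M (comon_prod M ?C ?C) ?C) (?p ?i ?i \<otimes>\<^sub>m ?i)"
    by (rule tensor_hom[OF pairing_hom[OF i i] i]) (simp_all add: c)
  from comon_hom_comp[OF this assoc_hom] comon_hom_comp[OF _ tensor_hom[OF i hopf_mult_hom[OF A]]]
  have "comon_hom M (comon_prod M ?C ?C) (comon_prod M ?C ?C) (shear A ?i)"
    by (simp add: shear_def c)
  then have "comon_hom M (comon_prod M ?C ?C) (comon_prod M ?C ?C) (shear A ?S)"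
    using comon_hom_inverse[OF _ iso(1)] iso(2) comon_prod_coc by simp
  moreover have "comon_hom M (comon_prod M ?C (comon_one M)) (comon_prod M ?C ?C) (?i \<otimes>\<^sub>m ?u)"
    by (intro tensor_hom hopf_unit_hom[OF A] i comon_one_coc) simp_all
  moreover have "comon_hom M ?C (comon_prod M ?C (comon_one M)) (inv_arr M (runit M a))"
    using comon_hom_inverse[OF runit_hom[of ?C]] comon_prod_coc[OF _ comon_one_coc, of ?C] by simp
  moreover have "comon_hom M (comon_prod M ?C ?C) ?C (proj2 M ?C ?C)"
    by (intro proj2_hom) simp_all
  \<comment> \<open>In elements the composite is
    \<open>a \<mapsto> (a, 1) \<mapsto> (a_1, S(a_2)) \<mapsto> S(a)\<close>. Each factor is already
    known to be a comonoid morphism.\<close>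
  ultimately have "comon_hom M ?C ?C (proj2 M ?C ?C \<cdot> shear A ?S \<cdot> (?i \<otimes>\<^sub>m ?u) \<cdot>
      inv_arr M (runit M a))"
    by (meson comon_hom_comp comon_prod_coc comon_one_coc A_arrs(15))
  also have "proj2 M ?C ?C \<cdot> shear A ?S \<cdot> (?i \<otimes>\<^sub>m ?u) \<cdot> inv_arr M (runit M a) = ?S"
  proof -
    have "shear A ?S \<cdot> (?i \<otimes>\<^sub>m ?u) = (?i \<otimes>\<^sub>m ?m) \<cdot> (assoc M a a a \<cdot> ((?i \<otimes>\<^sub>m ?i) \<otimes>\<^sub>m ?u)) \<cdot>
        (?p ?i ?S \<otimes>\<^sub>m Id M ?I)"
      by (simp add: shear_def interchange)
    also have "\<dots> = (?i \<otimes>\<^sub>m (?m \<cdot> (?i \<otimes>\<^sub>m ?u))) \<cdot> assoc M a a ?I \<cdot> (?p ?i ?S \<otimes>\<^sub>m Id M ?I)"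
      by (subst assoc_nat[of _ _ _ a a ?I]) (simp_all add: interchange)
    also have "\<dots> = ((?i \<otimes>\<^sub>m runit M a) \<cdot> assoc M a a ?I) \<cdot> (?p ?i ?S \<otimes>\<^sub>m Id M ?I)"
      by (simp add: hopf_monoid_laws(3)[OF A, simplified])
    also have "\<dots> = runit M (Cod M (?p ?i ?S)) \<cdot> (?p ?i ?S \<otimes>\<^sub>m Id M ?I)"
      by (subst runit_tensor) simp_all
    also have "\<dots> = ?p ?i ?S \<cdot> runit M a"
      by (subst runit_nat) simp_all
    finally have 1: "shear A ?S \<cdot> (?i \<otimes>\<^sub>m ?u) = ?p ?i ?S \<cdot> runit M a" .
    have "proj2 M ?C ?C \<cdot> shear A ?S \<cdot> (?i \<otimes>\<^sub>m ?u) \<cdot> inv_arr M (runit M a) = proj2 M ?C ?C \<cdot>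
        ?p ?i ?S"
      using comp_tail[OF 1, of "inv_arr M (runit M a)"] by simp
    also have "\<dots> = lunit M a \<cdot> ?p (hopf_counit A) ?S"
      by (simp add: proj2_def tensor_pairing)
    also have "\<dots> = ?S"
      using counit_pairing2[of ?C ?S a] by simp
    finally show ?thesis .
  qed
  finally show ?thesis .
qed

end

end

section \<open>Abelian categories\<close>

context category
begin

text \<open>Equality of the domains of \<open>g\<close> and \<open>h\<close> is read off from the
  equality of the composites.\<close>

lemma mono_cancel:
  assumes "mono_arr C f" "f \<cdot> g = f \<cdot> h" "g \<in> Arr C" "h \<in> Arr C" "Cod C g = Dom C f" "Cod C h =
      Dom C f"
  shows "g = h"
proof -
  have "Dom C g = Dom C h"
    using arg_cong[OF assms(2), of "Dom C"] assms unfolding mono_arr_def by (metis comp_arr(2))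
  then have "g \<in> hset C (Dom C g) (Dom C f)" "h \<in> hset C (Dom C g) (Dom C f)"
    using assms by (auto simp: in_hset)
  then show ?thesis using assms(1,2) unfolding mono_arr_def by blast
qed

lemma epi_cancel:
  assumes "epi_arr C f" "g \<cdot> f = h \<cdot> f" "g \<in> Arr C" "h \<in> Arr C" "Dom C g = Cod C f" "Dom C h =
      Cod C f"
  shows "g = h"
proof -
  have "Cod C g = Cod C h"
    using arg_cong[OF assms(2), of "Cod C"] assms unfolding epi_arr_def by (metis comp_arr(3))
  then have "g \<in> hset C (Cod C f) (Cod C g)" "h \<in> hset C (Cod C f) (Cod C g)"
    using assms by (auto simp: in_hset)
  then show ?thesis using assms(1,2) unfolding epi_arr_def by blast
qed

lemma mono_arrI:
  assumes "f \<in> Arr C"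
    and "\<And>g h. g \<in> Arr C \<Longrightarrow> h \<in> Arr C \<Longrightarrow> Cod C g = Dom C f \<Longrightarrow> Cod C h = Dom C f \<Longrightarrow> Dom C g = Dom C h \<Longrightarrow>
      f \<cdot> g = f \<cdot> h \<Longrightarrow> g = h"
  shows "mono_arr C f"
  unfolding mono_arr_def by (auto simp: in_hset intro: assms)

lemma epi_arrI:
  assumes "f \<in> Arr C"
    and "\<And>g h. g \<in> Arr C \<Longrightarrow> h \<in> Arr C \<Longrightarrow> Dom C g = Cod C f \<Longrightarrow> Dom C h = Cod C f \<Longrightarrow> Cod C g = Cod C h \<Longrightarrow>
      g \<cdot> f = h \<cdot> f \<Longrightarrow> g = h"
  shows "epi_arr C f"
  unfolding epi_arr_def by (auto simp: in_hset intro: assms)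

lemma mono_is_arr: "mono_arr C f \<Longrightarrow> f \<in> Arr C" and epi_is_arr: "epi_arr C f \<Longrightarrow> f \<in> Arr C"
  by (auto simp: mono_arr_def epi_arr_def)

lemma mono_comp:
  assumes f: "mono_arr C f" and g: "mono_arr C g" and "Cod C f = Dom C g"
  shows "mono_arr C (g \<cdot> f)"
proof (rule mono_arrI)
  note [simp] = mono_is_arr[OF f] mono_is_arr[OF g] assms(3)
  show "g \<cdot> f \<in> Arr C" by simp
  fix h k assume "h \<in> Arr C" "k \<in> Arr C" "Cod C h = Dom C (g \<cdot> f)" "Cod C k = Dom C (g \<cdot> f)"
    and eq: "(g \<cdot> f) \<cdot> h = (g \<cdot> f) \<cdot> k"
  then have [simp]: "h \<in> Arr C" "k \<in> Arr C" "Cod C h = Dom C f" "Cod C k = Dom C f" by auto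
  have "f \<cdot> h = f \<cdot> k" by (rule mono_cancel[OF g]) (use eq in simp_all)
  then show "h = k" by (rule mono_cancel[OF f]) simp_all
qed

lemma epi_comp:
  assumes f: "epi_arr C f" and g: "epi_arr C g" and "Cod C f = Dom C g"
  shows "epi_arr C (g \<cdot> f)"
proof (rule epi_arrI)
  note [simp] = epi_is_arr[OF f] epi_is_arr[OF g] assms(3)
  show "g \<cdot> f \<in> Arr C" by simp
  fix h k assume "h \<in> Arr C" "k \<in> Arr C" "Dom C h = Cod C (g \<cdot> f)" "Dom C k = Cod C (g \<cdot> f)"
    and eq: "h \<cdot> g \<cdot> f = k \<cdot> g \<cdot> f"
  then have [simp]: "h \<in> Arr C" "k \<in> Arr C" "Dom C h = Cod C g" "Dom C k = Cod C g" by auto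
  have "h \<cdot> g = k \<cdot> g" by (rule epi_cancel[OF f]) (use eq in simp_all)
  then show "h = k" by (rule epi_cancel[OF g]) simp_all
qed

lemma epi_left_factor:
  assumes "epi_arr C (g \<cdot> f)" "f \<in> Arr C" "g \<in> Arr C" "Cod C f = Dom C g"
  shows "epi_arr C g"
proof (rule epi_arrI[OF assms(3)])
  fix h k assume h: "h \<in> Arr C" "k \<in> Arr C" "Dom C h = Cod C g" "Dom C k = Cod C g"
      and eq: "h \<cdot> g = k \<cdot> g"
  have "h \<cdot> g \<cdot> f = (h \<cdot> g) \<cdot> f" using h assms(2-4) by simp
  also have "\<dots> = k \<cdot> g \<cdot> f" unfolding eq using h assms(2-4) by simp
  finally show "h = k" by (rule epi_cancel[OF assms(1)]) (use h assms(2-4) in simp_all)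
qed

lemma iso_epi: "iso_arr C f \<Longrightarrow> epi_arr C f"
  by (rule epi_arrI) (auto intro: iso_cancel_right)

lemma Id_epi: "a \<in> Obj C \<Longrightarrow> epi_arr C (Id C a)"
  by (intro iso_epi iso_Id)

lemma split_epi: "f \<in> Arr C \<Longrightarrow> s \<in> Arr C \<Longrightarrow> Cod C s = Dom C f \<Longrightarrow> f \<cdot> s = Id C (Cod C f) \<Longrightarrow> epi_arr C f"
  by (rule epi_left_factor[of f s]) (simp_all add: Id_epi)

text \<open>Uniqueness of factorizations amounts to monicity of \<open>e\<close>; afterwards only
  their existence has to be checked, and no separate domain condition on the factor.\<close>

lemma is_equalizer_iff:
  "is_equalizer C f g e \<longleftrightarrow> f \<in> Arr C \<and> g \<in> Arr C \<and> Dom C g = Dom C f \<and> Cod C g = Cod C f \<and>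
    mono_arr C e \<and> Cod C e = Dom C f \<and> f \<cdot> e = g \<cdot> e \<and>
    (\<forall>h. h \<in> Arr C \<longrightarrow> Cod C h = Dom C f \<longrightarrow> f \<cdot> h = g \<cdot> h \<longrightarrow> (\<exists>k. k \<in> Arr C \<and> Cod C k = Dom C e \<and> e \<cdot>
        k = h))"
    (is "?L \<longleftrightarrow> ?R")
proof
  assume L: ?L
  then have [simp]: "f \<in> Arr C" "g \<in> Arr C" "Dom C g = Dom C f" "Cod C g = Cod C f" "e \<in> Arr C"
      "Cod C e = Dom C f"
    and eq: "f \<cdot> e = g \<cdot> e"
    unfolding is_equalizer_def in_hset by auto
  have U: "\<exists>!k. k \<in> hset C (Dom C h) (Dom C e) \<and> e \<cdot> k = h"
    if "h \<in> Arr C" "Cod C h = Dom C f" "f \<cdot> h = g \<cdot> h" for h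
  proof -
    have "h \<in> hset C (Dom C h) (Dom C f)" using that by (simp add: in_hset)
    moreover have "\<forall>x. \<forall>h \<in> hset C x (Dom C f). f \<cdot> h = g \<cdot> h \<longrightarrow> (\<exists>!k. k \<in> hset C x (Dom C e) \<and> e \<cdot>
        k = h)"
      using L unfolding is_equalizer_def by (elim conjE)
    ultimately show ?thesis using that(3) by simp
  qed
  have "mono_arr C e"
  proof (rule mono_arrI)
    fix h k assume h: "h \<in> Arr C" "k \<in> Arr C" "Cod C h = Dom C e" "Cod C k = Dom C e" "Dom C h =
        Dom C k"
      and hk: "e \<cdot> h = e \<cdot> k"
    have "f \<cdot> e \<cdot> h = g \<cdot> e \<cdot> h" using comp_tail[OF eq, of h] h by simp
    then obtain l where "\<And>k. k \<in> hset C (Dom C (e \<cdot> h)) (Dom C e) \<and> e \<cdot> k = e \<cdot> h \<Longrightarrow> k = l"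
      using U[of "e \<cdot> h"] h by auto
    from this[of h] this[of k] show "h = k" using h hk by (simp add: in_hset)
  qed simp
  moreover have "\<exists>k. k \<in> Arr C \<and> Cod C k = Dom C e \<and> e \<cdot> k = h"
    if "h \<in> Arr C" "Cod C h = Dom C f" "f \<cdot> h = g \<cdot> h" for h
    using U[OF that] unfolding in_hset by blast
  ultimately show ?R using eq by simp
next
  assume R: ?R
  then have m: "mono_arr C e" and [simp]: "e \<in> Arr C" by (auto intro: mono_is_arr)
  show ?L unfolding is_equalizer_def
  proof (intro conjI allI ballI impI)
    fix x h assume "h \<in> hset C x (Dom C f)" and fh: "f \<cdot> h = g \<cdot> h"
    then have h: "h \<in> Arr C" "Dom C h = x" "Cod C h = Dom C f" by (auto simp: in_hset)
    with R fh obtain k where k: "k \<in> Arr C" "Cod C k = Dom C e" "e \<cdot> k = h" by blast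
    then have "Dom C k = x" using h by auto
    then show "\<exists>!k. k \<in> hset C x (Dom C e) \<and> e \<cdot> k = h"
      using k by (intro ex1I[of _ k]) (auto simp: in_hset intro: mono_cancel[OF m])
  qed (use R in \<open>auto simp: in_hset\<close>)
qed

lemma equalizer_factor:
  assumes "is_equalizer C f g e" "h \<in> Arr C" "Cod C h = Dom C f" "f \<cdot> h = g \<cdot> h"
  obtains k where "k \<in> Arr C" "Cod C k = Dom C e" "e \<cdot> k = h"
  using assms unfolding is_equalizer_iff by blast

end

section \<open>Zero arrows and subtraction\<close>

context preadditive_category
begin

lemma zero_arr_arr [simp]:
  assumes "a \<in> Obj C" "b \<in> Obj C"
  shows "zero_arr C a b \<in> Arr C" "Dom C (zero_arr C a b) = a" "Cod C (zero_arr C a b) = b"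
proof -
  interpret comm_group "hom_group C a b" by (rule hom_comm_group[OF assms])
  show "zero_arr C a b \<in> Arr C" "Dom C (zero_arr C a b) = a" "Cod C (zero_arr C a b) = b"
    using one_closed by (auto simp: hom_group_def in_hset)
qed

text \<open>In a group only the neutral element is idempotent. Being idempotent is visibly preserved
  by composition and by additive functors, hence so are zero arrows.\<close>

lemma add_idem_zero:
  assumes "f \<in> Arr C" "f +\<^sub>m f = f"
  shows "f = zero_arr C (Dom C f) (Cod C f)"
proof -
  interpret comm_group "hom_group C (Dom C f) (Cod C f)"
    by (rule hom_comm_group) (use assms in auto)
  show ?thesis using r_cancel_one[of f f] assms by (auto simp: hom_group_def in_hset)
qed

lemma zero_add_zero: "a \<in> Obj C \<Longrightarrow> b \<in> Obj C \<Longrightarrow> zero_arr C a b +\<^sub>m zero_arr C a b = zero_arr C a b"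
proof -
  assume "a \<in> Obj C" "b \<in> Obj C"
  then interpret comm_group "hom_group C a b" by (rule hom_comm_group)
  show ?thesis using l_one[OF one_closed] by (simp add: hom_group_def)
qed

lemma comp_zero [simp]:
  assumes f: "f \<in> Arr C" "Dom C f = b" and a: "a \<in> Obj C"
  shows "f \<cdot> zero_arr C a b = zero_arr C a (Cod C f)"
proof -
  let ?z = "zero_arr C a b"
  have b: "b \<in> Obj C" using f by auto
  have "(f \<cdot> ?z) +\<^sub>m (f \<cdot> ?z) = f \<cdot> (?z +\<^sub>m ?z)"
    using f a b by (intro add_comp[of ?z a b ?z f "Cod C f", symmetric]) (auto simp: in_hset)
  then show ?thesis using add_idem_zero[of "f \<cdot> ?z"] f a b by (simp add: zero_add_zero)
qed

lemma zero_comp [simp]: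
  assumes f: "f \<in> Arr C" "Cod C f = a" and b: "b \<in> Obj C"
  shows "zero_arr C a b \<cdot> f = zero_arr C (Dom C f) b"
proof -
  let ?z = "zero_arr C a b"
  have a: "a \<in> Obj C" using f by auto
  have "(?z \<cdot> f) +\<^sub>m (?z \<cdot> f) = (?z +\<^sub>m ?z) \<cdot> f"
    using f a b by (intro comp_add[of f "Dom C f" a ?z b ?z, symmetric]) (auto simp: in_hset)
  then show ?thesis using add_idem_zero[of "?z \<cdot> f"] f a b by (simp add: zero_add_zero)
qed

text \<open>The record provides addition only, so subtraction is taken in the hom group, which the
  boundary of \<open>f\<close> selects.\<close>

definition diff :: "'m \<Rightarrow> 'm \<Rightarrow> 'm" where
  "diff f g = f +\<^sub>m inv\<^bsub>hom_group C (Dom C f) (Cod C f)\<^esub> g"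

lemma diff_props:
  assumes "f \<in> Arr C" "g \<in> Arr C" "Dom C g = Dom C f" "Cod C g = Cod C f"
  shows "diff f g \<in> Arr C" "Dom C (diff f g) = Dom C f" "Cod C (diff f g) = Cod C f"
      "diff f g +\<^sub>m g = f"
    "h \<in> Arr C \<Longrightarrow> Dom C h = Dom C f \<Longrightarrow> Cod C h = Cod C f \<Longrightarrow> h +\<^sub>m g = f \<Longrightarrow> h = diff f g"
    "diff f g = zero_arr C (Dom C f) (Cod C f) \<longleftrightarrow> f = g"
    "diff f (zero_arr C (Dom C f) (Cod C f)) = f"
proof -
  interpret comm_group "hom_group C (Dom C f) (Cod C f)"
    by (rule hom_comm_group) (use assms in auto)
  let ?G = "hom_group C (Dom C f) (Cod C f)"
  have d: "diff f g = mult ?G f (inv\<^bsub>?G\<^esub> g)" by (simp add: diff_def hom_group_def)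
  have c: "f \<in> carrier ?G" "g \<in> carrier ?G" using assms by (auto simp: hom_group_def in_hset)
  then have "diff f g \<in> carrier ?G" unfolding d by simp
  then show "diff f g \<in> Arr C" "Dom C (diff f g) = Dom C f" "Cod C (diff f g) = Cod C f"
    by (auto simp: hom_group_def in_hset)
  have "mult ?G (diff f g) g = f" unfolding d using c by (simp add: m_assoc)
  then show "diff f g +\<^sub>m g = f" by (simp add: hom_group_def)
  show "h = diff f g" if "h \<in> Arr C" "Dom C h = Dom C f" "Cod C h = Cod C f" "h +\<^sub>m g = f"
  proof -
    have "h \<in> carrier ?G" "mult ?G h g = f" using that by (auto simp: hom_group_def in_hset)
    then show ?thesis unfolding d using c inv_solve_right[of h f g] by simp
  qed
  have "diff f g = one ?G \<longleftrightarrow> f = g" unfolding d using c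
    by (metis inv_closed inv_inv inv_equality r_inv)
  then show "diff f g = zero_arr C (Dom C f) (Cod C f) \<longleftrightarrow> f = g" by (simp add: hom_group_def)
  have "mult ?G f (inv\<^bsub>?G\<^esub> one ?G) = f" using c by simp
  then have "diff f (one ?G) = f" by (simp add: diff_def hom_group_def)
  then show "diff f (zero_arr C (Dom C f) (Cod C f)) = f" by (simp add: hom_group_def)
qed

lemma diff_comp:
  assumes f: "f \<in> Arr C" "g \<in> Arr C" "Dom C g = Dom C f" "Cod C g = Cod C f"
      and h: "h \<in> Arr C" "Cod C h = Dom C f"
  shows "diff f g \<cdot> h = diff (f \<cdot> h) (g \<cdot> h)"
proof (rule diff_props(5))
  note [simp] = f h diff_props(1-3)[OF f]
  have "(diff f g \<cdot> h) +\<^sub>m (g \<cdot> h) = (diff f g +\<^sub>m g) \<cdot> h"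
    by (rule comp_add[of h "Dom C h" "Dom C f" "diff f g" "Cod C f" g,
        symmetric]) (simp_all add: in_hset)
  then show "(diff f g \<cdot> h) +\<^sub>m (g \<cdot> h) = f \<cdot> h" by (simp add: diff_props(4)[OF f])
qed (use f h diff_props(1-3)[OF f] in simp_all)

lemma comp_diff:
  assumes f: "f \<in> Arr C" "g \<in> Arr C" "Dom C g = Dom C f" "Cod C g = Cod C f"
      and h: "h \<in> Arr C" "Cod C f = Dom C h"
  shows "h \<cdot> diff f g = diff (h \<cdot> f) (h \<cdot> g)"
proof (rule diff_props(5))
  note [simp] = f h diff_props(1-3)[OF f]
  have "(h \<cdot> diff f g) +\<^sub>m (h \<cdot> g) = h \<cdot> (diff f g +\<^sub>m g)"
    by (rule add_comp[of "diff f g" "Dom C f" "Cod C f" g h "Cod C h",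
        symmetric]) (simp_all add: in_hset)
  then show "(h \<cdot> diff f g) +\<^sub>m (h \<cdot> g) = h \<cdot> f" by (simp add: diff_props(4)[OF f])
qed (use f h diff_props(1-3)[OF f] in simp_all)

lemma mono_arr_zeroI:
  assumes "f \<in> Arr C" "\<And>g. g \<in> Arr C \<Longrightarrow> Cod C g = Dom C f \<Longrightarrow> f \<cdot> g = zero_arr C (Dom C g) (Cod C f) \<Longrightarrow>
    g = zero_arr C (Dom C g) (Dom C f)"
  shows "mono_arr C f"
proof (rule mono_arrI[OF assms(1)])
  fix g h assume g: "g \<in> Arr C" "h \<in> Arr C" "Cod C g = Dom C f" "Cod C h = Dom C f" "Dom C g =
      Dom C h" "f \<cdot> g = f \<cdot> h"
  then have "f \<cdot> diff g h = zero_arr C (Dom C g) (Cod C f)"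
    using assms(1) diff_props(6)[of "f \<cdot> g" "f \<cdot> h"] by (simp add: comp_diff)
  then have "diff g h = zero_arr C (Dom C g) (Cod C g)"
    using assms(2)[of "diff g h"] diff_props(1-3)[of g h] g by simp
  then show "g = h" using diff_props(6)[of g h] g by simp
qed

lemma epi_arr_zeroI:
  assumes "f \<in> Arr C" "\<And>g. g \<in> Arr C \<Longrightarrow> Dom C g = Cod C f \<Longrightarrow> g \<cdot> f = zero_arr C (Dom C f) (Cod C g) \<Longrightarrow>
    g = zero_arr C (Cod C f) (Cod C g)"
  shows "epi_arr C f"
proof (rule epi_arrI[OF assms(1)])
  fix g h assume g: "g \<in> Arr C" "h \<in> Arr C" "Dom C g = Cod C f" "Dom C h = Cod C f" "Cod C g =
      Cod C h" "g \<cdot> f = h \<cdot> f"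
  then have "diff g h \<cdot> f = zero_arr C (Dom C f) (Cod C g)"
    using assms(1) diff_props(6)[of "g \<cdot> f" "h \<cdot> f"] by (simp add: diff_comp)
  then have "diff g h = zero_arr C (Dom C g) (Cod C g)"
    using assms(2)[of "diff g h"] diff_props(1-3)[of g h] g by simp
  then show "g = h" using diff_props(6)[of g h] g by simp
qed

end

section \<open>Kernels, cokernels and images\<close>

context abelian_category
begin

lemma zero_obj_arr:
  assumes z: "zero_obj C z" and f: "f \<in> Arr C" and "Dom C f = z \<or> Cod C f = z"
  shows "f = zero_arr C (Dom C f) (Cod C f)"
proof -
  have z': "z \<in> Obj C" using z by (simp add: zero_obj_def)
  from assms(3) show ?thesis
  proof
    assume "Dom C f = z"
    moreover have "\<exists>!g. g \<in> hset C z (Cod C f)" using z f unfolding zero_obj_def by auto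
    ultimately show ?thesis using f z' by (auto simp: in_hset)
  next
    assume "Cod C f = z"
    moreover have "\<exists>!g. g \<in> hset C (Dom C f) z" using z f unfolding zero_obj_def by auto
    ultimately show ?thesis using f z' by (auto simp: in_hset)
  qed
qed

text \<open>Reconciles two notions of zero arrow: factoring through a zero object, and being neutral
  for addition. They agree because the hom sets from and to a zero object are singletons.\<close>

lemma is_zero_arr_iff: "is_zero_arr C f \<longleftrightarrow> f \<in> Arr C \<and> f = zero_arr C (Dom C f) (Cod C f)"
proof
  assume "is_zero_arr C f"
  then obtain z s t where z: "zero_obj C z" and "s \<in> hset C (Dom C f) z" "t \<in> hset C z (Cod C f)"
    and f: "f \<in> Arr C" "f = t \<cdot> s"
    unfolding is_zero_arr_def by blast
  then have s: "s \<in> Arr C" "Dom C s = Dom C f" "Cod C s = z"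
      and t: "t \<in> Arr C" "Dom C t = z" "Cod C t = Cod C f"
    unfolding in_hset by blast+
  have "s = zero_arr C (Dom C f) z" using zero_obj_arr[OF z s(1)] s by simp
  then have "t \<cdot> s = zero_arr C (Dom C f) (Cod C f)" using t f(1) by simp
  then have "f = zero_arr C (Dom C f) (Cod C f)" using f(2) by simp
  then show "f \<in> Arr C \<and> f = zero_arr C (Dom C f) (Cod C f)" using f(1) by blast
next
  assume f: "f \<in> Arr C \<and> f = zero_arr C (Dom C f) (Cod C f)"
  obtain z where z: "zero_obj C z" using ex_zero_obj by auto
  then have z': "z \<in> Obj C" by (simp add: zero_obj_def)
  have "zero_arr C z (Cod C f) \<cdot> zero_arr C (Dom C f) z = zero_arr C (Dom C f) (Cod C f)"
    using f z' by simp
  then show "is_zero_arr C f"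
    unfolding is_zero_arr_def using f z z'
    by (intro conjI exI[of _ z] bexI[of _ "zero_arr C (Dom C f) z"] bexI[of _ "zero_arr C z (Cod C
        f)"])
      (auto simp: in_hset)
qed

lemma kernelD:
  assumes "is_kernel C f k"
  shows "f \<in> Arr C" "k \<in> Arr C" "Cod C k = Dom C f" "f \<cdot> k = zero_arr C (Dom C k) (Cod C f)"
      "mono_arr C k"
    "h \<in> Arr C \<Longrightarrow> Cod C h = Dom C f \<Longrightarrow> f \<cdot> h = zero_arr C (Dom C h) (Cod C f) \<Longrightarrow>
      \<exists>l. l \<in> Arr C \<and> Dom C l = Dom C h \<and> Cod C l = Dom C k \<and> k \<cdot> l = h"
proof -
  show f [simp]: "f \<in> Arr C" "k \<in> Arr C" "Cod C k = Dom C f"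
      and z: "f \<cdot> k = zero_arr C (Dom C k) (Cod C f)"
    using assms by (auto simp: is_kernel_def is_zero_arr_iff)
  have U: "\<exists>!l. l \<in> hset C (Dom C h) (Dom C k) \<and> k \<cdot> l = h"
    if "h \<in> Arr C" "Cod C h = Dom C f" "f \<cdot> h = zero_arr C (Dom C h) (Cod C f)" for h
  proof -
    have "is_zero_arr C (f \<cdot> h)" using that by (simp add: is_zero_arr_iff)
    moreover have "h \<in> hset C (Dom C h) (Dom C f)" using that by (simp add: in_hset)
    moreover have "\<forall>x. \<forall>h \<in> hset C x (Dom C f). is_zero_arr C (f \<cdot> h) \<longrightarrow>
        (\<exists>!l. l \<in> hset C x (Dom C k) \<and> k \<cdot> l = h)"
      using assms unfolding is_kernel_def by (elim conjE)
    ultimately show ?thesis by simp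
  qed
  then show "h \<in> Arr C \<Longrightarrow> Cod C h = Dom C f \<Longrightarrow> f \<cdot> h = zero_arr C (Dom C h) (Cod C f) \<Longrightarrow>
      \<exists>l. l \<in> Arr C \<and> Dom C l = Dom C h \<and> Cod C l = Dom C k \<and> k \<cdot> l = h"
    by (metis in_hset)
  show "mono_arr C k"
  proof (rule mono_arrI)
    fix g h assume h: "g \<in> Arr C" "h \<in> Arr C" "Cod C g = Dom C k" "Cod C h = Dom C k" "Dom C g =
        Dom C h" and eq: "k \<cdot> g = k \<cdot> h"
    have "f \<cdot> k \<cdot> g = zero_arr C (Dom C g) (Cod C f)" using comp_tail[OF z, of g] h by simp
    then obtain l where "\<And>y. y \<in> hset C (Dom C (k \<cdot> g)) (Dom C k) \<and> k \<cdot> y = k \<cdot> g \<Longrightarrow> y = l"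
      using U[of "k \<cdot> g"] h by auto
    from this[of g] this[of h] show "g = h" using h eq by (simp add: in_hset)
  qed simp
qed

lemma cokernelD:
  assumes "is_cokernel C f q"
  shows "f \<in> Arr C" "q \<in> Arr C" "Dom C q = Cod C f" "q \<cdot> f = zero_arr C (Dom C f) (Cod C q)"
      "epi_arr C q"
    "h \<in> Arr C \<Longrightarrow> Dom C h = Cod C f \<Longrightarrow> h \<cdot> f = zero_arr C (Dom C f) (Cod C h) \<Longrightarrow>
      \<exists>l. l \<in> Arr C \<and> Dom C l = Cod C q \<and> Cod C l = Cod C h \<and> l \<cdot> q = h"
proof -
  show f [simp]: "f \<in> Arr C" "q \<in> Arr C" "Dom C q = Cod C f"
      and z: "q \<cdot> f = zero_arr C (Dom C f) (Cod C q)"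
    using assms by (auto simp: is_cokernel_def is_zero_arr_iff)
  have U: "\<exists>!l. l \<in> hset C (Cod C q) (Cod C h) \<and> l \<cdot> q = h"
    if "h \<in> Arr C" "Dom C h = Cod C f" "h \<cdot> f = zero_arr C (Dom C f) (Cod C h)" for h
  proof -
    have "is_zero_arr C (h \<cdot> f)" using that by (simp add: is_zero_arr_iff)
    moreover have "h \<in> hset C (Cod C f) (Cod C h)" using that by (simp add: in_hset)
    moreover have "\<forall>x. \<forall>h \<in> hset C (Cod C f) x. is_zero_arr C (h \<cdot> f) \<longrightarrow>
        (\<exists>!l. l \<in> hset C (Cod C q) x \<and> l \<cdot> q = h)"
      using assms unfolding is_cokernel_def by (elim conjE)
    ultimately show ?thesis by simp
  qed
  then show "h \<in> Arr C \<Longrightarrow> Dom C h = Cod C f \<Longrightarrow> h \<cdot> f = zero_arr C (Dom C f) (Cod C h) \<Longrightarrow>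
      \<exists>l. l \<in> Arr C \<and> Dom C l = Cod C q \<and> Cod C l = Cod C h \<and> l \<cdot> q = h"
    by (metis in_hset)
  show "epi_arr C q"
  proof (rule epi_arrI)
    fix g h assume h: "g \<in> Arr C" "h \<in> Arr C" "Dom C g = Cod C q" "Dom C h = Cod C q" "Cod C g =
        Cod C h" and eq: "g \<cdot> q = h \<cdot> q"
    have "(g \<cdot> q) \<cdot> f = zero_arr C (Dom C f) (Cod C g)" using z h by simp
    then obtain l where "\<And>y. y \<in> hset C (Cod C q) (Cod C (g \<cdot> q)) \<and> y \<cdot> q = g \<cdot> q \<Longrightarrow> y = l"
      using U[of "g \<cdot> q"] h by auto
    from this[of g] this[of h] show "g = h" using h eq by (simp add: in_hset)
  qed simp
qed

lemma kernelI:
  assumes "f \<in> Arr C" "mono_arr C k" "Cod C k = Dom C f" "f \<cdot> k = zero_arr C (Dom C k) (Cod C f)"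
    and "\<And>h. h \<in> Arr C \<Longrightarrow> Cod C h = Dom C f \<Longrightarrow> f \<cdot> h = zero_arr C (Dom C h) (Cod C f) \<Longrightarrow>
      \<exists>l. l \<in> Arr C \<and> Cod C l = Dom C k \<and> k \<cdot> l = h"
  shows "is_kernel C f k"
  unfolding is_kernel_def
proof (intro conjI allI ballI impI)
  show [simp]: "k \<in> Arr C" by (rule mono_is_arr[OF assms(2)])
  show "is_zero_arr C (f \<cdot> k)" using assms by (simp add: is_zero_arr_iff)
  fix x h assume h: "h \<in> hset C x (Dom C f)" "is_zero_arr C (f \<cdot> h)"
  then obtain l where l: "l \<in> Arr C" "Cod C l = Dom C k" "k \<cdot> l = h"
    using assms(5)[of h] assms(1) by (auto simp: in_hset is_zero_arr_iff)
  then have "Dom C l = x" using h assms by (auto simp: in_hset)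
  then show "\<exists>!l. l \<in> hset C x (Dom C k) \<and> k \<cdot> l = h"
    using l by (intro ex1I[of _ l]) (auto simp: in_hset intro: mono_cancel[OF assms(2)])
qed (use assms in auto)

lemma cokernelI:
  assumes "f \<in> Arr C" "epi_arr C q" "Dom C q = Cod C f" "q \<cdot> f = zero_arr C (Dom C f) (Cod C q)"
    and "\<And>h. h \<in> Arr C \<Longrightarrow> Dom C h = Cod C f \<Longrightarrow> h \<cdot> f = zero_arr C (Dom C f) (Cod C h) \<Longrightarrow>
      \<exists>l. l \<in> Arr C \<and> Dom C l = Cod C q \<and> l \<cdot> q = h"
  shows "is_cokernel C f q"
  unfolding is_cokernel_def
proof (intro conjI allI ballI impI)
  show [simp]: "q \<in> Arr C" by (rule epi_is_arr[OF assms(2)])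
  show "is_zero_arr C (q \<cdot> f)" using assms by (simp add: is_zero_arr_iff)
  fix x h assume h: "h \<in> hset C (Cod C f) x" "is_zero_arr C (h \<cdot> f)"
  then obtain l where l: "l \<in> Arr C" "Dom C l = Cod C q" "l \<cdot> q = h"
    using assms(5)[of h] assms(1) by (auto simp: in_hset is_zero_arr_iff)
  then have "Cod C l = x" using h assms by (auto simp: in_hset)
  then show "\<exists>!l. l \<in> hset C (Cod C q) x \<and> l \<cdot> q = h"
    using l by (intro ex1I[of _ l]) (auto simp: in_hset intro: epi_cancel[OF assms(2)])
qed (use assms in auto)

text \<open>In an abelian category \<open>e\<close> is the cokernel of some arrow, and that arrow is
  among the \<open>x\<close> killed by \<open>e\<close>.\<close>

lemma epi_factor:
  assumes e: "epi_arr C e" and h: "h \<in> Arr C" "Dom C h = Dom C e"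
    and 0: "\<And>x. x \<in> Arr C \<Longrightarrow> Cod C x = Dom C e \<Longrightarrow> e \<cdot> x = zero_arr C (Dom C x) (Cod C e) \<Longrightarrow> h \<cdot> x =
        zero_arr C (Dom C x) (Cod C h)"
  shows "\<exists>l. l \<in> Arr C \<and> Dom C l = Cod C e \<and> Cod C l = Cod C h \<and> l \<cdot> e = h"
proof -
  obtain f where f: "is_cokernel C f e" using epi_is_cokernel[OF e]
    by (auto simp: some_cokernel_def)
  show ?thesis using cokernelD[OF f] 0[of f] h by metis
qed

lemma mono_factor:
  assumes e: "mono_arr C e" and h: "h \<in> Arr C" "Cod C h = Cod C e"
    and 0: "\<And>x. x \<in> Arr C \<Longrightarrow> Dom C x = Cod C e \<Longrightarrow> x \<cdot> e = zero_arr C (Dom C e) (Cod C x) \<Longrightarrow> x \<cdot> h =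
        zero_arr C (Dom C h) (Cod C x)"
  shows "\<exists>l. l \<in> Arr C \<and> Dom C l = Dom C h \<and> Cod C l = Dom C e \<and> e \<cdot> l = h"
proof -
  obtain f where f: "is_kernel C f e" using mono_is_kernel[OF e] by (auto simp: some_kernel_def)
  show ?thesis using kernelD[OF f] 0[of f] h by metis
qed

lemma epi_cokernel_of_kernel:
  assumes e: "epi_arr C e" and k: "is_kernel C e k"
  shows "is_cokernel C k e"
proof (rule cokernelI)
  note [simp] = kernelD(1-3)[OF k]
  fix h assume h: "h \<in> Arr C" "Dom C h = Cod C k" "h \<cdot> k = zero_arr C (Dom C k) (Cod C h)"
  have "h \<cdot> x = zero_arr C (Dom C x) (Cod C h)"
    if x: "x \<in> Arr C" "Cod C x = Dom C e" "e \<cdot> x = zero_arr C (Dom C x) (Cod C e)" for x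
  proof -
    obtain l where l: "l \<in> Arr C" "Dom C l = Dom C x" "Cod C l = Dom C k" "k \<cdot> l = x"
      using kernelD(6)[OF k x] by auto
    have "h \<cdot> k \<cdot> l = zero_arr C (Dom C x) (Cod C h)" using comp_tail[OF h(3), of l] h l(1-3)
      by simp
    then show ?thesis by (simp only: l(4))
  qed
  then have "\<exists>l. l \<in> Arr C \<and> Dom C l = Cod C e \<and> Cod C l = Cod C h \<and> l \<cdot> e = h"
    using h by (intro epi_factor[OF e]) simp_all
  then show "\<exists>l. l \<in> Arr C \<and> Dom C l = Cod C e \<and> l \<cdot> e = h" by blast
qed (use e kernelD[OF k] in auto)

lemma mono_kernel_of_cokernel:
  assumes e: "mono_arr C e" and q: "is_cokernel C e q"
  shows "is_kernel C q e"
proof (rule kernelI)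
  note [simp] = cokernelD(1-3)[OF q]
  fix h assume h: "h \<in> Arr C" "Cod C h = Dom C q" "q \<cdot> h = zero_arr C (Dom C h) (Cod C q)"
  have "x \<cdot> h = zero_arr C (Dom C h) (Cod C x)"
    if x: "x \<in> Arr C" "Dom C x = Cod C e" "x \<cdot> e = zero_arr C (Dom C e) (Cod C x)" for x
  proof -
    obtain l where l: "l \<in> Arr C" "Dom C l = Cod C q" "Cod C l = Cod C x" "l \<cdot> q = x"
      using cokernelD(6)[OF q x] by auto
    have "(l \<cdot> q) \<cdot> h = zero_arr C (Dom C h) (Cod C x)" using h l(1-3) by simp
    then show ?thesis by (simp only: l(4))
  qed
  then have "\<exists>l. l \<in> Arr C \<and> Dom C l = Dom C h \<and> Cod C l = Dom C e \<and> e \<cdot> l = h"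
    using h by (intro mono_factor[OF e]) simp_all
  then show "\<exists>l. l \<in> Arr C \<and> Cod C l = Dom C e \<and> e \<cdot> l = h" by blast
qed (use e cokernelD[OF q] in auto)

text \<open>
  With \<open>q\<close> the cokernel of the kernel of \<open>f = m \<cdot> q\<close>, the arrow \<open>m\<close> is monic: if \<open>m \<cdot> x = 0\<close> then
  \<open>m\<close> factors through the cokernel \<open>c\<close> of \<open>x\<close>, so \<open>c \<cdot> q\<close> kills no more than \<open>f\<close> and \<open>c\<close> splits.
\<close>

lemma epi_mono_factorization:
  assumes [simp]: "f \<in> Arr C"
  shows "\<exists>e m. epi_arr C e \<and> mono_arr C m \<and> Dom C e = Dom C f \<and> Cod C m = Cod C f \<and> Dom C m =
      Cod C e \<and> m \<cdot> e = f"
proof -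
  obtain k where k: "is_kernel C f k" using ex_kernel[OF assms] by auto
  note [simp] = kernelD(2,3)[OF k]
  obtain q where q: "is_cokernel C k q" using ex_cokernel[of k] by auto
  note [simp] = cokernelD(2,3)[OF q]
  obtain m where m [simp]: "m \<in> Arr C" "Dom C m = Cod C q" "Cod C m = Cod C f" and mq: "m \<cdot> q = f"
    using cokernelD(6)[OF q assms _ kernelD(4)[OF k]] by auto
  have "mono_arr C m"
  proof (rule mono_arr_zeroI)
    fix x assume [simp]: "x \<in> Arr C" "Cod C x = Dom C m"
        and mx: "m \<cdot> x = zero_arr C (Dom C x) (Cod C m)"
    obtain c where c: "is_cokernel C x c" using ex_cokernel[of x] by auto
    note [simp] = cokernelD(2,3)[OF c]
    obtain m' where [simp]: "m' \<in> Arr C" "Dom C m' = Cod C c" "Cod C m' = Cod C m"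
        and m': "m' \<cdot> c = m"
      using cokernelD(6)[OF c _ _ mx] by auto
    have cq: "epi_arr C (c \<cdot> q)" by (rule epi_comp) (use cokernelD(5)[OF q] cokernelD(5)[OF c] in
        simp_all)
    have "q \<cdot> y = zero_arr C (Dom C y) (Cod C q)"
      if [simp]: "y \<in> Arr C" "Cod C y = Dom C (c \<cdot> q)"
          and y: "(c \<cdot> q) \<cdot> y = zero_arr C (Dom C y) (Cod C (c \<cdot> q))" for y
    proof -
      have "f \<cdot> y = ((m' \<cdot> c) \<cdot> q) \<cdot> y" by (simp only: mq m')
      also have "\<dots> = m' \<cdot> (c \<cdot> q) \<cdot> y" using that(2) by simp
      also have "\<dots> = zero_arr C (Dom C y) (Cod C f)" by (subst y) simp
      finally obtain l where [simp]: "l \<in> Arr C" "Cod C l = Dom C k" "Dom C l = Dom C y"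
          and l: "k \<cdot> l = y"
        using kernelD(6)[OF k, of y] by auto
      have "q \<cdot> k \<cdot> l = zero_arr C (Dom C y) (Cod C q)" using comp_tail[OF cokernelD(4)[OF q], of l]
        by simp
      then show ?thesis by (simp only: l)
    qed
    from epi_factor[OF cq _ _ this] obtain r where [simp]: "r \<in> Arr C" "Dom C r = Cod C c"
        "Cod C r = Cod C q"
      and r: "r \<cdot> c \<cdot> q = q" by auto
    have "r \<cdot> c = Id C (Cod C q)"
      by (rule epi_cancel[OF cokernelD(5)[OF q]]) (simp_all add: r)
    then have "x = r \<cdot> c \<cdot> x" by (simp flip: assoc_comp)
    also have "\<dots> = zero_arr C (Dom C x) (Dom C m)" by (simp add: cokernelD(4)[OF c])
    finally show "x = zero_arr C (Dom C x) (Dom C m)" .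
  qed simp
  then show ?thesis using mq cokernelD(5)[OF q] by (intro exI[of _ q] exI[of _ m]) simp
qed

text \<open>Whatever \<open>e\<close> kills is killed by \<open>j \<cdot> t\<close>, hence by
  \<open>t\<close>, as \<open>j\<close> is monic; so \<open>t\<close> factors through
  \<open>e\<close>. This is the tool that puts algebraic structure on images.\<close>

lemma diagonal_fill:
  assumes e: "epi_arr C e" and j: "mono_arr C j"
      and [simp]: "t \<in> Arr C" "r \<in> Arr C" "Dom C t = Dom C e" "Dom C r = Cod C e"
    "Cod C t = Dom C j" "Cod C r = Cod C j" and eq: "j \<cdot> t = r \<cdot> e"
  shows "\<exists>d. d \<in> Arr C \<and> Dom C d = Cod C e \<and> Cod C d = Dom C j \<and> j \<cdot> d = r \<and> d \<cdot> e = t"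
proof -
  note [simp] = epi_is_arr[OF e] mono_is_arr[OF j]
  have "t \<cdot> x = zero_arr C (Dom C x) (Cod C t)"
    if [simp]: "x \<in> Arr C" "Cod C x = Dom C e" and x: "e \<cdot> x = zero_arr C (Dom C x) (Cod C e)" for x
  proof (rule mono_cancel[OF j])
    show "j \<cdot> t \<cdot> x = j \<cdot> zero_arr C (Dom C x) (Cod C t)"
    proof -
      have "j \<cdot> t \<cdot> x = (j \<cdot> t) \<cdot> x" by simp
      also have "\<dots> = r \<cdot> e \<cdot> x" unfolding eq by simp
      also have "\<dots> = j \<cdot> zero_arr C (Dom C x) (Cod C t)" unfolding x by simp
      finally show ?thesis .
    qed
  qed simp_all
  then have "\<exists>d. d \<in> Arr C \<and> Dom C d = Cod C e \<and> Cod C d = Cod C t \<and> d \<cdot> e = t"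
    by (intro epi_factor[OF e]) simp_all
  then obtain d where [simp]: "d \<in> Arr C" "Dom C d = Cod C e" "Cod C d = Dom C j" and d: "d \<cdot> e = t"
    by auto
  have "j \<cdot> d = r" by (rule epi_cancel[OF e]) (simp_all add: d eq)
  then show ?thesis using d by (intro exI[of _ d]) simp
qed

lemma equalizer_iff_kernel:
  assumes [simp]: "f \<in> Arr C" "g \<in> Arr C" "Dom C g = Dom C f" "Cod C g = Cod C f"
  shows "is_equalizer C f g e \<longleftrightarrow> is_kernel C (diff f g) e"
proof -
  note [simp] = diff_props(1-3)[of f g]
  have iff: "f \<cdot> h = g \<cdot> h \<longleftrightarrow> diff f g \<cdot> h = zero_arr C (Dom C h) (Cod C (diff f g))"
    if "h \<in> Arr C" "Cod C h = Dom C f" for h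
    using diff_props(6)[of "f \<cdot> h" "g \<cdot> h"] that by (simp add: diff_comp)
  show ?thesis
  proof
    assume e: "is_kernel C (diff f g) e"
    show "is_equalizer C f g e"
      unfolding is_equalizer_iff using kernelD[OF e] iff[of e] iff by auto
  next
    assume "is_equalizer C f g e"
    then have e: "mono_arr C e" "Cod C e = Dom C f" "f \<cdot> e = g \<cdot> e"
      and U: "\<And>h. h \<in> Arr C \<Longrightarrow> Cod C h = Dom C f \<Longrightarrow> f \<cdot> h = g \<cdot> h \<Longrightarrow> \<exists>k. k \<in> Arr C \<and> Cod C k =
          Dom C e \<and> e \<cdot> k = h"
      unfolding is_equalizer_iff by auto
    show "is_kernel C (diff f g) e"
      by (rule kernelI) (use e iff[of e] mono_is_arr[OF e(1)] iff U in auto)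
  qed
qed

lemma ex_equalizer:
  assumes "f \<in> Arr C" "g \<in> Arr C" "Dom C g = Dom C f" "Cod C g = Cod C f"
  shows "\<exists>e. is_equalizer C f g e"
  using ex_kernel[of "diff f g"] diff_props(1)[OF assms] equalizer_iff_kernel[OF assms] by blast

section \<open>Exact additive functors\<close>

context
  fixes F :: "'m \<Rightarrow> 'm" and G :: "'o \<Rightarrow> 'o"
  assumes F_arr: "\<And>f. f \<in> Arr C \<Longrightarrow> F f \<in> Arr C" "\<And>f. f \<in> Arr C \<Longrightarrow> Dom C (F f) = G (Dom C f)"
      "\<And>f. f \<in> Arr C \<Longrightarrow> Cod C (F f) = G (Cod C f)"
    and F_comp: "\<And>f g. f \<in> Arr C \<Longrightarrow> g \<in> Arr C \<Longrightarrow> Cod C f = Dom C g \<Longrightarrow> F (g \<cdot> f) = F g \<cdot> F f"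
    and F_add: "additive_functor C C F" and F_exact: "exact_functor C C F"
begin

lemma functor_zero:
  assumes [simp]: "a \<in> Obj C" "b \<in> Obj C"
  shows "F (zero_arr C a b) = zero_arr C (G a) (G b)"
proof -
  have "zero_arr C a b \<in> hset C a b" by (simp add: in_hset)
  then have "F (zero_arr C a b +\<^sub>m zero_arr C a b) = F (zero_arr C a b) +\<^sub>m F (zero_arr C a b)"
    using F_add assms unfolding additive_functor_def by blast
  then show ?thesis
    using add_idem_zero[of "F (zero_arr C a b)"] F_arr[of "zero_arr C a b"]
      by (simp add: zero_add_zero)
qed

lemma functor_diff:
  assumes f: "f \<in> Arr C" "g \<in> Arr C" "Dom C g = Dom C f" "Cod C g = Cod C f"
  shows "F (diff f g) = diff (F f) (F g)"
proof (rule diff_props(5))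
  note [simp] = f diff_props(1-3)[OF f]
  have "diff f g \<in> hset C (Dom C f) (Cod C f)" "g \<in> hset C (Dom C f) (Cod C f)"
    by (simp_all add: in_hset)
  moreover have "Dom C f \<in> Obj C" "Cod C f \<in> Obj C" by simp_all
  ultimately have "F (diff f g +\<^sub>m g) = F (diff f g) +\<^sub>m F g"
    using F_add unfolding additive_functor_def by blast
  then show "F (diff f g) +\<^sub>m F g = F f" by (simp add: diff_props(4)[OF f])
qed (use f diff_props(1-3)[OF f] in \<open>simp_all add: F_arr\<close>)

lemma functor_mono:
  assumes f: "mono_arr C f"
  shows "mono_arr C (F f)"
proof -
  obtain q where q: "is_cokernel C f q" using ex_cokernel[OF mono_is_arr[OF f]] by auto
  then have "short_exact C f q" using mono_kernel_of_cokernel[OF f q] by (simp add: short_exact_def)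
  then have "short_exact C (F f) (F q)" using F_exact by (simp add: exact_functor_def)
  then show ?thesis using kernelD(5) by (auto simp: short_exact_def)
qed

lemma functor_epi:
  assumes f: "epi_arr C f"
  shows "epi_arr C (F f)"
proof -
  obtain k where k: "is_kernel C f k" using ex_kernel[OF epi_is_arr[OF f]] by auto
  then have "short_exact C k f" using epi_cokernel_of_kernel[OF f k] by (simp add: short_exact_def)
  then have "short_exact C (F k) (F f)" using F_exact by (simp add: exact_functor_def)
  then show ?thesis using cokernelD(5) by (auto simp: short_exact_def)
qed

text \<open>Exactness is given for short exact sequences only. For a general \<open>f\<close>, the
  image factorization reduces the claim to the epimorphism \<open>e\<close>, and \<open>F m\<close>
  stays monic.\<close>

lemma functor_kernel:
  assumes k: "is_kernel C f k"
  shows "is_kernel C (F f) (F k)"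
proof -
  note [simp] = kernelD(1-3)[OF k]
  obtain e m where e: "epi_arr C e" and m: "mono_arr C m"
      and [simp]: "Dom C e = Dom C f" "Cod C m = Cod C f" "Dom C m = Cod C e"
    and me: "m \<cdot> e = f"
    using epi_mono_factorization[of f] by auto
  note [simp] = epi_is_arr[OF e] mono_is_arr[OF m]
  have z: "e \<cdot> h = zero_arr C (Dom C h) (Cod C e)"
    if [simp]: "h \<in> Arr C" "Cod C h = Dom C f" and h: "f \<cdot> h = zero_arr C (Dom C h) (Cod C f)" for h
  proof (rule mono_cancel[OF m])
    have "m \<cdot> e \<cdot> h = f \<cdot> h" unfolding me[symmetric] by simp
    then show "m \<cdot> e \<cdot> h = m \<cdot> zero_arr C (Dom C h) (Cod C e)" using h by simp
  qed simp_all
  \<comment> \<open>As \<open>m\<close> is monic, \<open>f\<close> and \<open>e\<close> have the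
    same kernel, and \<open>k\<close>, \<open>e\<close> form a short exact sequence.\<close>
  have ke: "is_kernel C e k"
  proof (rule kernelI)
    show "e \<cdot> k = zero_arr C (Dom C k) (Cod C e)" by (rule z) (simp_all add: kernelD(4)[OF k])
    fix h assume [simp]: "h \<in> Arr C" "Cod C h = Dom C e"
        and h: "e \<cdot> h = zero_arr C (Dom C h) (Cod C e)"
    have "f \<cdot> h = m \<cdot> e \<cdot> h" unfolding me[symmetric] by simp
    then have "f \<cdot> h = zero_arr C (Dom C h) (Cod C f)" using h by simp
    then show "\<exists>l. l \<in> Arr C \<and> Cod C l = Dom C k \<and> k \<cdot> l = h" using kernelD(6)[OF k, of h] by auto
  qed (use kernelD(5)[OF k] in simp_all)
  then have "short_exact C k e" using epi_cokernel_of_kernel[OF e ke] by (simp add: short_exact_def)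
  then have "short_exact C (F k) (F e)" using F_exact by (simp add: exact_functor_def)
  then have Fk: "is_kernel C (F e) (F k)" by (simp add: short_exact_def)
  have [simp]: "G (Cod C e) \<in> Obj C" using Cod_Obj[OF F_arr(1)[of e]] F_arr(3)[of e] by simp
  have Ff: "F f = F m \<cdot> F e" unfolding me[symmetric] by (simp add: F_comp)
  show ?thesis
  proof (rule kernelI)
    show "F f \<cdot> F k = zero_arr C (Dom C (F k)) (Cod C (F f))"
      using F_comp[of k f] functor_zero[of "Dom C k" "Cod C f"]
        by (simp add: kernelD(4)[OF k] F_arr)
    fix h assume [simp]: "h \<in> Arr C" and "Cod C h = Dom C (F f)"
        and h: "F f \<cdot> h = zero_arr C (Dom C h) (Cod C (F f))"
    then have [simp]: "Cod C h = G (Dom C f)" by (simp add: F_arr)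
    have "F e \<cdot> h = zero_arr C (Dom C h) (Cod C (F e))"
      by (rule mono_cancel[OF functor_mono[OF m]]) (use h in \<open>simp_all add: Ff F_arr\<close>)
    then show "\<exists>l. l \<in> Arr C \<and> Cod C l = Dom C (F k) \<and> F k \<cdot> l = h"
      using kernelD(6)[OF Fk, of h] by (auto simp: F_arr)
  qed (use functor_mono[OF kernelD(5)[OF k]] in \<open>simp_all add: F_arr\<close>)
qed

lemma functor_equalizer:
  assumes "is_equalizer C f g e"
  shows "is_equalizer C (F f) (F g) (F e)"
proof -
  have f [simp]: "f \<in> Arr C" "g \<in> Arr C" "Dom C g = Dom C f" "Cod C g = Cod C f"
    using assms by (auto simp: is_equalizer_iff)
  have "is_kernel C (F (diff f g)) (F e)"
    by (rule functor_kernel) (use assms equalizer_iff_kernel[OF f] in auto)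
  then show ?thesis
    using equalizer_iff_kernel[of "F f" "F g"] functor_diff[OF f] F_arr by simp
qed

end

end

section \<open>Consequences of exactness of the tensor product\<close>

context abelian_symmetric_monoidal_category
begin

lemma tensor_Id_mono: "mono_arr M f \<Longrightarrow> a \<in> Obj M \<Longrightarrow> mono_arr M (f \<otimes>\<^sub>m Id M a)"
  by (rule functor_mono[where G = "\<lambda>b. b \<otimes> a",
      OF _ _ _ _ tensor_right_additive tensor_right_exact]) (simp_all add: interchange)

lemma Id_tensor_mono: "mono_arr M f \<Longrightarrow> a \<in> Obj M \<Longrightarrow> mono_arr M (Id M a \<otimes>\<^sub>m f)"
  by (rule functor_mono[where G = "\<lambda>b. a \<otimes> b",
      OF _ _ _ _ tensor_left_additive tensor_left_exact]) (simp_all add: interchange)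

lemma tensor_Id_epi: "epi_arr M f \<Longrightarrow> a \<in> Obj M \<Longrightarrow> epi_arr M (f \<otimes>\<^sub>m Id M a)"
  by (rule functor_epi[where G = "\<lambda>b. b \<otimes> a",
      OF _ _ _ _ tensor_right_additive tensor_right_exact]) (simp_all add: interchange)

lemma Id_tensor_epi: "epi_arr M f \<Longrightarrow> a \<in> Obj M \<Longrightarrow> epi_arr M (Id M a \<otimes>\<^sub>m f)"
  by (rule functor_epi[where G = "\<lambda>b. a \<otimes> b",
      OF _ _ _ _ tensor_left_additive tensor_left_exact]) (simp_all add: interchange)

lemma tensor_Id_kernel: "is_kernel M f k \<Longrightarrow> a \<in> Obj M \<Longrightarrow> is_kernel M (f \<otimes>\<^sub>m Id M a) (k \<otimes>\<^sub>m Id M a)"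
  by (rule functor_kernel[where G = "\<lambda>b. b \<otimes> a",
      OF _ _ _ _ tensor_right_additive tensor_right_exact]) (simp_all add: interchange)

lemma Id_tensor_equalizer:
  "is_equalizer M f g e \<Longrightarrow> a \<in> Obj M \<Longrightarrow> is_equalizer M (Id M a \<otimes>\<^sub>m f) (Id M a \<otimes>\<^sub>m g) (Id M a \<otimes>\<^sub>m e)"
  by (rule functor_equalizer[where G = "\<lambda>b. a \<otimes> b",
      OF _ _ _ _ tensor_left_additive tensor_left_exact]) (simp_all add: interchange)

lemma tensor_Id_zero: "a \<in> Obj M \<Longrightarrow> b \<in> Obj M \<Longrightarrow> c \<in> Obj M \<Longrightarrow> zero_arr M a b \<otimes>\<^sub>m Id M c =
    zero_arr M (a \<otimes> c) (b \<otimes> c)"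
  by (rule functor_zero[where G = "\<lambda>b. b \<otimes> c",
      OF _ _ _ _ tensor_right_additive tensor_right_exact]) (simp_all add: interchange)

lemma tensor_Id_diff:
  "f \<in> Arr M \<Longrightarrow> g \<in> Arr M \<Longrightarrow> Dom M g = Dom M f \<Longrightarrow> Cod M g = Cod M f \<Longrightarrow> c \<in> Obj M \<Longrightarrow>
    diff f g \<otimes>\<^sub>m Id M c = diff (f \<otimes>\<^sub>m Id M c) (g \<otimes>\<^sub>m Id M c)"
  by (rule functor_diff[where G = "\<lambda>b. b \<otimes> c",
      OF _ _ _ _ tensor_right_additive tensor_right_exact]) (simp_all add: interchange)

lemma tensor_mono:
  assumes f: "mono_arr M f" and g: "mono_arr M g"
  shows "mono_arr M (f \<otimes>\<^sub>m g)"
proof -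
  note [simp] = mono_is_arr[OF f] mono_is_arr[OF g]
  have "mono_arr M ((f \<otimes>\<^sub>m Id M (Cod M g)) \<cdot> (Id M (Dom M f) \<otimes>\<^sub>m g))"
    by (intro mono_comp tensor_Id_mono Id_tensor_mono f g) simp_all
  then show ?thesis by (simp add: interchange)
qed

lemma tensor_epi:
  assumes f: "epi_arr M f" and g: "epi_arr M g"
  shows "epi_arr M (f \<otimes>\<^sub>m g)"
proof -
  note [simp] = epi_is_arr[OF f] epi_is_arr[OF g]
  have "epi_arr M ((f \<otimes>\<^sub>m Id M (Cod M g)) \<cdot> (Id M (Dom M f) \<otimes>\<^sub>m g))"
    by (intro epi_comp tensor_Id_epi Id_tensor_epi f g) simp_all
  then show ?thesis by (simp add: interchange)
qed

end

section \<open>Cotensor products as pullbacks\<close>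

context abelian_symmetric_monoidal_category
begin

text \<open>Each axiom for \<open>d\<close> is tested after a tensor power of \<open>e\<close>,
  which is monic because tensoring is exact; there it becomes the axiom of \<open>W\<close>.\<close>

lemma comon_sub:
  assumes W: "comon_coc M W" and e: "mono_arr M e" and c: "Cod M e = com_obj W"
    and d: "d \<in> Arr M" "Dom M d = Dom M e" "Cod M d = Dom M e \<otimes> Dom M e" "(e \<otimes>\<^sub>m e) \<cdot> d =
        com_comult W \<cdot> e"
  shows "comon_coc M \<lparr>com_obj = Dom M e, com_comult = d, com_counit = com_counit W \<cdot> e\<rparr>"
    "comon_hom M \<lparr>com_obj = Dom M e, com_comult = d, com_counit = com_counit W \<cdot> e\<rparr> W e"
proof -
  let ?w = "com_obj W" and ?e = "Dom M e"
      and ?E = "\<lparr>com_obj = Dom M e, com_comult = d, com_counit = com_counit W \<cdot> e\<rparr>"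
  note [simp] = comon_cocD(1-7)[OF W] mono_is_arr[OF e] c d(1-3)
  have dw: "(e \<otimes>\<^sub>m e) \<cdot> d \<cdot> h = com_comult W \<cdot> e \<cdot> h" if "h \<in> Arr M" "Cod M h = ?e" for h
    using comp_tail[OF d(4), of h] that by simp
  show "comon_hom M ?E W e" by (rule comon_homI) (simp_all add: d(4))
  show "comon_coc M ?E"
  proof (rule comon_cocI[OF refl refl refl])
    have "assoc M ?e ?e ?e \<cdot> (d \<otimes>\<^sub>m Id M ?e) \<cdot> d = (Id M ?e \<otimes>\<^sub>m d) \<cdot> d"
    proof (rule mono_cancel[OF tensor_mono[OF e tensor_mono[OF e e]]])
      have "(e \<otimes>\<^sub>m e \<otimes>\<^sub>m e) \<cdot> assoc M ?e ?e ?e \<cdot> (d \<otimes>\<^sub>m Id M ?e) \<cdot> d =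
          (assoc M ?w ?w ?w \<cdot> ((e \<otimes>\<^sub>m e) \<otimes>\<^sub>m e)) \<cdot> (d \<otimes>\<^sub>m Id M ?e) \<cdot> d"
        by (subst assoc_nat[of _ _ _ ?e ?e ?e]) simp_all
      also have "\<dots> = assoc M ?w ?w ?w \<cdot> ((com_comult W \<cdot> e) \<otimes>\<^sub>m e) \<cdot> d"
        by (simp add: interchange d(4))
      also have "\<dots> = assoc M ?w ?w ?w \<cdot> (com_comult W \<otimes>\<^sub>m Id M ?w) \<cdot> (e \<otimes>\<^sub>m e) \<cdot> d"
        by (simp add: interchange)
      also have "\<dots> = (assoc M ?w ?w ?w \<cdot> (com_comult W \<otimes>\<^sub>m Id M ?w) \<cdot> com_comult W) \<cdot> e"
        by (simp add: d(4))
      also have "\<dots> = (Id M ?w \<otimes>\<^sub>m com_comult W) \<cdot> (e \<otimes>\<^sub>m e) \<cdot> d"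
        unfolding comon_cocD(8)[OF W] by (simp add: d(4))
      also have "\<dots> = (e \<otimes>\<^sub>m (com_comult W \<cdot> e)) \<cdot> d"
        by (simp add: interchange)
      also have "\<dots> = (e \<otimes>\<^sub>m e \<otimes>\<^sub>m e) \<cdot> (Id M ?e \<otimes>\<^sub>m d) \<cdot> d"
        unfolding d(4)[symmetric] by (simp add: interchange)
      finally show "(e \<otimes>\<^sub>m e \<otimes>\<^sub>m e) \<cdot> assoc M ?e ?e ?e \<cdot> (d \<otimes>\<^sub>m Id M ?e) \<cdot> d = (e \<otimes>\<^sub>m e \<otimes>\<^sub>m e) \<cdot>
          (Id M ?e \<otimes>\<^sub>m d) \<cdot> d" .
    qed simp_all
    then show "assoc M (com_obj ?E) (com_obj ?E) (com_obj ?E) \<cdot>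
        (com_comult ?E \<otimes>\<^sub>m Id M (com_obj ?E)) \<cdot> com_comult ?E =
        (Id M (com_obj ?E) \<otimes>\<^sub>m com_comult ?E) \<cdot> com_comult ?E" by simp
    have "lunit M ?e \<cdot> ((com_counit W \<cdot> e) \<otimes>\<^sub>m Id M ?e) \<cdot> d = Id M ?e"
    proof (rule mono_cancel[OF e])
      have "e \<cdot> lunit M ?e \<cdot> ((com_counit W \<cdot> e) \<otimes>\<^sub>m Id M ?e) \<cdot> d =
          (lunit M (Cod M e) \<cdot> (Id M (unit_obj M) \<otimes>\<^sub>m e)) \<cdot> ((com_counit W \<cdot> e) \<otimes>\<^sub>m Id M ?e) \<cdot> d"
        by (subst lunit_nat) simp_all
      also have "\<dots> = lunit M ?w \<cdot> (com_counit W \<otimes>\<^sub>m Id M ?w) \<cdot> (e \<otimes>\<^sub>m e) \<cdot> d"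
        by (simp add: interchange)
      also have "\<dots> = (lunit M ?w \<cdot> (com_counit W \<otimes>\<^sub>m Id M ?w) \<cdot> com_comult W) \<cdot> e"
        by (simp add: d(4))
      finally show "e \<cdot> lunit M ?e \<cdot> ((com_counit W \<cdot> e) \<otimes>\<^sub>m Id M ?e) \<cdot> d = e \<cdot> Id M ?e"
        by (simp add: comon_cocD(9)[OF W])
    qed simp_all
    then show "lunit M (com_obj ?E) \<cdot> (com_counit ?E \<otimes>\<^sub>m Id M (com_obj ?E)) \<cdot> com_comult ?E =
        Id M (com_obj ?E)" by simp
    have "symm M ?e ?e \<cdot> d = d"
    proof (rule mono_cancel[OF tensor_mono[OF e e]])
      have "(e \<otimes>\<^sub>m e) \<cdot> symm M ?e ?e \<cdot> d = (symm M (Cod M e) (Cod M e) \<cdot> (e \<otimes>\<^sub>m e)) \<cdot> d"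
        by (subst symm_nat) simp_all
      also have "\<dots> = (symm M ?w ?w \<cdot> com_comult W) \<cdot> e"
        by (simp add: d(4))
      finally show "(e \<otimes>\<^sub>m e) \<cdot> symm M ?e ?e \<cdot> d = (e \<otimes>\<^sub>m e) \<cdot> d"
        by (simp only: comon_cocD(11)[OF W] d(4))
    qed simp_all
    then show "symm M (com_obj ?E) (com_obj ?E) \<cdot> com_comult ?E = com_comult ?E" by simp
  qed simp_all
qed

text \<open>Compatibility of \<open>x\<close> with comultiplication may be tested after the monic
  \<open>e \<otimes> e\<close>.\<close>

lemma comon_hom_mono_factor:
  assumes e: "comon_hom M E W e" "mono_arr M e"
      and x: "x \<in> Arr M" "Dom M x = com_obj T" "Cod M x = com_obj E"
    and h: "comon_hom M T W (e \<cdot> x)" and c: "comon_coc M E" "comon_coc M W" "comon_coc M T"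
  shows "comon_hom M T E x"
proof (rule comon_homI)
  note [simp] = comon_homD(1-3)[OF e(1)] x comon_cocD(1-7)[OF c(1)] comon_cocD(1-7)[OF c(2)]
      comon_cocD(1-7)[OF c(3)]
  show "com_comult E \<cdot> x = (x \<otimes>\<^sub>m x) \<cdot> com_comult T"
  proof (rule mono_cancel[OF tensor_mono[OF e(2) e(2)]])
    have "(e \<otimes>\<^sub>m e) \<cdot> com_comult E \<cdot> x = com_comult W \<cdot> e \<cdot> x"
      using comp_tail[OF comon_homD(4)[OF e(1)], of x] by simp
    then show "(e \<otimes>\<^sub>m e) \<cdot> com_comult E \<cdot> x = (e \<otimes>\<^sub>m e) \<cdot> (x \<otimes>\<^sub>m x) \<cdot> com_comult T"
      using comon_homD(4)[OF h] by (simp add: interchange)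
  qed simp_all
  show "com_counit E \<cdot> x = com_counit T"
    using comp_tail[OF comon_homD(5)[OF e(1)], of x] comon_homD(5)[OF h] by simp
qed (use x in simp_all)

text \<open>
  Coassociativity puts \<open>com_comult W \<cdot> e\<close> into \<open>W \<otimes> E\<close>, cocommutativity into \<open>E \<otimes> W\<close>, and
  exactness of the tensor product into \<open>E \<otimes> E\<close>.
\<close>

lemma comon_equalizer:
  assumes W: "comon_coc M W" and B: "comon_coc M B" and s: "comon_hom M W B s"
      and t: "comon_hom M W B t"
    and e: "is_equalizer M (pairing M W (Id M (com_obj W)) s) (pairing M W (Id M (com_obj W)) t) e"
  obtains E where "com_obj E = Dom M e" "comon_coc M E" "comon_hom M E W e"
proof -
  let ?w = "com_obj W" and ?i = "Id M (com_obj W)" and ?e = "Dom M e"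
  let ?r = "\<lambda>s. pairing M W ?i s"
  note [simp] = comon_cocD(1-7)[OF W] W comon_homD(1-3)[OF s] comon_homD(1-3)[OF t] comon_cocD(1)[OF
      B]
  have m: "mono_arr M e" and [simp]: "Cod M e = ?w" and re: "?r s \<cdot> e = ?r t \<cdot> e"
    using e unfolding is_equalizer_iff by simp_all
  note [simp] = mono_is_arr[OF m]
  have 1: "(?i \<otimes>\<^sub>m ?r s) \<cdot> com_comult W = assoc M ?w ?w (com_obj B) \<cdot>
      (com_comult W \<otimes>\<^sub>m Id M (com_obj B)) \<cdot> ?r s"
    if [simp]: "s \<in> Arr M" "Dom M s = ?w" "Cod M s = com_obj B" for s
  proof -
    have d: "com_comult W = ?r ?i" by (simp add: pairing_def)
    have "(?i \<otimes>\<^sub>m ?r s) \<cdot> com_comult W = ?r (?r s)" by (subst d) (simp add: tensor_pairing)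
    also have "\<dots> = assoc M ?w ?w (com_obj B) \<cdot> pairing M W (?r ?i) s" by (simp add: assoc_pairing)
    also have "\<dots> = assoc M ?w ?w (com_obj B) \<cdot> (com_comult W \<otimes>\<^sub>m Id M (com_obj B)) \<cdot> ?r s"
      by (subst d[symmetric]) (simp add: tensor_pairing)
    finally show ?thesis .
  qed
  have 2: "(?i \<otimes>\<^sub>m ?r s) \<cdot> com_comult W \<cdot> e = (?i \<otimes>\<^sub>m ?r t) \<cdot> com_comult W \<cdot> e"
    using comp_tail[OF 1[of s], of e] comp_tail[OF 1[of t], of e] re by simp
  obtain v where [simp]: "v \<in> Arr M" "Cod M v = ?w \<otimes> ?e" and v: "(?i \<otimes>\<^sub>m e) \<cdot> v = com_comult W \<cdot> e"
    using equalizer_factor[OF Id_tensor_equalizer[OF e, of ?w], of "com_comult W \<cdot> e"] 2 by auto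
  have [simp]: "Dom M v = ?e" using arg_cong[OF v, of "Dom M"] by simp
  let ?u = "symm M ?w ?e \<cdot> v"
  have "(e \<otimes>\<^sub>m ?i) \<cdot> ?u = (symm M (Cod M ?i) (Cod M e) \<cdot> (?i \<otimes>\<^sub>m e)) \<cdot> v"
    by (subst symm_nat) simp_all
  also have "\<dots> = (symm M ?w ?w \<cdot> com_comult W) \<cdot> e" by (simp add: v)
  finally have u: "(e \<otimes>\<^sub>m ?i) \<cdot> ?u = com_comult W \<cdot> e" by (simp only: comon_cocD(11)[OF W])
  have 3: "(e \<otimes>\<^sub>m Id M (?w \<otimes> com_obj B)) \<cdot> (Id M ?e \<otimes>\<^sub>m ?r s) \<cdot> ?u = (?i \<otimes>\<^sub>m ?r s) \<cdot> com_comult W \<cdot> e"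
    if [simp]: "s \<in> Arr M" "Dom M s = ?w" "Cod M s = com_obj B" for s
  proof -
    have "(e \<otimes>\<^sub>m Id M (?w \<otimes> com_obj B)) \<cdot> (Id M ?e \<otimes>\<^sub>m ?r s) \<cdot> ?u = (?i \<otimes>\<^sub>m ?r s) \<cdot> (e \<otimes>\<^sub>m ?i) \<cdot> ?u"
      by (simp add: interchange)
    then show ?thesis unfolding u .
  qed
  \<comment> \<open>Whether \<open>?u\<close> factors through \<open>Id \<otimes> e\<close> is
    tested after the monic \<open>e \<otimes> Id\<close>, where it becomes equation
    \<open>2\<close>.\<close>
  have 4: "(Id M ?e \<otimes>\<^sub>m ?r s) \<cdot> ?u = (Id M ?e \<otimes>\<^sub>m ?r t) \<cdot> ?u"
    by (rule mono_cancel[OF tensor_Id_mono[OF m, of "?w \<otimes> com_obj B"]]) (use 2 3 in simp_all)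
  obtain d where [simp]: "d \<in> Arr M" "Cod M d = ?e \<otimes> ?e" and d: "(Id M ?e \<otimes>\<^sub>m e) \<cdot> d = ?u"
    using equalizer_factor[OF Id_tensor_equalizer[OF e, of ?e], of ?u] 4 by auto
  have [simp]: "Dom M d = ?e" using arg_cong[OF d, of "Dom M"] by simp
  have "(e \<otimes>\<^sub>m e) \<cdot> d = (e \<otimes>\<^sub>m ?i) \<cdot> (Id M ?e \<otimes>\<^sub>m e) \<cdot> d" by (simp add: interchange)
  also have "\<dots> = com_comult W \<cdot> e" unfolding d u ..
  finally have dd: "(e \<otimes>\<^sub>m e) \<cdot> d = com_comult W \<cdot> e" .
  show thesis by (rule that[OF _ comon_sub[OF W m, of d]]) (simp_all add: dd)
qed

text \<open>With \<open>cotensor_right\<close>, the parallel pair whose equalizer is the cotensor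
  product of \<open>V\<close> (along \<open>p\<close>) and \<open>A\<close> (along \<open>f\<close>)
  over \<open>B\<close>. In elements the two arrows are \<open>(x, y) \<mapsto> (x, p(x), y)\<close>
  and \<open>(x, y) \<mapsto> (x, f(y), y)\<close>.\<close>

definition cotensor_left :: "('o, 'm) comonoid_obj \<Rightarrow> ('o, 'm) comonoid_obj \<Rightarrow> ('o,
    'm) comonoid_obj \<Rightarrow> 'm \<Rightarrow> 'm" where
  "cotensor_left V A B p = assoc M (com_obj V) (com_obj B) (com_obj A) \<cdot> (((Id M (com_obj V) \<otimes>\<^sub>m p) \<cdot>
      com_comult V) \<otimes>\<^sub>m Id M (com_obj A))"

definition cotensor_right :: "('o, 'm) comonoid_obj \<Rightarrow> ('o, 'm) comonoid_obj \<Rightarrow> 'm \<Rightarrow> 'm" where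
  "cotensor_right V A f = Id M (com_obj V) \<otimes>\<^sub>m ((f \<otimes>\<^sub>m Id M (com_obj A)) \<cdot> com_comult A)"

context
  fixes V A B p f
  assumes V: "comon_coc M V" and A: "comon_coc M A" and B: "comon_coc M B"
    and p: "comon_hom M V B p" and f: "comon_hom M A B f"
begin

private lemma VA_arrs: "com_obj V \<in> Obj M" "com_obj A \<in> Obj M" "com_obj B \<in> Obj M" "comon_coc M V"
    "comon_coc M A" "comon_coc M B"
  "p \<in> Arr M" "Dom M p = com_obj V" "Cod M p = com_obj B" "f \<in> Arr M" "Dom M f = com_obj A"
      "Cod M f = com_obj B"
  "com_comult V \<in> Arr M" "Dom M (com_comult V) = com_obj V" "Cod M (com_comult V) =
      com_obj V \<otimes> com_obj V"
  "com_comult A \<in> Arr M" "Dom M (com_comult A) = com_obj A" "Cod M (com_comult A) =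
      com_obj A \<otimes> com_obj A"
  using comon_homD(1-3)[OF p] comon_homD(1-3)[OF f] V A B comon_cocD(1-7)[OF V] comon_cocD(1-7)[OF
      A] comon_cocD(1)[OF B]
  by simp_all

lemma cotensor_arrs:
  "cotensor_left V A B p \<in> Arr M" "Dom M (cotensor_left V A B p) = com_obj V \<otimes> com_obj A"
  "Cod M (cotensor_left V A B p) = com_obj V \<otimes> com_obj B \<otimes> com_obj A"
  "cotensor_right V A f \<in> Arr M" "Dom M (cotensor_right V A f) = com_obj V \<otimes> com_obj A"
  "Cod M (cotensor_right V A f) = com_obj V \<otimes> com_obj B \<otimes> com_obj A"
  by (simp_all add: cotensor_left_def cotensor_right_def VA_arrs)

lemma cotensor_pairing:
  assumes T: "comon_coc M T" and x: "comon_hom M T V x" and y: "comon_hom M T A y"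
  shows "cotensor_left V A B p \<cdot> pairing M T x y = pairing M T x (pairing M T (p \<cdot> x) y)"
    "cotensor_right V A f \<cdot> pairing M T x y = pairing M T x (pairing M T (f \<cdot> y) y)"
proof -
  note [simp] = VA_arrs comon_homD(1-3)[OF x] comon_homD(1-3)[OF y] T
  have "((Id M (com_obj V) \<otimes>\<^sub>m p) \<cdot> com_comult V) \<cdot> x = pairing M V (Id M (com_obj V)) p \<cdot> x"
    by (simp add: pairing_def)
  also have "\<dots> = pairing M T x (p \<cdot> x)"
    by (subst pairing_comp[OF _ _ _ _ _ x]) simp_all
  finally show "cotensor_left V A B p \<cdot> pairing M T x y = pairing M T x (pairing M T (p \<cdot> x) y)"
    by (simp add: cotensor_left_def tensor_pairing assoc_pairing)
  have "((f \<otimes>\<^sub>m Id M (com_obj A)) \<cdot> com_comult A) \<cdot> y = pairing M A f (Id M (com_obj A)) \<cdot> y"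
    by (simp add: pairing_def)
  also have "\<dots> = pairing M T (f \<cdot> y) y"
    by (subst pairing_comp[OF _ _ _ _ _ y]) simp_all
  finally show "cotensor_right V A f \<cdot> pairing M T x y = pairing M T x (pairing M T (f \<cdot> y) y)"
    by (simp add: cotensor_right_def tensor_pairing)
qed

text \<open>Up to a permutation of the factors, the parallel pair consists of the graphs of the two
  comonoid morphisms \<open>p \<cdot> proj1\<close> and \<open>f \<cdot> proj2\<close> on
  \<open>V \<otimes> A\<close>, so \<open>comon_equalizer\<close> applies.\<close>

lemma cotensor_pullback:
  assumes e: "is_equalizer M (cotensor_left V A B p) (cotensor_right V A f) e"
  obtains E where "com_obj E = Dom M e" "comon_coc M E" "comon_hom M E (comon_prod M V A) e"
    "p \<cdot> proj1 M V A \<cdot> e = f \<cdot> proj2 M V A \<cdot> e"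
proof -
  let ?W = "comon_prod M V A" and ?p1 = "proj1 M V A" and ?p2 = "proj2 M V A" and ?v = "com_obj V"
      and ?a = "com_obj A" and ?b = "com_obj B"
  have W: "comon_coc M ?W" by (rule comon_prod_coc[OF V A])
  note h1 = proj1_hom[OF V A] and h2 = proj2_hom[OF V A]
  note [simp] = VA_arrs W proj_arr[OF V A] symm_pairing assoc_pairing tensor_pairing
  \<comment> \<open>The isomorphism from \<open>V \<otimes> B \<otimes> A\<close> to
    \<open>(V \<otimes> A) \<otimes> B\<close>.\<close>
  let ?\<theta> = "inv_arr M (assoc M ?v ?a ?b) \<cdot> (Id M ?v \<otimes>\<^sub>m symm M ?b ?a)"
  have pi: "pairing M ?W ?p1 ?p2 = Id M (?v \<otimes> ?a)" by (rule pairing_proj[OF V A])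
  have 1: "?\<theta> \<cdot> pairing M ?W ?p1 (pairing M ?W g ?p2) = pairing M ?W (Id M (com_obj ?W)) g"
    if [simp]: "g \<in> Arr M" "Dom M g = ?v \<otimes> ?a" "Cod M g = ?b" for g
  proof -
    have "?\<theta> \<cdot> pairing M ?W ?p1 (pairing M ?W g ?p2) = inv_arr M (assoc M ?v ?a ?b) \<cdot>
        pairing M ?W ?p1 (pairing M ?W ?p2 g)"
      by simp
    also have "\<dots> = inv_arr M (assoc M ?v ?a ?b) \<cdot> assoc M ?v ?a ?b \<cdot>
        pairing M ?W (pairing M ?W ?p1 ?p2) g"
      by simp
    also have "\<dots> = pairing M ?W (Id M (com_obj ?W)) g"
      by (simp del: assoc_pairing add: pi)
    finally show ?thesis .
  qed
  have "cotensor_left V A B p = pairing M ?W ?p1 (pairing M ?W (p \<cdot> ?p1) ?p2)"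
    using cotensor_pairing(1)[OF W h1 h2] cotensor_arrs by (simp add: pi)
  then have l: "?\<theta> \<cdot> cotensor_left V A B p = pairing M ?W (Id M (com_obj ?W)) (p \<cdot> ?p1)"
    using 1[of "p \<cdot> ?p1"] by simp
  have "cotensor_right V A f = pairing M ?W ?p1 (pairing M ?W (f \<cdot> ?p2) ?p2)"
    using cotensor_pairing(2)[OF W h1 h2] cotensor_arrs by (simp add: pi)
  then have r: "?\<theta> \<cdot> cotensor_right V A f = pairing M ?W (Id M (com_obj ?W)) (f \<cdot> ?p2)"
    using 1[of "f \<cdot> ?p2"] by simp
  have m: "mono_arr M e" and [simp]: "Cod M e = ?v \<otimes> ?a"
      and eq: "cotensor_left V A B p \<cdot> e = cotensor_right V A f \<cdot> e"
    and U: "\<And>h. h \<in> Arr M \<Longrightarrow> Cod M h = ?v \<otimes> ?a \<Longrightarrow> cotensor_left V A B p \<cdot> h = cotensor_right V A f \<cdot>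
        h \<Longrightarrow>
      \<exists>k. k \<in> Arr M \<and> Cod M k = Dom M e \<and> e \<cdot> k = h"
    using e cotensor_arrs unfolding is_equalizer_iff by auto
  note [simp] = mono_is_arr[OF m] cotensor_arrs
  have iff: "(?\<theta> \<cdot> cotensor_left V A B p) \<cdot> h = (?\<theta> \<cdot> cotensor_right V A f) \<cdot> h \<longleftrightarrow>
      cotensor_left V A B p \<cdot> h = cotensor_right V A f \<cdot> h"
    if [simp]: "h \<in> Arr M" "Cod M h = ?v \<otimes> ?a" for h
  proof
    assume "(?\<theta> \<cdot> cotensor_left V A B p) \<cdot> h = (?\<theta> \<cdot> cotensor_right V A f) \<cdot> h"
    then have "?\<theta> \<cdot> (cotensor_left V A B p \<cdot> h) = ?\<theta> \<cdot> (cotensor_right V A f \<cdot> h)" by simp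
    then show "cotensor_left V A B p \<cdot> h = cotensor_right V A f \<cdot> h"
      by (rule iso_cancel_left[rotated -1]) (simp_all add: iso_comp)
  next
    assume "cotensor_left V A B p \<cdot> h = cotensor_right V A f \<cdot> h"
    then show "(?\<theta> \<cdot> cotensor_left V A B p) \<cdot> h = (?\<theta> \<cdot> cotensor_right V A f) \<cdot> h" by simp
  qed
  have e': "is_equalizer M (?\<theta> \<cdot> cotensor_left V A B p) (?\<theta> \<cdot> cotensor_right V A f) e"
    unfolding is_equalizer_iff using m eq U iff by auto
  have s: "comon_hom M ?W B (p \<cdot> ?p1)" by (intro comon_hom_comp[OF h1 p] V B W)
  have t: "comon_hom M ?W B (f \<cdot> ?p2)" by (intro comon_hom_comp[OF h2 f] A B W)
  obtain E where E: "com_obj E = Dom M e" "comon_coc M E" "comon_hom M E ?W e"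
    by (rule comon_equalizer[OF W B s t e'[unfolded l r]])
  have "proj2 M ?W B \<cdot> pairing M ?W (Id M (com_obj ?W)) (p \<cdot> ?p1) \<cdot> e = proj2 M ?W B \<cdot>
      pairing M ?W (Id M (com_obj ?W)) (f \<cdot> ?p2) \<cdot> e"
    using e' unfolding l r is_equalizer_iff by simp
  then have "p \<cdot> ?p1 \<cdot> e = f \<cdot> ?p2 \<cdot> e"
    using comp_tail[OF proj_pairing(2)[OF comon_hom_Id[OF W] s W W B], of e]
      comp_tail[OF proj_pairing(2)[OF comon_hom_Id[OF W] t W W B], of e] proj_arr[OF W B] by simp
  with E that show thesis by blast
qed

lemma cotensor_factor:
  assumes e: "is_equalizer M (cotensor_left V A B p) (cotensor_right V A f) e"
    and T: "comon_coc M T" and x: "comon_hom M T V x" and y: "comon_hom M T A y"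
        and xy: "p \<cdot> x = f \<cdot> y"
  obtains z where "z \<in> Arr M" "Dom M z = com_obj T" "Cod M z = Dom M e" "e \<cdot> z = pairing M T x y"
proof -
  note [simp] = VA_arrs comon_homD(1-3)[OF x] comon_homD(1-3)[OF y] T cotensor_arrs
  have "cotensor_left V A B p \<cdot> pairing M T x y = cotensor_right V A f \<cdot> pairing M T x y"
    by (simp add: cotensor_pairing[OF T x y] xy)
  then obtain z where z: "z \<in> Arr M" "Cod M z = Dom M e" "e \<cdot> z = pairing M T x y"
    using equalizer_factor[OF e, of "pairing M T x y"] by auto
  moreover have "mono_arr M e" using e unfolding is_equalizer_iff by simp
  then have "Dom M z = com_obj T" using arg_cong[OF z(3), of "Dom M"] z(1,2)
    by (simp add: mono_is_arr)
  ultimately show thesis using that by blast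
qed

end

text \<open>The Hopf axioms are equations between comonoid morphisms into \<open>E\<close>, so they
  may be tested along a jointly monic family \<open>V\<close> of structure-preserving arrows to Hopf
  monoids. The family is empty for the trivial Hopf monoid, a single inclusion for images, and a
  pair of projections for pullbacks.\<close>

lemma hopf_transfer:
  assumes E: "comon_coc M E" and m: "comon_hom M (comon_prod M E E) E m"
      and u: "comon_hom M (comon_one M) E u"
    and S: "comon_hom M E E S"
    and V: "\<And>G v. (G, v) \<in> V \<Longrightarrow> hopf_coc M G \<and> comon_hom M E (hopf_comonoid G) v \<and>
      v \<cdot> m = hopf_mult G \<cdot> (v \<otimes>\<^sub>m v) \<and> v \<cdot> u = hopf_unit G \<and> v \<cdot> S = hopf_antipode G \<cdot> v"
    and joint: "\<And>T h k. comon_coc M T \<Longrightarrow> comon_hom M T E h \<Longrightarrow> comon_hom M T E k \<Longrightarrow>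
      (\<And>G v. (G, v) \<in> V \<Longrightarrow> v \<cdot> h = v \<cdot> k) \<Longrightarrow> h = k"
    and H: "H = \<lparr>hopf_carrier = com_obj E, hopf_mult = m, hopf_unit = u, hopf_comult = com_comult E,
      hopf_counit = com_counit E, hopf_antipode = S\<rparr>"
  shows "hopf_coc M H" "hopf_comonoid H = E" "(G, v) \<in> V \<Longrightarrow> hopf_hom M H G v"
proof -
  let ?e = "com_obj E" and ?i = "Id M (com_obj E)" and ?I = "unit_obj M" and ?p = "pairing M E"
  show HE: "hopf_comonoid H = E" by (simp add: H hopf_comonoid_def)
  have sel: "hopf_carrier H = ?e" "hopf_mult H = m" "hopf_unit H = u" "hopf_counit H = com_counit E"
      "hopf_antipode H = S"
    by (simp_all add: H)
  have c: "comon_coc M (comon_prod M E E)" "comon_coc M (comon_one M)"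
      "comon_coc M (comon_prod M (comon_prod M E E) E)"
    "comon_coc M (comon_prod M E (comon_prod M E E))" "comon_coc M (comon_prod M (comon_one M) E)"
    "comon_coc M (comon_prod M E (comon_one M))"
    by (intro comon_prod_coc E comon_one_coc)+
  note i = comon_hom_Id[OF E]
  note [simp] = comon_homD(1-3)[OF m, simplified] comon_homD(1-3)[OF u,
      simplified] comon_homD(1-3)[OF S] comon_cocD(1-7)[OF E] E
  {
    fix G v assume Gv: "(G, v) \<in> V"
    note v = V[OF Gv]
    then have G: "hopf_coc M G" and vh: "comon_hom M E (hopf_comonoid G) v"
        and vm: "v \<cdot> m = hopf_mult G \<cdot> (v \<otimes>\<^sub>m v)"
      and vu: "v \<cdot> u = hopf_unit G" and vS: "v \<cdot> S = hopf_antipode G \<cdot> v" by auto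
    let ?g = "hopf_carrier G" and ?m = "hopf_mult G" and ?u = "hopf_unit G"
    note [simp] = hopf_cocD[OF G] comon_homD(1-3)[OF vh, simplified] comon_homD(5)[OF vh,
        simplified]
    have vmh: "v \<cdot> m \<cdot> h = ?m \<cdot> (v \<otimes>\<^sub>m v) \<cdot> h" if "h \<in> Arr M" "Cod M h = ?e \<otimes> ?e" for h
      using comp_tail[OF vm, of h] that by simp
    have "v \<cdot> m \<cdot> (m \<otimes>\<^sub>m ?i) = (?m \<cdot> (?m \<otimes>\<^sub>m Id M ?g)) \<cdot> ((v \<otimes>\<^sub>m v) \<otimes>\<^sub>m v)"
      by (simp add: vmh interchange vm)
    also have "\<dots> = ?m \<cdot> (Id M ?g \<otimes>\<^sub>m ?m) \<cdot> (assoc M ?g ?g ?g \<cdot> ((v \<otimes>\<^sub>m v) \<otimes>\<^sub>m v))"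
      unfolding hopf_monoid_laws(1)[OF G] by simp
    also have "\<dots> = v \<cdot> m \<cdot> (?i \<otimes>\<^sub>m m) \<cdot> assoc M ?e ?e ?e"
      by (subst assoc_nat[of _ _ _ ?e ?e ?e]) (simp_all add: vmh interchange vm)
    finally have "v \<cdot> m \<cdot> (m \<otimes>\<^sub>m ?i) = v \<cdot> m \<cdot> (?i \<otimes>\<^sub>m m) \<cdot> assoc M ?e ?e ?e" .
    moreover
    have "v \<cdot> m \<cdot> (u \<otimes>\<^sub>m ?i) = (?m \<cdot> (?u \<otimes>\<^sub>m Id M ?g)) \<cdot> (Id M ?I \<otimes>\<^sub>m v)"
      by (simp add: vmh interchange vu)
    then have "v \<cdot> m \<cdot> (u \<otimes>\<^sub>m ?i) = v \<cdot> lunit M ?e"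
      unfolding hopf_monoid_laws(2)[OF G] using lunit_nat[of v] by simp
    moreover
    have "v \<cdot> m \<cdot> (?i \<otimes>\<^sub>m u) = (?m \<cdot> (Id M ?g \<otimes>\<^sub>m ?u)) \<cdot> (v \<otimes>\<^sub>m Id M ?I)"
      by (simp add: vmh interchange vu)
    then have "v \<cdot> m \<cdot> (?i \<otimes>\<^sub>m u) = v \<cdot> runit M ?e"
      unfolding hopf_monoid_laws(3)[OF G] using runit_nat[of v] by simp
    moreover
    have "v \<cdot> m \<cdot> ?p S ?i = conv M G E (hopf_antipode G \<cdot> v) v"
      by (simp add: vmh tensor_pairing conv_def vS)
    then have "v \<cdot> m \<cdot> ?p S ?i = v \<cdot> u \<cdot> com_counit E"
      using conv_antipode(1)[OF G E vh] comp_tail[OF vu, of "com_counit E"] by simp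
    moreover
    have "v \<cdot> m \<cdot> ?p ?i S = conv M G E v (hopf_antipode G \<cdot> v)"
      by (simp add: vmh tensor_pairing conv_def vS)
    then have "v \<cdot> m \<cdot> ?p ?i S = v \<cdot> u \<cdot> com_counit E"
      using conv_antipode(2)[OF G E vh] comp_tail[OF vu, of "com_counit E"] by simp
    ultimately have "v \<cdot> m \<cdot> (m \<otimes>\<^sub>m ?i) = v \<cdot> m \<cdot> (?i \<otimes>\<^sub>m m) \<cdot> assoc M ?e ?e ?e"
      "v \<cdot> m \<cdot> (u \<otimes>\<^sub>m ?i) = v \<cdot> lunit M ?e" "v \<cdot> m \<cdot> (?i \<otimes>\<^sub>m u) = v \<cdot> runit M ?e"
      "v \<cdot> m \<cdot> ?p S ?i = v \<cdot> u \<cdot> com_counit E" "v \<cdot> m \<cdot> ?p ?i S = v \<cdot> u \<cdot> com_counit E" by blast+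
  }
  note eqs = this
  show "hopf_coc M H"
  proof (rule hopf_cocI, unfold HE conv_def sel)
    show "m \<cdot> (m \<otimes>\<^sub>m ?i) = m \<cdot> (?i \<otimes>\<^sub>m m) \<cdot> assoc M ?e ?e ?e"
      by (rule joint[OF c(3)])
        (intro comon_hom_comp[OF tensor_hom[OF m i] m] comon_hom_comp[OF comon_hom_comp[OF assoc_hom
            tensor_hom[OF i m]] m] c E comon_prod_coc eqs(1); assumption)+
    show "m \<cdot> (u \<otimes>\<^sub>m ?i) = lunit M ?e"
      by (rule joint[OF c(5)]) (intro comon_hom_comp[OF tensor_hom[OF u i] m] lunit_hom c E eqs(2);
          assumption)+
    show "m \<cdot> (?i \<otimes>\<^sub>m u) = runit M ?e"
      by (rule joint[OF c(6)]) (intro comon_hom_comp[OF tensor_hom[OF i u] m] runit_hom c E eqs(3);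
          assumption)+
    show "m \<cdot> ?p S ?i = u \<cdot> com_counit E"
      by (rule joint[OF E]) (intro comon_hom_comp[OF pairing_hom[OF S i] m] comon_hom_comp[OF
          comon_hom_counit u] c E eqs(4); assumption)+
    show "m \<cdot> ?p ?i S = u \<cdot> com_counit E"
      by (rule joint[OF E]) (intro comon_hom_comp[OF pairing_hom[OF i S] m] comon_hom_comp[OF
          comon_hom_counit u] c E eqs(5); assumption)+
  qed (use E m u in simp_all)
  show "hopf_hom M H G v" if "(G, v) \<in> V"
    using V[OF that] unfolding hopf_hom_def HE is_monoid_arr_def by (simp add: H)
qed

definition hopf_one :: "('o, 'm) hopf_obj" where
  "hopf_one = \<lparr>hopf_carrier = unit_obj M, hopf_mult = lunit M (unit_obj M), hopf_unit =
      Id M (unit_obj M),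
    hopf_comult = inv_arr M (lunit M (unit_obj M)), hopf_counit = Id M (unit_obj M), hopf_antipode =
        Id M (unit_obj M)\<rparr>"

lemma hopf_one_comonoid: "hopf_comonoid hopf_one = comon_one M"
  by (simp add: hopf_one_def hopf_comonoid_def comon_one_def)

lemma hopf_hom_to_one: "comon_hom M T (comon_one M) h \<Longrightarrow> h = com_counit T"
  using comon_homD[of T "comon_one M" h] by simp

lemma hopf_one_coc: "hopf_coc M hopf_one"
proof -
  note one = comon_one_coc
  have "hopf_coc M \<lparr>hopf_carrier = com_obj (comon_one M), hopf_mult = lunit M (unit_obj M),
      hopf_unit = Id M (unit_obj M),
      hopf_comult = com_comult (comon_one M), hopf_counit = com_counit (comon_one M),
          hopf_antipode = Id M (unit_obj M)\<rparr>"
  \<comment> \<open>For the empty family, joint monicity is the fact that comonoid morphisms into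
    the unit comonoid are unique.\<close>
  proof (rule hopf_transfer(1)[OF one _ _ _ _ _ refl, where V = "{}"])
    show "comon_hom M (comon_prod M (comon_one M) (comon_one M)) (comon_one M) (lunit M (unit_obj
        M))"
      using lunit_hom[OF one] by simp
    show "comon_hom M (comon_one M) (comon_one M) (Id M (unit_obj M))"
      using comon_hom_Id[OF one] by simp
    then show "comon_hom M (comon_one M) (comon_one M) (Id M (unit_obj M))" .
    show "h = k" if "comon_hom M T (comon_one M) h" "comon_hom M T (comon_one M) k" for T h k
      using hopf_hom_to_one[OF that(1)] hopf_hom_to_one[OF that(2)] by simp
  qed blast
  then show ?thesis by (simp add: hopf_one_def)
qed

lemma hopf_unit_hopf_hom: "hopf_coc M A \<Longrightarrow> hopf_hom M hopf_one A (hopf_unit A)"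
proof -
  assume A: "hopf_coc M A"
  note [simp] = hopf_cocD[OF A]
  let ?u = "hopf_unit A"
  have "hopf_mult A \<cdot> (?u \<otimes>\<^sub>m ?u) = (hopf_mult A \<cdot> (?u \<otimes>\<^sub>m Id M (hopf_carrier A))) \<cdot>
      (Id M (unit_obj M) \<otimes>\<^sub>m ?u)"
    by (simp add: interchange)
  also have "\<dots> = ?u \<cdot> lunit M (unit_obj M)"
    unfolding hopf_monoid_laws(2)[OF A] using lunit_nat[of ?u] by simp
  finally show ?thesis
    unfolding hopf_hom_def hopf_one_comonoid is_monoid_arr_def using hopf_unit_hom[OF A]
      by (simp add: hopf_one_def)
qed

lemma hopf_counit_hopf_hom: "hopf_coc M A \<Longrightarrow> hopf_hom M A hopf_one (hopf_counit A)"
proof -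
  assume A: "hopf_coc M A"
  have "hopf_counit A \<cdot> hopf_mult A = lunit M (unit_obj M) \<cdot> (hopf_counit A \<otimes>\<^sub>m hopf_counit A)"
    "hopf_counit A \<cdot> hopf_unit A = Id M (unit_obj M)"
    using A by (auto simp: hopf_coc_def is_hopf_monoid_def is_bimonoid_def Let_def)
  then show ?thesis
    unfolding hopf_hom_def hopf_one_comonoid is_monoid_arr_def
    using comon_hom_counit[OF hopf_coc_comon[OF A]] by (simp add: hopf_one_def)
qed

lemma hopf_hom_comp:
  assumes A: "hopf_coc M A" and B: "hopf_coc M B" and C: "hopf_coc M C" and f: "hopf_hom M A B f"
      and g: "hopf_hom M B C g"
  shows "hopf_hom M A C (g \<cdot> f)"
proof -
  note [simp] = hopf_homD(1-3)[OF f] hopf_homD(1-3)[OF g] hopf_cocD[OF A] hopf_cocD[OF B]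
      hopf_cocD[OF C]
  have "g \<cdot> f \<cdot> hopf_mult A = (g \<cdot> hopf_mult B) \<cdot> (f \<otimes>\<^sub>m f)" by (simp add: hopf_homD(5)[OF f])
  also have "\<dots> = hopf_mult C \<cdot> ((g \<cdot> f) \<otimes>\<^sub>m (g \<cdot> f))" unfolding hopf_homD(5)[OF g]
    by (simp add: interchange)
  finally show ?thesis
    using comon_hom_comp[OF hopf_homD(4)[OF f] hopf_homD(4)[OF g]] hopf_coc_comon[OF A]
        hopf_coc_comon[OF B] hopf_coc_comon[OF C]
    unfolding hopf_hom_def is_monoid_arr_def by (simp add: hopf_homD(6)[OF f] hopf_homD(6)[OF g])
qed

lemma hopf_hom_Id: "hopf_coc M A \<Longrightarrow> hopf_hom M A A (Id M (hopf_carrier A))"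
  using comon_hom_Id[OF hopf_coc_comon[of A]]
    by (simp add: hopf_hom_def is_monoid_arr_def hopf_cocD)

text \<open>Comultiplication, multiplication and antipode of the image are diagonal fill-ins between
  \<open>e\<close> and \<open>i\<close>, or their tensor squares. That the antipode can be filled in
  depends on \<open>q\<close> commuting with antipodes.\<close>

lemma hopf_image:
  assumes A: "hopf_coc M A" and B: "hopf_coc M B" and q: "hopf_hom M A B q"
  obtains I e i where "hopf_coc M I" "hopf_hom M A I e" "hopf_hom M I B i" "epi_arr M e"
      "mono_arr M i" "i \<cdot> e = q"
proof -
  note [simp] = hopf_homD(1-3)[OF q] hopf_cocD[OF A] hopf_cocD[OF B]
  note qh = hopf_homD(4)[OF q]
  obtain e i where e: "epi_arr M e" and i: "mono_arr M i"
      and [simp]: "Dom M e = hopf_carrier A" "Cod M i = hopf_carrier B" "Dom M i = Cod M e"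
    and ie: "i \<cdot> e = q"
    using epi_mono_factorization[of q] by auto
  note [simp] = epi_is_arr[OF e] mono_is_arr[OF i]
  let ?I = "Cod M e" and ?A = "hopf_comonoid A" and ?B = "hopf_comonoid B"
  have ieh: "i \<cdot> e \<cdot> h = q \<cdot> h" if "h \<in> Arr M" "Cod M h = hopf_carrier A" for h
    using comp_tail[OF ie, of h] that by simp
  obtain d where [simp]: "d \<in> Arr M" "Dom M d = ?I" "Cod M d = ?I \<otimes> ?I"
      and d: "(i \<otimes>\<^sub>m i) \<cdot> d = hopf_comult B \<cdot> i"
    using diagonal_fill[OF e tensor_mono[OF i i], of "(e \<otimes>\<^sub>m e) \<cdot> hopf_comult A" "hopf_comult B \<cdot> i"]
      comon_homD(4)[OF qh] by (auto simp: interchange ie)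
  let ?E = "\<lparr>com_obj = ?I, com_comult = d, com_counit = hopf_counit B \<cdot> i\<rparr>"
  have E: "comon_coc M ?E" and iE: "comon_hom M ?E ?B i"
    using comon_sub[OF hopf_coc_comon[OF B] i, of d] d by simp_all
  \<comment> \<open>The fill-in for the multiplication starts from \<open>e \<otimes> e\<close>,
    which is epic by exactness of the tensor product.\<close>
  obtain m where [simp]: "m \<in> Arr M" "Dom M m = ?I \<otimes> ?I" "Cod M m = ?I"
      and m: "i \<cdot> m = hopf_mult B \<cdot> (i \<otimes>\<^sub>m i)" "m \<cdot> (e \<otimes>\<^sub>m e) = e \<cdot> hopf_mult A"
    using diagonal_fill[OF tensor_epi[OF e e] i, of "e \<cdot> hopf_mult A" "hopf_mult B \<cdot> (i \<otimes>\<^sub>m i)"]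
      hopf_homD(5)[OF q] by (auto simp: interchange ie ieh)
  obtain S where [simp]: "S \<in> Arr M" "Dom M S = ?I" "Cod M S = ?I"
      and S: "i \<cdot> S = hopf_antipode B \<cdot> i"
    using diagonal_fill[OF e i, of "e \<cdot> hopf_antipode A" "hopf_antipode B \<cdot> i"]
      hopf_hom_antipode[OF A B q] by (auto simp: ie ieh)
  let ?u = "e \<cdot> hopf_unit A"
  have u: "i \<cdot> ?u = hopf_unit B" by (simp add: ieh hopf_homD(6)[OF q])
  note fac = comon_hom_mono_factor[OF iE i _ _ _ _ E hopf_coc_comon[OF B]]
  have Bc: "comon_coc M ?B" by (rule hopf_coc_comon[OF B])
  have EE: "comon_coc M (comon_prod M ?E ?E)" "comon_coc M (comon_prod M ?B ?B)"
    by (intro comon_prod_coc E Bc)+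
  have mh: "comon_hom M (comon_prod M ?E ?E) ?E m"
  proof (rule fac)
    show "comon_hom M (comon_prod M ?E ?E) ?B (i \<cdot> m)"
      unfolding m by (intro comon_hom_comp[OF tensor_hom[OF iE iE] hopf_mult_hom[OF B]] EE E Bc)
  qed (simp_all add: EE)
  have uh: "comon_hom M (comon_one M) ?E ?u"
  proof (rule fac)
    show "comon_hom M (comon_one M) ?B (i \<cdot> ?u)" unfolding u by (rule hopf_unit_hom[OF B])
  qed (simp_all add: comon_one_coc)
  have Sh: "comon_hom M ?E ?E S"
  proof (rule fac)
    show "comon_hom M ?E ?B (i \<cdot> S)"
      unfolding S by (intro comon_hom_comp[OF iE antipode_hom[OF B refl]] E Bc)
  qed (simp_all add: E)
  let ?H = "\<lparr>hopf_carrier = com_obj ?E, hopf_mult = m, hopf_unit = ?u, hopf_comult = com_comult ?E,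
      hopf_counit = com_counit ?E, hopf_antipode = S\<rparr>"
  have V: "hopf_coc M G \<and> comon_hom M ?E (hopf_comonoid G) v \<and> v \<cdot> m = hopf_mult G \<cdot> (v \<otimes>\<^sub>m v) \<and>
      v \<cdot> ?u = hopf_unit G \<and> v \<cdot> S = hopf_antipode G \<cdot> v" if "(G, v) \<in> {(B, i)}" for G v
    using that B iE m(1) u S by simp
  have joint: "h = k" if h: "comon_hom M T ?E h" and k: "comon_hom M T ?E k"
      and "\<And>G v. (G, v) \<in> {(B, i)} \<Longrightarrow> v \<cdot> h = v \<cdot> k" for T h k
    by (rule mono_cancel[OF i that(3)]) (use comon_homD(1-3)[OF h] comon_homD(1-3)[OF k] in
        simp_all)
  have tr: "hopf_coc M ?H" "hopf_comonoid ?H = ?E" "(G, v) \<in> {(B, i)} \<Longrightarrow> hopf_hom M ?H G v" for G v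
    by (rule hopf_transfer[OF E mh uh Sh, of "{(B, i)}", OF V joint refl]; blast)+
  have "hopf_hom M A ?H e"
    unfolding hopf_hom_def tr(2) is_monoid_arr_def
  proof (intro conjI)
    show "comon_hom M ?A ?E e"
      by (rule fac) (use qh hopf_coc_comon[OF A] in \<open>simp_all add: ie\<close>)
  qed (simp_all add: m(2))
  then show thesis using that[OF tr(1) _ _ e i ie] tr(3)[of B i] by simp
qed

text \<open>Multiplication, unit and antipode come from the universal property, applied to the
  operations on components. For this reason, and for later use, the property is stated for all
  cocommutative comonoids \<open>T\<close> and not only for Hopf monoids.\<close>

lemma hopf_pullback:
  assumes V: "hopf_coc M V" and A: "hopf_coc M A" and B: "hopf_coc M B" and p: "hopf_hom M V B p"
      and f: "hopf_hom M A B f"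
    and e: "is_equalizer M (cotensor_left (hopf_comonoid V) (hopf_comonoid A) (hopf_comonoid B) p)
        (cotensor_right (hopf_comonoid V) (hopf_comonoid A) f) e"
  obtains E v a where "hopf_coc M E" "hopf_carrier E = Dom M e" "hopf_hom M E V v"
      "hopf_hom M E A a" "p \<cdot> v = f \<cdot> a"
    "pairing M (hopf_comonoid E) v a = e"
    "\<And>T x y. comon_coc M T \<Longrightarrow> comon_hom M T (hopf_comonoid V) x \<Longrightarrow> comon_hom M T (hopf_comonoid A) y \<Longrightarrow>
        p \<cdot> x = f \<cdot> y \<Longrightarrow>
      \<exists>z. comon_hom M T (hopf_comonoid E) z \<and> v \<cdot> z = x \<and> a \<cdot> z = y"
proof -
  let ?V = "hopf_comonoid V" and ?A = "hopf_comonoid A" and ?B = "hopf_comonoid B"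
  note Vc = hopf_coc_comon[OF V] and Ac = hopf_coc_comon[OF A] and Bc = hopf_coc_comon[OF B]
  note pc = hopf_homD(4)[OF p] and fc = hopf_homD(4)[OF f]
  note [simp] = hopf_homD(1-3)[OF p] hopf_homD(1-3)[OF f] hopf_cocD[OF A] hopf_cocD[OF B]
      hopf_cocD[OF V] proj_arr[OF Vc Ac] 
  obtain E where Ed: "com_obj E = Dom M e" and E: "comon_coc M E"
      and eE: "comon_hom M E (comon_prod M ?V ?A) e"
    and pf: "p \<cdot> proj1 M ?V ?A \<cdot> e = f \<cdot> proj2 M ?V ?A \<cdot> e"
    by (rule cotensor_pullback[OF Vc Ac Bc pc fc e])
  let ?v = "proj1 M ?V ?A \<cdot> e" and ?a = "proj2 M ?V ?A \<cdot> e"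
  have em: "mono_arr M e" using e by (simp add: is_equalizer_iff)
  have W: "comon_coc M (comon_prod M ?V ?A)" by (rule comon_prod_coc[OF Vc Ac])
  have v: "comon_hom M E ?V ?v" by (intro comon_hom_comp[OF eE proj1_hom[OF Vc Ac]] E W Vc)
  have a: "comon_hom M E ?A ?a" by (intro comon_hom_comp[OF eE proj2_hom[OF Vc Ac]] E W Ac)
  note [simp] = mono_is_arr[OF em] comon_homD(1,3)[OF eE, simplified] Ed
  have joint: "h = k" if T: "comon_coc M T" and h: "comon_hom M T E h" and k: "comon_hom M T E k"
      and "?v \<cdot> h = ?v \<cdot> k" "?a \<cdot> h = ?a \<cdot> k" for T h k
  proof -
    note [simp] = comon_homD(1-3)[OF h] comon_homD(1-3)[OF k]
    have "e \<cdot> h = e \<cdot> k"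
      by (rule prod_hom_eqI[OF comon_hom_comp[OF h eE] comon_hom_comp[OF k eE] T Vc Ac]) (use that T
          E W in simp_all)
    then show ?thesis by (rule mono_cancel[OF em]) simp_all
  qed
  have U: "\<exists>z. comon_hom M T E z \<and> ?v \<cdot> z = x \<and> ?a \<cdot> z = y"
    if T: "comon_coc M T" and x: "comon_hom M T ?V x" and y: "comon_hom M T ?A y"
        and xy: "p \<cdot> x = f \<cdot> y" for T x y
  proof -
    obtain z where z: "z \<in> Arr M" "Dom M z = com_obj T" "Cod M z = Dom M e" "e \<cdot> z =
        pairing M T x y"
      by (rule cotensor_factor[OF Vc Ac Bc pc fc e T x y xy])
    have "comon_hom M T E z"
      by (rule comon_hom_mono_factor[OF eE em]) (use z pairing_hom[OF x y T Vc Ac] E W T in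
          simp_all)
    then show ?thesis
      using proj_pairing[OF x y T Vc Ac] z by (intro exI[of _ z]) simp
  qed
  have EE: "comon_coc M (comon_prod M E E)" "comon_coc M (comon_prod M ?V ?V)"
      "comon_coc M (comon_prod M ?A ?A)" by (intro comon_prod_coc E Vc Ac)+
  have "p \<cdot> hopf_mult V \<cdot> (?v \<otimes>\<^sub>m ?v) = f \<cdot> hopf_mult A \<cdot> (?a \<otimes>\<^sub>m ?a)"
    using comp_tail[OF hopf_homD(5)[OF p], of "?v \<otimes>\<^sub>m ?v"] comp_tail[OF hopf_homD(5)[OF f],
        of "?a \<otimes>\<^sub>m ?a"] pf
    by (simp add: interchange)
  from U[OF EE(1) comon_hom_comp[OF tensor_hom[OF v v] hopf_mult_hom[OF V]] comon_hom_comp[OF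
      tensor_hom[OF a a] hopf_mult_hom[OF A]] this]
  obtain m where m: "comon_hom M (comon_prod M E E) E m" "?v \<cdot> m = hopf_mult V \<cdot> (?v \<otimes>\<^sub>m ?v)" "?a \<cdot>
      m = hopf_mult A \<cdot> (?a \<otimes>\<^sub>m ?a)"
    using E EE Vc Ac by auto
  have "p \<cdot> hopf_unit V = f \<cdot> hopf_unit A" by (simp add: hopf_homD(6)[OF p] hopf_homD(6)[OF f])
  from U[OF comon_one_coc hopf_unit_hom[OF V] hopf_unit_hom[OF A] this]
  obtain u where u: "comon_hom M (comon_one M) E u" "?v \<cdot> u = hopf_unit V" "?a \<cdot> u = hopf_unit A"
    by auto
  have "p \<cdot> hopf_antipode V \<cdot> ?v = f \<cdot> hopf_antipode A \<cdot> ?a"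
    using comp_tail[OF hopf_hom_antipode[OF V B p], of ?v] comp_tail[OF hopf_hom_antipode[OF A B f],
        of ?a] pf by simp
  from U[OF E comon_hom_comp[OF v antipode_hom[OF V refl]] comon_hom_comp[OF a antipode_hom[OF A
      refl]] this]
  obtain S where S: "comon_hom M E E S" "?v \<cdot> S = hopf_antipode V \<cdot> ?v" "?a \<cdot> S = hopf_antipode A \<cdot>
      ?a"
    using E Vc Ac by auto
  let ?H = "\<lparr>hopf_carrier = com_obj E, hopf_mult = m, hopf_unit = u, hopf_comult = com_comult E,
      hopf_counit = com_counit E, hopf_antipode = S\<rparr>"
  let ?S = "{(V, ?v), (A, ?a)}"
  have V': "hopf_coc M G \<and> comon_hom M E (hopf_comonoid G) w \<and> w \<cdot> m = hopf_mult G \<cdot> (w \<otimes>\<^sub>m w) \<and> w \<cdot>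
      u = hopf_unit G \<and> w \<cdot> S = hopf_antipode G \<cdot> w"
    if "(G, w) \<in> ?S" for G w
    using that V A v a m u S by auto
  have J: "h = k" if "comon_coc M T" "comon_hom M T E h" "comon_hom M T E k" "\<And>G w. (G, w) \<in> ?S \<Longrightarrow>
      w \<cdot> h = w \<cdot> k" for T h k
    by (rule joint[OF that(1-3)]) (use that(4) in blast)+
  have tr: "hopf_coc M ?H" "hopf_comonoid ?H = E" "(G, w) \<in> ?S \<Longrightarrow> hopf_hom M ?H G w" for G w
    by (rule hopf_transfer[OF E m(1) u(1) S(1), of ?S, OF V' J refl]; blast)+
  show thesis
  proof (rule that[of ?H ?v ?a])
    show "hopf_coc M ?H" by (rule tr)
    show "hopf_hom M ?H V ?v" "hopf_hom M ?H A ?a" by (rule tr; blast)+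
    show "pairing M (hopf_comonoid ?H) ?v ?a = e" unfolding tr(2)
      by (rule pairing_eta[OF eE E Vc Ac])
    show "\<exists>z. comon_hom M T (hopf_comonoid ?H) z \<and> ?v \<cdot> z = x \<and> ?a \<cdot> z = y"
      if "comon_coc M T" "comon_hom M T ?V x" "comon_hom M T ?A y" "p \<cdot> x = f \<cdot> y" for T x y
      unfolding tr(2) by (rule U[OF that])
  qed (simp_all add: pf)
qed

end

section \<open>Coflatness\<close>

context abelian_symmetric_monoidal_category
begin

section \<open>Comodules and their morphisms\<close>

lemma right_comoduleD:
  assumes "is_right_comodule M B (x, r)"
  shows "x \<in> Obj M" "r \<in> Arr M" "Dom M r = x" "Cod M r = x \<otimes> com_obj B"
    "assoc M x (com_obj B) (com_obj B) \<cdot> (r \<otimes>\<^sub>m Id M (com_obj B)) \<cdot> r = (Id M x \<otimes>\<^sub>m com_comult B) \<cdot> r"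
    "runit M x \<cdot> (Id M x \<otimes>\<^sub>m com_counit B) \<cdot> r = Id M x"
  using assms by (auto simp: is_right_comodule_def Let_def in_hset)

lemma right_comoduleI:
  assumes "x \<in> Obj M" "r \<in> Arr M" "Dom M r = x" "Cod M r = x \<otimes> com_obj B"
    "assoc M x (com_obj B) (com_obj B) \<cdot> (r \<otimes>\<^sub>m Id M (com_obj B)) \<cdot> r = (Id M x \<otimes>\<^sub>m com_comult B) \<cdot> r"
    "runit M x \<cdot> (Id M x \<otimes>\<^sub>m com_counit B) \<cdot> r = Id M x"
  shows "is_right_comodule M B (x, r)"
  using assms by (auto simp: is_right_comodule_def Let_def in_hset)

lemma comodule_of_hom:
  assumes V: "comon_coc M V" and B: "comon_coc M B" and p: "comon_hom M V B p"
  shows "is_right_comodule M B (com_obj V, (Id M (com_obj V) \<otimes>\<^sub>m p) \<cdot> com_comult V)"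
proof (rule right_comoduleI)
  note [simp] = V comon_cocD(1-7)[OF V] comon_cocD(1-7)[OF B] comon_homD(1-3)[OF p] comon_homD(5)[OF
      p]
  let ?i = "Id M (com_obj V)" and ?r = "(Id M (com_obj V) \<otimes>\<^sub>m p) \<cdot> com_comult V"
  have r: "?r = pairing M V ?i p" by (simp add: pairing_def)
  have pp: "com_comult B \<cdot> p = pairing M V p p" using comon_homD(4)[OF p] by (simp add: pairing_def)
  show "assoc M (com_obj V) (com_obj B) (com_obj B) \<cdot> (?r \<otimes>\<^sub>m Id M (com_obj B)) \<cdot> ?r =
      (Id M (com_obj V) \<otimes>\<^sub>m com_comult B) \<cdot> ?r"
    unfolding r by (simp add: tensor_pairing assoc_pairing pp)
  show "runit M (com_obj V) \<cdot> (?i \<otimes>\<^sub>m com_counit B) \<cdot> ?r = ?i"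
    unfolding r by (simp add: tensor_pairing counit_pairing1)
qed (use comon_cocD(1-7)[OF V] comon_cocD(1-7)[OF B] comon_homD(1-3)[OF p] in simp_all)

text \<open>The laws for \<open>t\<close> may be tested after the epimorphism \<open>z\<close>,
  where they become those of \<open>s\<close>.\<close>

lemma quotient_comodule:
  assumes B: "comon_coc M B" and Y: "is_right_comodule M B (y, s)"
      and z: "epi_arr M z" "Dom M z = y" "Cod M z = c"
    and t: "t \<in> Arr M" "Dom M t = c" "Cod M t = c \<otimes> com_obj B"
        and tz: "t \<cdot> z = (z \<otimes>\<^sub>m Id M (com_obj B)) \<cdot> s"
  shows "is_right_comodule M B (c, t)"
proof (rule right_comoduleI)
  let ?b = "com_obj B"
  note [simp] = comon_cocD(1-7)[OF B] right_comoduleD(1-4)[OF Y] epi_is_arr[OF z(1)] z(2,3) t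
  show c [simp]: "c \<in> Obj M" using Cod_Obj[of z] by simp
  have "(assoc M c ?b ?b \<cdot> (t \<otimes>\<^sub>m Id M ?b) \<cdot> t) \<cdot> z = (assoc M c ?b ?b \<cdot>
      ((z \<otimes>\<^sub>m Id M ?b) \<otimes>\<^sub>m Id M ?b)) \<cdot> (s \<otimes>\<^sub>m Id M ?b) \<cdot> s"
    by (simp add: tz interchange)
  also have "\<dots> = (z \<otimes>\<^sub>m Id M (?b \<otimes> ?b)) \<cdot> assoc M y ?b ?b \<cdot> (s \<otimes>\<^sub>m Id M ?b) \<cdot> s"
    by (subst assoc_nat[of _ _ _ y ?b ?b]) simp_all
  also have "\<dots> = ((Id M c \<otimes>\<^sub>m com_comult B) \<cdot> t) \<cdot> z"
    by (simp add: right_comoduleD(5)[OF Y] interchange tz)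
  finally show "assoc M c ?b ?b \<cdot> (t \<otimes>\<^sub>m Id M ?b) \<cdot> t = (Id M c \<otimes>\<^sub>m com_comult B) \<cdot> t"
    by (rule epi_cancel[OF z(1)]) simp_all
  have "(runit M c \<cdot> (Id M c \<otimes>\<^sub>m com_counit B) \<cdot> t) \<cdot> z = (runit M (Cod M z) \<cdot>
      (z \<otimes>\<^sub>m Id M (unit_obj M))) \<cdot> (Id M y \<otimes>\<^sub>m com_counit B) \<cdot> s"
    by (simp add: tz interchange)
  also have "\<dots> = Id M c \<cdot> z"
    by (subst runit_nat) (simp_all add: right_comoduleD(6)[OF Y])
  finally show "runit M c \<cdot> (Id M c \<otimes>\<^sub>m com_counit B) \<cdot> t = Id M c"
    by (rule epi_cancel[OF z(1)]) simp_all
qed (use t in simp_all)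

text \<open>Dually, the laws are tested after \<open>n\<close> and its tensor products with
  identities, which exactness keeps monic.\<close>

lemma sub_comodule:
  assumes B: "comon_coc M B" and Y: "is_right_comodule M B (y, s)"
      and n: "mono_arr M n" "Cod M n = y" "Dom M n = c"
    and t: "t \<in> Arr M" "Dom M t = c" "Cod M t = c \<otimes> com_obj B"
        and tn: "(n \<otimes>\<^sub>m Id M (com_obj B)) \<cdot> t = s \<cdot> n"
  shows "is_right_comodule M B (c, t)"
proof (rule right_comoduleI)
  let ?b = "com_obj B"
  note [simp] = comon_cocD(1-7)[OF B] right_comoduleD(1-4)[OF Y] mono_is_arr[OF n(1)] n(2,3) t
  show c [simp]: "c \<in> Obj M" using Dom_Obj[of n] by simp
  have "(n \<otimes>\<^sub>m Id M (?b \<otimes> ?b)) \<cdot> assoc M c ?b ?b \<cdot> (t \<otimes>\<^sub>m Id M ?b) \<cdot> t =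
      (assoc M y ?b ?b \<cdot> ((n \<otimes>\<^sub>m Id M ?b) \<otimes>\<^sub>m Id M ?b)) \<cdot> (t \<otimes>\<^sub>m Id M ?b) \<cdot> t"
    by (subst assoc_nat[of _ _ _ c ?b ?b]) simp_all
  also have "\<dots> = assoc M y ?b ?b \<cdot> ((s \<cdot> n) \<otimes>\<^sub>m Id M ?b) \<cdot> t"
    by (simp add: interchange tn)
  also have "\<dots> = assoc M y ?b ?b \<cdot> (s \<otimes>\<^sub>m Id M ?b) \<cdot> (n \<otimes>\<^sub>m Id M ?b) \<cdot> t"
    by (simp add: interchange)
  also have "\<dots> = (assoc M y ?b ?b \<cdot> (s \<otimes>\<^sub>m Id M ?b) \<cdot> s) \<cdot> n"
    by (simp add: tn)
  also have "\<dots> = (Id M y \<otimes>\<^sub>m com_comult B) \<cdot> (n \<otimes>\<^sub>m Id M ?b) \<cdot> t"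
    unfolding right_comoduleD(5)[OF Y] by (simp add: tn)
  also have "\<dots> = (n \<otimes>\<^sub>m Id M (?b \<otimes> ?b)) \<cdot> (Id M c \<otimes>\<^sub>m com_comult B) \<cdot> t"
    by (simp add: interchange)
  finally show "assoc M c ?b ?b \<cdot> (t \<otimes>\<^sub>m Id M ?b) \<cdot> t = (Id M c \<otimes>\<^sub>m com_comult B) \<cdot> t"
    by (rule mono_cancel[OF tensor_Id_mono[OF n(1)], rotated]) simp_all
  have "n \<cdot> runit M c \<cdot> (Id M c \<otimes>\<^sub>m com_counit B) \<cdot> t = (runit M (Cod M n) \<cdot>
      (n \<otimes>\<^sub>m Id M (unit_obj M))) \<cdot> (Id M c \<otimes>\<^sub>m com_counit B) \<cdot> t"
    by (subst runit_nat) simp_all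
  also have "\<dots> = runit M y \<cdot> (Id M y \<otimes>\<^sub>m com_counit B) \<cdot> (n \<otimes>\<^sub>m Id M ?b) \<cdot> t"
    by (simp add: interchange)
  also have "\<dots> = (runit M y \<cdot> (Id M y \<otimes>\<^sub>m com_counit B) \<cdot> s) \<cdot> n"
    by (simp add: tn)
  also have "\<dots> = n \<cdot> Id M c"
    by (simp add: right_comoduleD(6)[OF Y])
  finally show "runit M c \<cdot> (Id M c \<otimes>\<^sub>m com_counit B) \<cdot> t = Id M c"
    by (rule mono_cancel[OF n(1)]) simp_all
qed (use t in simp_all)

text \<open>The comodule laws at both ends are included, so that the predicate describes exactly the
  arrows of \<open>Right_Comod\<close>.\<close>

definition comodule_hom :: "('o, 'm) comonoid_obj \<Rightarrow> 'o \<times> 'm \<Rightarrow> 'o \<times> 'm \<Rightarrow> 'm \<Rightarrow> bool" where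
  "comodule_hom B X Y f \<longleftrightarrow> is_right_comodule M B X \<and> is_right_comodule M B Y \<and>
      f \<in> hset M (fst X) (fst Y) \<and>
    snd Y \<cdot> f = (f \<otimes>\<^sub>m Id M (com_obj B)) \<cdot> snd X"

lemma Right_Comod_simps:
  "(X, f, Y) \<in> Arr (Right_Comod M B) \<longleftrightarrow> comodule_hom B X Y f"
  "Dom (Right_Comod M B) (X, f, Y) = X" "Cod (Right_Comod M B) (X, f, Y) = Y"
  "Comp (Right_Comod M B) (Y', g, Z) (X, f, Y) = (X, g \<cdot> f, Z)"
  by (auto simp: Right_Comod_def struct_cat_def comodule_hom_def)

lemma comodule_homD:
  assumes "comodule_hom B (x, r) (y, s) f"
  shows "is_right_comodule M B (x, r)" "is_right_comodule M B (y, s)" "f \<in> Arr M" "Dom M f = x"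
      "Cod M f = y"
    "s \<cdot> f = (f \<otimes>\<^sub>m Id M (com_obj B)) \<cdot> r"
  using assms by (auto simp: comodule_hom_def in_hset)

text \<open>The cokernel of a comodule morphism is a comodule.\<close>

lemma epi_of_comodules:
  assumes B: "comon_coc M B" and f: "comodule_hom B (x, r) (y, s) f"
    and epi: "epi_arr (Right_Comod M B) ((x, r), f, (y, s))"
  shows "epi_arr M f"
proof -
  let ?b = "com_obj B"
  note X = comodule_homD(1)[OF f] and Y = comodule_homD(2)[OF f]
  note [simp] = comon_cocD(1-7)[OF B] right_comoduleD(1-4)[OF X] right_comoduleD(1-4)[OF Y]
      comodule_homD(3-5)[OF f]
  obtain z where z: "is_cokernel M f z" using ex_cokernel[of f] by auto
  let ?c = "Cod M z"
  note [simp] = cokernelD(2,3)[OF z] and zf = cokernelD(4)[OF z, simplified]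
      and ze = cokernelD(5)[OF z]
  have "((z \<otimes>\<^sub>m Id M ?b) \<cdot> s) \<cdot> f = ((z \<cdot> f) \<otimes>\<^sub>m Id M ?b) \<cdot> r"
    by (simp add: comodule_homD(6)[OF f] interchange)
  also have "\<dots> = zero_arr M x (?c \<otimes> ?b)" by (simp add: zf tensor_Id_zero)
  finally obtain t where [simp]: "t \<in> Arr M" "Dom M t = ?c" "Cod M t = ?c \<otimes> ?b"
      and t: "t \<cdot> z = (z \<otimes>\<^sub>m Id M ?b) \<cdot> s"
    using cokernelD(6)[OF z, of "(z \<otimes>\<^sub>m Id M ?b) \<cdot> s"] by auto
  have C: "is_right_comodule M B (?c, t)"
    by (rule quotient_comodule[OF B Y ze]) (simp_all add: t)
  \<comment> \<open>Both \<open>z\<close> and the zero arrow are comodule morphisms that agree after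
    \<open>f\<close>; epicness among comodules forces them to coincide, and a vanishing cokernel
    makes \<open>f\<close> epic in \<open>M\<close>.\<close>
  have zh: "comodule_hom B (y, s) (?c, t) z" using C Y by (simp add: comodule_hom_def in_hset t)
  have 0: "comodule_hom B (y, s) (?c, t) (zero_arr M y ?c)"
    using C Y by (simp add: comodule_hom_def in_hset tensor_Id_zero)
  let ?R = "Right_Comod M B"
  have "((y, s), z, (?c, t)) \<in> hset ?R (y, s) (?c, t)" "((y, s), zero_arr M y ?c, (?c,
      t)) \<in> hset ?R (y, s) (?c, t)"
    using zh 0 by (simp_all add: in_hset Right_Comod_simps)
  moreover have "Comp ?R ((y, s), z, (?c, t)) ((x, r), f, (y, s)) = Comp ?R ((y, s),
      zero_arr M y ?c, (?c, t)) ((x, r), f, (y, s))"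
    by (simp add: Right_Comod_simps zf)
  moreover have "\<forall>c. \<forall>g \<in> hset ?R (y, s) c. \<forall>h \<in> hset ?R (y, s) c.
      Comp ?R g ((x, r), f, (y, s)) = Comp ?R h ((x, r), f, (y, s)) \<longrightarrow> g = h"
    using epi unfolding epi_arr_def Right_Comod_simps by (elim conjE)
  ultimately have "((y, s), z, (?c, t)) = ((y, s), zero_arr M y ?c, (?c, t))" by blast
  then have z0: "z = zero_arr M y ?c" by simp
  show ?thesis
  proof (rule epi_arr_zeroI)
    fix g assume [simp]: "g \<in> Arr M" "Dom M g = Cod M f"
        and g: "g \<cdot> f = zero_arr M (Dom M f) (Cod M g)"
    obtain l where [simp]: "l \<in> Arr M" "Dom M l = ?c" "Cod M l = Cod M g" and l: "l \<cdot> z = g"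
      using cokernelD(6)[OF z _ _ g] by auto
    have "l \<cdot> zero_arr M y ?c = zero_arr M y (Cod M g)" by simp
    then show "g = zero_arr M (Cod M f) (Cod M g)" unfolding z0[symmetric] l by simp
  qed simp
qed

text \<open>This makes cotensoring functorial: \<open>f \<otimes> Id\<close> carries the cotensor
  product of the source into that of the target.\<close>

lemma comodule_hom_equalizes:
  assumes B: "comon_coc M B" and f: "comodule_hom B (x, r) (y, s) f"
    and l: "l \<in> Arr M" "Dom M l = a" "Cod M l = com_obj B \<otimes> a"
    and e: "is_equalizer M (assoc M x (com_obj B) a \<cdot> (r \<otimes>\<^sub>m Id M a)) (Id M x \<otimes>\<^sub>m l) e"
  shows "(assoc M y (com_obj B) a \<cdot> (s \<otimes>\<^sub>m Id M a)) \<cdot> (f \<otimes>\<^sub>m Id M a) \<cdot> e = (Id M y \<otimes>\<^sub>m l) \<cdot>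
      (f \<otimes>\<^sub>m Id M a) \<cdot> e"
proof -
  let ?b = "com_obj B"
  have [simp]: "a \<in> Obj M" using Dom_Obj[OF l(1)] l by simp
  note [simp] = comon_cocD(1-7)[OF B] right_comoduleD(1-4)[OF comodule_homD(1)[OF f]]
      right_comoduleD(1-4)[OF comodule_homD(2)[OF f]]
    comodule_homD(3-5)[OF f] l
  have m: "mono_arr M e" and [simp]: "Cod M e = x \<otimes> a"
      and eq: "assoc M x ?b a \<cdot> (r \<otimes>\<^sub>m Id M a) \<cdot> e = (Id M x \<otimes>\<^sub>m l) \<cdot> e"
    using e unfolding is_equalizer_iff by (auto simp: mono_is_arr)
  note [simp] = mono_is_arr[OF m]
  have "(assoc M y ?b a \<cdot> (s \<otimes>\<^sub>m Id M a)) \<cdot> (f \<otimes>\<^sub>m Id M a) \<cdot> e = (assoc M y ?b a \<cdot>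
      ((f \<otimes>\<^sub>m Id M ?b) \<otimes>\<^sub>m Id M a)) \<cdot> (r \<otimes>\<^sub>m Id M a) \<cdot> e"
    by (simp add: interchange comodule_homD(6)[OF f])
  also have "\<dots> = (f \<otimes>\<^sub>m Id M (?b \<otimes> a)) \<cdot> (assoc M x ?b a \<cdot> (r \<otimes>\<^sub>m Id M a) \<cdot> e)"
    by (subst assoc_nat[of _ _ _ x ?b a]) simp_all
  also have "\<dots> = (Id M y \<otimes>\<^sub>m l) \<cdot> (f \<otimes>\<^sub>m Id M a) \<cdot> e"
    unfolding eq by (simp add: interchange)
  finally show ?thesis .
qed

text \<open>Makes \<open>f\<close> a morphism of module comonoids, the kind of arrow to which the
  coflatness condition refers. Linearity of comultiplication and counit holds because the action is
  a composite of comonoid morphisms.\<close>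

lemma module_comonoid_of_hom:
  assumes A: "hopf_coc M A" and B: "hopf_coc M B" and f: "hopf_hom M A B f"
  shows "is_module_comonoid M A \<lparr>modcom_comonoid = hopf_comonoid B, modcom_act = hopf_mult B \<cdot>
      (f \<otimes>\<^sub>m Id M (hopf_carrier B))\<rparr>"
proof -
  let ?a = "hopf_carrier A" and ?b = "hopf_carrier B" and ?m = "hopf_mult B"
      and ?act = "hopf_mult B \<cdot> (f \<otimes>\<^sub>m Id M (hopf_carrier B))"
  note Ac = hopf_coc_comon[OF A] and Bc = hopf_coc_comon[OF B]
  note [simp] = hopf_cocD[OF A] hopf_cocD[OF B] hopf_homD(1-3)[OF f]
  have "comon_hom M (comon_prod M (hopf_comonoid A) (hopf_comonoid B)) (hopf_comonoid B) ?act"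
    using comon_hom_Id[OF Bc]
    by (intro comon_hom_comp[OF tensor_hom[OF hopf_homD(4)[OF f]] hopf_mult_hom[OF B]]
        comon_prod_coc Ac Bc) simp_all
  note h = comon_homD(4,5)[OF this]
  have "?act \<cdot> (hopf_mult A \<otimes>\<^sub>m Id M ?b) = (?m \<cdot> (?m \<otimes>\<^sub>m Id M ?b)) \<cdot> ((f \<otimes>\<^sub>m f) \<otimes>\<^sub>m Id M ?b)"
    by (simp add: interchange hopf_homD(5)[OF f])
  also have "\<dots> = ?m \<cdot> (Id M ?b \<otimes>\<^sub>m ?m) \<cdot> (assoc M ?b ?b ?b \<cdot> ((f \<otimes>\<^sub>m f) \<otimes>\<^sub>m Id M ?b))"
    unfolding hopf_monoid_laws(1)[OF B] by simp
  also have "\<dots> = ?act \<cdot> (Id M ?a \<otimes>\<^sub>m ?act) \<cdot> assoc M ?a ?a ?b"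
    by (subst assoc_nat[of _ _ _ ?a ?a ?b]) (simp_all add: interchange)
  finally have 1: "?act \<cdot> (hopf_mult A \<otimes>\<^sub>m Id M ?b) = ?act \<cdot> (Id M ?a \<otimes>\<^sub>m ?act) \<cdot> assoc M ?a ?a ?b" .
  have 2: "?act \<cdot> (hopf_unit A \<otimes>\<^sub>m Id M ?b) = lunit M ?b"
    by (simp add: interchange hopf_homD(6)[OF f] hopf_monoid_laws(2)[OF B])
  show ?thesis
    using Bc h 1 2
    by (simp add: is_module_comonoid_def modcom_module_def is_left_module_def is_left_linear_def
        diagonal_module_def trivial_module_def
      Let_def in_hset comon_coc_def comon_prod_def interchange)
qed

text \<open>The coflatness condition in usable form. The cotensor functor is built from chosen
  equalizers; here the premise speaks of arbitrary equalizers \<open>e\<close>, \<open>e'\<close>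
  and the arrow \<open>g\<close> induced between them, so that no choice has to be inspected
  later.\<close>

lemma faithful_coflatness_epi:
  assumes FC: "faithful_coflatness M" and A: "hopf_coc M A" and B: "hopf_coc M B"
      and f: "hopf_hom M A B f" and fe: "epi_arr M f"
    and d: "comodule_hom (hopf_comonoid B) (x, r) (y, s) d" and b: "b = hopf_carrier B"
        and a: "a = hopf_carrier A"
    and l: "l = (f \<otimes>\<^sub>m Id M a) \<cdot> hopf_comult A"
    and epi: "\<And>e e' g. is_equalizer M (assoc M x b a \<cdot> (r \<otimes>\<^sub>m Id M a)) (Id M x \<otimes>\<^sub>m l) e \<Longrightarrow>
      is_equalizer M (assoc M y b a \<cdot> (s \<otimes>\<^sub>m Id M a)) (Id M y \<otimes>\<^sub>m l) e' \<Longrightarrow>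
      g \<in> Arr M \<Longrightarrow> Dom M g = Dom M e \<Longrightarrow> Cod M g = Dom M e' \<Longrightarrow> e' \<cdot> g = (d \<otimes>\<^sub>m Id M a) \<cdot> e \<Longrightarrow> epi_arr M g"
  shows "epi_arr M d"
proof -
  let ?B = "hopf_comonoid B"
  note Ac = hopf_coc_comon[OF A] and Bc = hopf_coc_comon[OF B]
  note [simp] = hopf_cocD[OF A, folded a] hopf_cocD[OF B, folded b] hopf_homD(1-3)[OF f, folded a b]
  note dx = comodule_homD(1)[OF d] and dy = comodule_homD(2)[OF d]
  note [simp] = right_comoduleD(1-4)[OF dx, simplified, folded b] right_comoduleD(1-4)[OF dy,
      simplified, folded b] comodule_homD(3-5)[OF d]
  have l' [simp]: "l \<in> Arr M" "Dom M l = a" "Cod M l = b \<otimes> a" by (simp_all add: l)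
  let ?X = "\<lparr>modcom_comonoid = hopf_comonoid B, modcom_act = hopf_mult B \<cdot> (f \<otimes>\<^sub>m Id M b)\<rparr>"
  have X: "is_module_comonoid M A ?X" using module_comonoid_of_hom[OF A B f] by (simp add: b)
  have AA: "is_module_comonoid M A (hopf_modcom A)"
    using module_comonoid_of_hom[OF A A hopf_hom_Id[OF A]] hopf_cocD[OF A]
      by (simp add: hopf_modcom_def)
  have "(hopf_modcom A, f, ?X) \<in> hset (Comon_coc_mod M A) (hopf_modcom A) ?X"
    using X AA hopf_homD(4,5)[OF f]
    by (simp add: in_hset Comon_coc_mod_def struct_cat_def comon_hom_def is_left_linear_def
        modcom_module_def interchange
      hopf_modcom_def flip: a b)
  moreover have "A \<in> Obj (Hopf_coc M)" using A
    by (simp add: Hopf_coc_def struct_cat_def hopf_coc_def)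
  ultimately have refl: "reflects_epis (Right_Comod M ?B) M (cotensor_arr M ?B (a, l))"
    using FC fe unfolding faithful_coflatness_def Let_def l a by fastforce
  let ?P = "\<lambda>x r e. is_equalizer M (assoc M x b a \<cdot> (r \<otimes>\<^sub>m Id M a)) (Id M x \<otimes>\<^sub>m l) e"
  let ?e = "cotensor_incl M ?B (a, l) (x, r)" and ?e' = "cotensor_incl M ?B (a, l) (y, s)"
  have "\<exists>e. ?P x r e" "\<exists>e. ?P y s e" by (rule ex_equalizer; simp)+
  then have e: "?P x r ?e" and e': "?P y s ?e'"
    unfolding cotensor_incl_def by (auto simp flip: b intro: someI_ex)
  have m: "mono_arr M ?e" "Cod M ?e = x \<otimes> a" "mono_arr M ?e'" "Cod M ?e' = y \<otimes> a" using e e'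
    by (simp_all add: is_equalizer_iff)
  note [simp] = mono_is_arr[OF m(1)] mono_is_arr[OF m(3)] m(2,4)
  have eqz: "(assoc M y b a \<cdot> (s \<otimes>\<^sub>m Id M a)) \<cdot> (d \<otimes>\<^sub>m Id M a) \<cdot> ?e = (Id M y \<otimes>\<^sub>m l) \<cdot> (d \<otimes>\<^sub>m Id M a) \<cdot>
      ?e"
    using comodule_hom_equalizes[OF Bc d l'(1,2), of ?e, simplified, folded b] e by simp
  obtain g where g: "g \<in> Arr M" "Cod M g = Dom M ?e'" "?e' \<cdot> g = (d \<otimes>\<^sub>m Id M a) \<cdot> ?e"
    by (rule equalizer_factor[OF e' _ _ eqz]) simp_all
  have gd: "Dom M g = Dom M ?e" using arg_cong[OF g(3), of "Dom M"] g(1,2) by simp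
  \<comment> \<open>The induced arrow is unique because \<open>?e'\<close> is monic, so it is the
    value of the functor at \<open>d\<close>.\<close>
  have "cotensor_arr M ?B (a, l) ((x, r), d, (y, s)) = g"
    unfolding cotensor_arr_def Let_def prod.case
  proof (rule the_equality)
    show "g \<in> hset M (Dom M ?e) (Dom M ?e') \<and> ?e' \<cdot> g = (d \<otimes>\<^sub>m Id M (fst (a, l))) \<cdot> ?e" using g gd
      by (simp add: in_hset)
    show "h = g" if "h \<in> hset M (Dom M ?e) (Dom M ?e') \<and> ?e' \<cdot> h = (d \<otimes>\<^sub>m Id M (fst (a, l))) \<cdot> ?e"
        for h
      by (rule mono_cancel[OF m(3)]) (use that g in \<open>simp_all add: in_hset\<close>)
  qed
  moreover have "epi_arr M g" by (rule epi[OF e e' g(1) gd g(2,3)])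
  ultimately have "epi_arr (Right_Comod M ?B) ((x, r), d, (y, s))"
    using refl d unfolding reflects_epis_def by (metis Right_Comod_simps(1))
  then show ?thesis by (rule epi_of_comodules[OF Bc d])
qed

text \<open>Along \<open>f\<close> itself, the pullback \<open>v\<close> of \<open>f\<close> acquires the section \<open>\<langle>1, a\<rangle>\<close>.\<close>

lemma pullback_epi:
  assumes FC: "faithful_coflatness M" and A: "hopf_coc M A" and B: "hopf_coc M B"
      and V: "hopf_coc M V"
    and f: "hopf_hom M A B f" and fe: "epi_arr M f" and g: "hopf_hom M V B g"
  obtains E v a where "hopf_coc M E" "hopf_hom M E V v" "hopf_hom M E A a" "g \<cdot> v = f \<cdot> a"
      "epi_arr M v"
proof -
  let ?V = "hopf_comonoid V" and ?A = "hopf_comonoid A" and ?B = "hopf_comonoid B"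
  let ?a = "hopf_carrier A" and ?b = "hopf_carrier B"
  note Vc = hopf_coc_comon[OF V] and Ac = hopf_coc_comon[OF A] and Bc = hopf_coc_comon[OF B]
  note fc = hopf_homD(4)[OF f] and gc = hopf_homD(4)[OF g]
  obtain e where e: "is_equalizer M (cotensor_left ?V ?A ?B g) (cotensor_right ?V ?A f) e"
    using ex_equalizer[of "cotensor_left ?V ?A ?B g"
        "cotensor_right ?V ?A f"] cotensor_arrs[OF Vc Ac Bc gc fc] by auto
  obtain E v a where E: "hopf_coc M E" "hopf_carrier E = Dom M e" and v: "hopf_hom M E V v"
      and a: "hopf_hom M E A a"
    and gv: "g \<cdot> v = f \<cdot> a" and va: "pairing M (hopf_comonoid E) v a = e"
    by (rule hopf_pullback[OF V A B g f e])
  let ?E = "hopf_comonoid E"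
  note Ec = hopf_coc_comon[OF E(1)] and vc = hopf_homD(4)[OF v] and ac = hopf_homD(4)[OF a]
  note [simp] = hopf_cocD[OF A] hopf_cocD[OF B] hopf_cocD[OF V] hopf_cocD[OF E(1)]
    hopf_homD(1-3)[OF f] hopf_homD(1-3)[OF g] hopf_homD(1-3)[OF v] hopf_homD(1-3)[OF a] Ec
  have gvc: "comon_hom M ?E ?B (g \<cdot> v)" by (rule comon_hom_comp[OF vc gc Ec Vc Bc])
  let ?rE = "(Id M (com_obj ?E) \<otimes>\<^sub>m (g \<cdot> v)) \<cdot> com_comult ?E"
      and ?rV = "(Id M (com_obj ?V) \<otimes>\<^sub>m g) \<cdot> com_comult ?V"
  have "?rV \<cdot> v = (Id M (com_obj ?V) \<otimes>\<^sub>m g) \<cdot> (v \<otimes>\<^sub>m v) \<cdot> com_comult ?E"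
    using comon_homD(4)[OF vc] by simp
  then have vh: "comodule_hom ?B (com_obj ?E, ?rE) (com_obj ?V, ?rV) v"
    unfolding comodule_hom_def using comodule_of_hom[OF Ec Bc gvc] comodule_of_hom[OF Vc Bc gc]
    by (simp add: in_hset interchange)
  have "epi_arr M v"
  proof (rule faithful_coflatness_epi[OF FC A B f fe vh refl refl refl])
    let ?l = "(f \<otimes>\<^sub>m Id M ?a) \<cdot> hopf_comult A"
    fix e1 e2 g1
    assume e1: "is_equalizer M (assoc M (com_obj ?E) ?b ?a \<cdot>
        (?rE \<otimes>\<^sub>m Id M ?a)) (Id M (com_obj ?E) \<otimes>\<^sub>m ?l) e1"
      and e2: "is_equalizer M (assoc M (com_obj ?V) ?b ?a \<cdot>
          (?rV \<otimes>\<^sub>m Id M ?a)) (Id M (com_obj ?V) \<otimes>\<^sub>m ?l) e2"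
      and g1: "g1 \<in> Arr M" "Dom M g1 = Dom M e1" "Cod M g1 = Dom M e2" "e2 \<cdot> g1 = (v \<otimes>\<^sub>m Id M ?a) \<cdot>
          e1"
    have e1': "is_equalizer M (cotensor_left ?E ?A ?B (g \<cdot> v)) (cotensor_right ?E ?A f) e1"
      using e1 by (simp add: cotensor_left_def cotensor_right_def)
    have e2': "is_equalizer M (cotensor_left ?V ?A ?B g) (cotensor_right ?V ?A f) e2"
      using e2 by (simp add: cotensor_left_def cotensor_right_def)
    have m: "mono_arr M e1" "mono_arr M e2" "Cod M e1 = hopf_carrier E \<otimes> ?a" "Cod M e2 =
        hopf_carrier V \<otimes> ?a"
      using e1 e2 by (simp_all add: is_equalizer_iff)
    note [simp] = g1(1-3) mono_is_arr[OF m(1)] mono_is_arr[OF m(2)] m(3,4)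
    \<comment> \<open>The section \<open>\<langle>1, a\<rangle>\<close> of the comment above, as an
      arrow into the cotensor product of \<open>E\<close> with \<open>A\<close>; it exists because
      \<open>g \<cdot> v = f \<cdot> a\<close>.\<close>
    obtain z where [simp]: "z \<in> Arr M" "Dom M z = hopf_carrier E" "Cod M z = Dom M e1"
      and z: "e1 \<cdot> z = pairing M ?E (Id M (com_obj ?E)) a"
      using cotensor_factor[OF Ec Ac Bc gvc fc e1' Ec comon_hom_Id[OF Ec] ac] gv by auto
    have eqs: "cotensor_left ?V ?A ?B g \<cdot> e2 = cotensor_right ?V ?A f \<cdot> e2"
      using e2' by (simp add: is_equalizer_iff)
    \<comment> \<open>\<open>e\<close> and \<open>e2\<close> equalize the same pair. The comparison
      \<open>k\<close> moves the section onto the equalizer \<open>e2\<close>: since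
      \<open>e2 \<cdot> g1 \<cdot> z = e\<close>, the arrow \<open>z \<cdot> k\<close> splits
      \<open>g1\<close>.\<close>
    obtain k where [simp]: "k \<in> Arr M" "Cod M k = Dom M e" and k: "e \<cdot> k = e2"
      by (rule equalizer_factor[OF e _ _ eqs]) (simp_all add: cotensor_arrs[OF Vc Ac Bc gc fc])
    note [simp] = E(2)[symmetric]
    have em: "mono_arr M e" using e by (simp add: is_equalizer_iff)
    have [simp]: "Dom M k = Dom M e2" using arg_cong[OF k, of "Dom M"] mono_is_arr[OF em] by simp
    have "(e2 \<cdot> g1) \<cdot> z = (v \<otimes>\<^sub>m Id M ?a) \<cdot> e1 \<cdot> z" unfolding g1(4) by simp
    also have "\<dots> = e" unfolding z by (simp add: tensor_pairing va)
    finally have 1: "e2 \<cdot> g1 \<cdot> z = e" by simp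
    have "g1 \<cdot> z \<cdot> k = Id M (Dom M e2)"
      by (rule mono_cancel[OF m(2)]) (use comp_tail[OF 1, of k] in \<open>simp_all add: k\<close>)
    then show "epi_arr M g1" by (intro split_epi[of g1 "z \<cdot> k"]) simp_all
  qed
  then show thesis by (rule that[OF E(1) v a gv])
qed

text \<open>Every law for \<open>k\<close> is tested after \<open>f\<close>, after
  \<open>f \<otimes> f\<close>, or on the unit, where it follows from the laws for \<open>f\<close>
  and \<open>h\<close>.\<close>

lemma hopf_hom_epi_factor:
  assumes A: "hopf_coc M A" and B: "hopf_coc M B" and X: "hopf_coc M X" and f: "hopf_hom M A B f"
      and fe: "epi_arr M f"
    and h: "hopf_hom M A X h" and k: "k \<in> Arr M" "Dom M k = hopf_carrier B" "Cod M k =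
        hopf_carrier X" and kf: "k \<cdot> f = h"
  shows "hopf_hom M B X k"
proof -
  note [simp] = hopf_cocD[OF A] hopf_cocD[OF B] hopf_cocD[OF X] hopf_homD(1-3)[OF f]
      hopf_homD(1-3)[OF h] k
  have kfh: "k \<cdot> f \<cdot> l = h \<cdot> l" if "l \<in> Arr M" "Cod M l = hopf_carrier A" for l
    using comp_tail[OF kf, of l] that by simp
  have "(hopf_comult X \<cdot> k) \<cdot> f = (h \<otimes>\<^sub>m h) \<cdot> hopf_comult A"
    using comon_homD(4)[OF hopf_homD(4)[OF h]] by (simp add: kf)
  also have "\<dots> = (k \<otimes>\<^sub>m k) \<cdot> (f \<otimes>\<^sub>m f) \<cdot> hopf_comult A" by (simp add: interchange kf)
  also have "\<dots> = ((k \<otimes>\<^sub>m k) \<cdot> hopf_comult B) \<cdot> f"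
    using comon_homD(4)[OF hopf_homD(4)[OF f]] by simp
  finally have 1: "hopf_comult X \<cdot> k = (k \<otimes>\<^sub>m k) \<cdot> hopf_comult B"
    by (rule epi_cancel[OF fe]) simp_all
  have "(hopf_counit X \<cdot> k) \<cdot> f = hopf_counit B \<cdot> f"
    by (simp add: kf hopf_homD(7)[OF h] hopf_homD(7)[OF f])
  then have 2: "hopf_counit X \<cdot> k = hopf_counit B" by (rule epi_cancel[OF fe]) simp_all
  have "(k \<cdot> hopf_mult B) \<cdot> (f \<otimes>\<^sub>m f) = k \<cdot> f \<cdot> hopf_mult A" by (simp add: hopf_homD(5)[OF f])
  also have "\<dots> = (hopf_mult X \<cdot> (k \<otimes>\<^sub>m k)) \<cdot> (f \<otimes>\<^sub>m f)"
    by (simp add: kfh hopf_homD(5)[OF h] interchange kf)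
  finally have 3: "k \<cdot> hopf_mult B = hopf_mult X \<cdot> (k \<otimes>\<^sub>m k)"
    by (rule epi_cancel[OF tensor_epi[OF fe fe]]) simp_all
  have 4: "k \<cdot> hopf_unit B = hopf_unit X"
    using kfh[of "hopf_unit A"] by (simp add: hopf_homD(6)[OF f] hopf_homD(6)[OF h])
  show ?thesis
    using 1 2 3 4 unfolding hopf_hom_def is_monoid_arr_def by (auto intro!: comon_homI)
qed

text \<open>
  With \<open>v\<close> and \<open>a\<close> the kernel pair of \<open>f\<close>, the difference \<open>v - a\<close> maps onto the kernel \<open>n\<close> of \<open>f\<close>
  in \<open>M\<close>: after cotensoring with \<open>A\<close> it is split, since \<open>(x, y) \<mapsto> (x, y, y)\<close> is sent to \<open>(x, y) -
  (y, y)\<close>.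
\<close>

lemma kernel_pair_difference_epi:
  assumes FC: "faithful_coflatness M" and A: "hopf_coc M A" and B: "hopf_coc M B"
    and f: "hopf_hom M A B f" and fe: "epi_arr M f"
    and e: "is_equalizer M (cotensor_left (hopf_comonoid A) (hopf_comonoid A) (hopf_comonoid B) f)
        (cotensor_right (hopf_comonoid A) (hopf_comonoid A) f) e"
    and E: "hopf_coc M E" "hopf_carrier E = Dom M e" and v: "hopf_hom M E A v"
        and a: "hopf_hom M E A a"
    and fva: "f \<cdot> v = f \<cdot> a" and va: "pairing M (hopf_comonoid E) v a = e"
    and n: "is_kernel M f n"
  obtains d where "d \<in> Arr M" "Dom M d = hopf_carrier E" "Cod M d = Dom M n" "n \<cdot> d = diff v a"
      "epi_arr M d"
proof -
  let ?A = "hopf_comonoid A" and ?B = "hopf_comonoid B" and ?E = "hopf_comonoid E"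
  let ?a = "hopf_carrier A" and ?b = "hopf_carrier B" and ?e = "hopf_carrier E" and ?n = "Dom M n"
  note Ac = hopf_coc_comon[OF A] and Bc = hopf_coc_comon[OF B] and Ec = hopf_coc_comon[OF E(1)]
  note fc = hopf_homD(4)[OF f] and vc = hopf_homD(4)[OF v] and ac = hopf_homD(4)[OF a]
  note [simp] = hopf_cocD[OF A] hopf_cocD[OF B] hopf_cocD[OF E(1)]
    hopf_homD(1-3)[OF f] hopf_homD(1-3)[OF v] hopf_homD(1-3)[OF a] Ec Ac
  note [simp] = kernelD(2)[OF n] kernelD(3)[OF n, simplified]
  note nm = kernelD(5)[OF n] and fn = kernelD(4)[OF n, simplified]
  have dv: "diff v a \<in> Arr M" "Dom M (diff v a) = ?e" "Cod M (diff v a) = ?a"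
    using diff_props(1-3)[of v a] by simp_all
  note [simp] = dv
  have "f \<cdot> diff v a = zero_arr M ?e ?b"
    using diff_props(6)[of "f \<cdot> v" "f \<cdot> a"] fva by (simp add: comp_diff)
  then obtain d where [simp]: "d \<in> Arr M" "Dom M d = ?e" "Cod M d = ?n" and d: "n \<cdot> d = diff v a"
    using kernelD(6)[OF n, of "diff v a"] by auto
  let ?rA = "(Id M ?a \<otimes>\<^sub>m f) \<cdot> hopf_comult A" and ?rE = "(Id M ?e \<otimes>\<^sub>m (f \<cdot> v)) \<cdot> hopf_comult E"
  \<comment> \<open>The kernel \<open>n\<close> is a subcomodule of \<open>A\<close>: its coaction
    lands in the kernel of \<open>f \<otimes> Id\<close>, because comultiplication commutes with
    \<open>f\<close>, and by exactness that kernel is \<open>n \<otimes> Id\<close>.\<close>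
  have "(f \<otimes>\<^sub>m Id M ?b) \<cdot> ?rA \<cdot> n = ((f \<otimes>\<^sub>m f) \<cdot> hopf_comult A) \<cdot> n" by (simp add: interchange)
  also have "\<dots> = zero_arr M ?n (?b \<otimes> ?b)"
    unfolding comon_homD(4)[OF fc, simplified, symmetric] by (simp add: fn)
  finally have 0: "(f \<otimes>\<^sub>m Id M ?b) \<cdot> ?rA \<cdot> n = zero_arr M ?n (?b \<otimes> ?b)" .
  obtain t where [simp]: "t \<in> Arr M" "Dom M t = ?n" "Cod M t = ?n \<otimes> ?b"
      and t: "(n \<otimes>\<^sub>m Id M ?b) \<cdot> t = ?rA \<cdot> n"
    using kernelD(6)[OF tensor_Id_kernel[OF n, of ?b], of "?rA \<cdot> n"] 0 by auto
  have cA: "is_right_comodule M ?B (?a, ?rA)" using comodule_of_hom[OF Ac Bc fc] by simp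
  have cN: "is_right_comodule M ?B (?n, t)" by (rule sub_comodule[OF Bc cA nm]) (use t in simp_all)
  have fvc: "comon_hom M ?E ?B (f \<cdot> v)" by (rule comon_hom_comp[OF vc fc Ec Ac Bc])
  have cE: "is_right_comodule M ?B (?e, ?rE)" using comodule_of_hom[OF Ec Bc fvc] by simp
  \<comment> \<open>The coaction on \<open>E\<close> is the same along \<open>v\<close> and along
    \<open>a\<close>, since both have the same composite with \<open>f\<close>; so both projections,
    and with them their difference, are comodule morphisms.\<close>
  have r: "?rA \<cdot> w = (w \<otimes>\<^sub>m Id M ?b) \<cdot> ?rE" if w: "hopf_hom M E A w" and "f \<cdot> w = f \<cdot> v" for w
    using comon_homD(4)[OF hopf_homD(4)[OF w]] hopf_homD(1-3)[OF w] that(2)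
      by (simp add: interchange)
  have "(n \<otimes>\<^sub>m Id M ?b) \<cdot> t \<cdot> d = ?rA \<cdot> diff v a"
    using comp_tail[OF t, of d] by (simp add: d)
  also have "\<dots> = diff (?rA \<cdot> v) (?rA \<cdot> a)" by (rule comp_diff) simp_all
  also have "\<dots> = diff ((v \<otimes>\<^sub>m Id M ?b) \<cdot> ?rE) ((a \<otimes>\<^sub>m Id M ?b) \<cdot> ?rE)"
    by (simp only: r[OF v refl] r[OF a fva[symmetric]])
  also have "\<dots> = diff (v \<otimes>\<^sub>m Id M ?b) (a \<otimes>\<^sub>m Id M ?b) \<cdot> ?rE"
    by (rule diff_comp[symmetric]) simp_all
  also have "\<dots> = (n \<otimes>\<^sub>m Id M ?b) \<cdot> (d \<otimes>\<^sub>m Id M ?b) \<cdot> ?rE"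
    by (subst tensor_Id_diff[symmetric]) (simp_all add: interchange d)
  finally have "t \<cdot> d = (d \<otimes>\<^sub>m Id M ?b) \<cdot> ?rE"
    by (rule mono_cancel[OF tensor_Id_mono[OF nm], rotated]) simp_all
  then have dh: "comodule_hom ?B (?e, ?rE) (?n, t) d"
    unfolding comodule_hom_def using cE cN by (simp add: in_hset)
  have nh: "comodule_hom ?B (?n, t) (?a, ?rA) n"
    unfolding comodule_hom_def using cA cN t by (simp add: in_hset)
  let ?l = "(f \<otimes>\<^sub>m Id M ?a) \<cdot> hopf_comult A"
  have em: "mono_arr M e" and [simp]: "Cod M e = ?a \<otimes> ?a" using e cotensor_arrs[OF Ac Ac Bc fc fc]
    by (simp_all add: is_equalizer_iff)
  note [simp] = E(2)[symmetric] mono_is_arr[OF em]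
  have "epi_arr M d"
  proof (rule faithful_coflatness_epi[OF FC A B f fe dh refl refl refl])
    fix e1 e2 g1
    assume e1: "is_equalizer M (assoc M ?e ?b ?a \<cdot> (?rE \<otimes>\<^sub>m Id M ?a)) (Id M ?e \<otimes>\<^sub>m ?l) e1"
      and e2: "is_equalizer M (assoc M ?n ?b ?a \<cdot> (t \<otimes>\<^sub>m Id M ?a)) (Id M ?n \<otimes>\<^sub>m ?l) e2"
      and g1: "g1 \<in> Arr M" "Dom M g1 = Dom M e1" "Cod M g1 = Dom M e2" "e2 \<cdot> g1 = (d \<otimes>\<^sub>m Id M ?a) \<cdot>
          e1"
    have e1': "is_equalizer M (cotensor_left ?E ?A ?B (f \<cdot> v)) (cotensor_right ?E ?A f) e1"
      using e1 by (simp add: cotensor_left_def cotensor_right_def)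
    have m: "mono_arr M e1" "mono_arr M e2" "Cod M e1 = ?e \<otimes> ?a" "Cod M e2 = ?n \<otimes> ?a"
      using e1 e2 by (simp_all add: is_equalizer_iff)
    note [simp] = g1(1-3) mono_is_arr[OF m(1)] mono_is_arr[OF m(2)] m(3,4)
    obtain z where [simp]: "z \<in> Arr M" "Dom M z = ?e" "Cod M z = Dom M e1"
      and z: "e1 \<cdot> z = pairing M ?E (Id M (com_obj ?E)) a"
      using cotensor_factor[OF Ec Ac Bc fvc fc e1' Ec comon_hom_Id[OF Ec] ac] fva by auto
    \<comment> \<open>\<open>?j\<close> regards an element of the kernel cotensored with
      \<open>A\<close> as an element of \<open>A \<otimes> A\<close>. As \<open>n\<close> is a
      comodule morphism, it lies in the kernel pair, which yields the arrow \<open>y\<close> into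
      \<open>E\<close>.\<close>
    let ?j = "(n \<otimes>\<^sub>m Id M ?a) \<cdot> e2"
    have "(assoc M ?a ?b ?a \<cdot> (?rA \<otimes>\<^sub>m Id M ?a)) \<cdot> ?j = (Id M ?a \<otimes>\<^sub>m ?l) \<cdot> ?j"
      using comodule_hom_equalizes[OF Bc nh, of ?l ?a e2] e2 by simp
    then have "cotensor_left ?A ?A ?B f \<cdot> ?j = cotensor_right ?A ?A f \<cdot> ?j"
      by (simp add: cotensor_left_def cotensor_right_def)
    then obtain y where [simp]: "y \<in> Arr M" "Cod M y = ?e" and y: "e \<cdot> y = ?j"
      using equalizer_factor[OF e, of ?j] cotensor_arrs[OF Ac Ac Bc fc fc] by auto
    have [simp]: "Dom M y = Dom M e2" using arg_cong[OF y, of "Dom M"] by simp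
    have "a \<cdot> y = proj2 M ?A ?A \<cdot> e \<cdot> y"
      using comp_tail[OF proj_pairing(2)[OF vc ac Ec Ac Ac], of y] proj_arr[OF Ac Ac]
        by (simp add: va)
    also have "\<dots> = lunit M ?a \<cdot> ((hopf_counit A \<cdot> n) \<otimes>\<^sub>m Id M ?a) \<cdot> e2"
      unfolding y by (simp add: proj2_def interchange)
    \<comment> \<open>The second projection applies the counit of \<open>A\<close> to the kernel,
      and that counit factors through \<open>f\<close>.\<close>
    also have "hopf_counit A \<cdot> n = zero_arr M ?n (unit_obj M)"
      unfolding hopf_homD(7)[OF f, symmetric] by (simp add: fn)
    finally have ay: "a \<cdot> y = zero_arr M (Dom M e2) ?a" by (simp add: tensor_Id_zero)
    \<comment> \<open>The term to be subtracted, \<open>(y, y)\<close> in elements, is the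
      comultiplication applied to the second component, and that component has just been shown to
      vanish.\<close>
    have "pairing M ?E a a = hopf_comult A \<cdot> a"
      using comon_homD(4)[OF ac] by (simp add: pairing_def)
    then have aay: "pairing M ?E a a \<cdot> y = zero_arr M (Dom M e2) (?a \<otimes> ?a)" by (simp add: ay)
    have "(n \<otimes>\<^sub>m Id M ?a) \<cdot> e2 \<cdot> g1 \<cdot> z \<cdot> y = (n \<otimes>\<^sub>m Id M ?a) \<cdot> (d \<otimes>\<^sub>m Id M ?a) \<cdot> (e1 \<cdot> z) \<cdot> y"
      using comp_tail[OF g1(4), of "z \<cdot> y"] by simp
    also have "\<dots> = (diff v a \<otimes>\<^sub>m Id M ?a) \<cdot> pairing M ?E (Id M ?e) a \<cdot> y"
      unfolding z by (simp add: interchange d)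
    also have "\<dots> = diff ((v \<otimes>\<^sub>m Id M ?a) \<cdot> pairing M ?E (Id M ?e) a \<cdot> y) ((a \<otimes>\<^sub>m Id M ?a) \<cdot>
        pairing M ?E (Id M ?e) a \<cdot> y)"
      by (subst tensor_Id_diff, simp_all) (rule diff_comp, simp_all)
    also have "\<dots> = diff (e \<cdot> y) (pairing M ?E a a \<cdot> y)"
      using comp_tail[OF tensor_pairing[OF Ec _ _ _ _ _ _ _ _, of "Id M ?e" a v "Id M ?a"], of y]
        comp_tail[OF tensor_pairing[OF Ec _ _ _ _ _ _ _ _, of "Id M ?e" a a "Id M ?a"], of y]
          by (simp add: va)
    also have "\<dots> = ?j"
      unfolding aay y using diff_props(7)[of ?j ?j] by simp
    finally have 1: "(n \<otimes>\<^sub>m Id M ?a) \<cdot> e2 \<cdot> g1 \<cdot> z \<cdot> y = ?j" .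
    have 2: "e2 \<cdot> g1 \<cdot> z \<cdot> y = e2"
      by (rule mono_cancel[OF tensor_Id_mono[OF nm] 1]) simp_all
    have "g1 \<cdot> z \<cdot> y = Id M (Dom M e2)"
      by (rule mono_cancel[OF m(2)]) (simp_all add: 2)
    then show "epi_arr M g1" by (intro split_epi[of g1 "z \<cdot> y"]) simp_all
  qed
  then show thesis by (intro that[of d]) (simp_all add: d del: E(2)[symmetric])
qed

text \<open>The universal property is phrased with arrows of \<open>M\<close> and with the trivial
  morphism in place of zero arrows; \<open>epi_some_cokernel\<close> translates it and adds
  uniqueness, which follows from \<open>fe\<close>.\<close>

theorem epi_hopf_cokernel:
  assumes FC: "faithful_coflatness M" and A: "hopf_coc M A" and B: "hopf_coc M B"
    and f: "hopf_hom M A B f" and fe: "epi_arr M f"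
  obtains K k where "hopf_coc M K" "hopf_hom M K A k" "f \<cdot> k = hopf_unit B \<cdot> hopf_counit K"
    "\<And>X h. hopf_coc M X \<Longrightarrow> hopf_hom M A X h \<Longrightarrow> h \<cdot> k = hopf_unit X \<cdot> hopf_counit K \<Longrightarrow>
        \<exists>l. hopf_hom M B X l \<and> l \<cdot> f = h"
proof -
  let ?A = "hopf_comonoid A" and ?B = "hopf_comonoid B" and ?I = "hopf_comonoid hopf_one"
  note Ac = hopf_coc_comon[OF A] and Bc = hopf_coc_comon[OF B]
      and Ic = hopf_coc_comon[OF hopf_one_coc]
  note fc = hopf_homD(4)[OF f] and uh = hopf_unit_hopf_hom[OF B]
  note uc = hopf_homD(4)[OF uh]
  note [simp] = hopf_cocD[OF A] hopf_cocD[OF B] hopf_homD(1-3)[OF f]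
  \<comment> \<open>The Hopf kernel is the pullback of \<open>f\<close> along the unit of
    \<open>B\<close>, regarded as a Hopf morphism from the trivial Hopf monoid.\<close>
  obtain e0 where e0: "is_equalizer M (cotensor_left ?I ?A ?B (hopf_unit B)) (cotensor_right ?I ?A
      f) e0"
    using ex_equalizer[of "cotensor_left ?I ?A ?B (hopf_unit B)"
        "cotensor_right ?I ?A f"] cotensor_arrs[OF Ic Ac Bc uc fc] by auto
  obtain K w k where K: "hopf_coc M K" and w: "hopf_hom M K hopf_one w" and k: "hopf_hom M K A k"
      and uw: "hopf_unit B \<cdot> w = f \<cdot> k"
    and KU: "\<And>T x y. comon_coc M T \<Longrightarrow> comon_hom M T ?I x \<Longrightarrow> comon_hom M T ?A y \<Longrightarrow> hopf_unit B \<cdot> x = f \<cdot>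
        y \<Longrightarrow>
      \<exists>z. comon_hom M T (hopf_comonoid K) z \<and> w \<cdot> z = x \<and> k \<cdot> z = y"
    by (rule hopf_pullback[OF hopf_one_coc A B uh f e0]) (rule that; blast)
  have wK: "w = hopf_counit K"
    using hopf_hom_to_one[OF hopf_homD(4)[OF w, unfolded hopf_one_comonoid]] by simp
  obtain e where e: "is_equalizer M (cotensor_left ?A ?A ?B f) (cotensor_right ?A ?A f) e"
    using ex_equalizer[of "cotensor_left ?A ?A ?B f"
        "cotensor_right ?A ?A f"] cotensor_arrs[OF Ac Ac Bc fc fc] by auto
  obtain E v a where E: "hopf_coc M E" "hopf_carrier E = Dom M e" and v: "hopf_hom M E A v"
      and a: "hopf_hom M E A a"
    and fva: "f \<cdot> v = f \<cdot> a" and va: "pairing M (hopf_comonoid E) v a = e"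
    by (rule hopf_pullback[OF A A B f f e])
  obtain n where n: "is_kernel M f n" using ex_kernel[of f] by auto
  obtain d where d: "d \<in> Arr M" "Dom M d = hopf_carrier E" "Cod M d = Dom M n" "n \<cdot> d = diff v a"
      "epi_arr M d"
    by (rule kernel_pair_difference_epi[OF FC A B f fe e E v a fva va n])
  let ?E = "hopf_comonoid E" and ?S = "hopf_antipode A"
  note Ec = hopf_coc_comon[OF E(1)] and vc = hopf_homD(4)[OF v] and ac = hopf_homD(4)[OF a]
  note [simp] = hopf_cocD[OF E(1)] hopf_cocD[OF K] hopf_homD(1-3)[OF v] hopf_homD(1-3)[OF a]
      hopf_homD(1-3)[OF k] d(1-3)
    kernelD(2)[OF n] kernelD(3)[OF n, simplified] Ec
  show thesis
  proof (rule that[OF K k])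
    show "f \<cdot> k = hopf_unit B \<cdot> hopf_counit K" using uw by (simp add: wK)
    fix X h assume X: "hopf_coc M X" and h: "hopf_hom M A X h"
        and hk: "h \<cdot> k = hopf_unit X \<cdot> hopf_counit K"
    note [simp] = hopf_cocD[OF X] hopf_homD(1-3)[OF h]
    \<comment> \<open>The quotient of the two projections in the convolution group. It becomes
      trivial under \<open>f\<close>, as both projections agree there, and so it factors through
      \<open>k\<close>.\<close>
    let ?c = "conv M A ?E v (?S \<cdot> a)"
    have Sa: "comon_hom M ?E ?A (?S \<cdot> a)"
      by (rule comon_hom_comp[OF ac antipode_hom[OF A refl] Ec Ac Ac])
    have c: "comon_hom M ?E ?A ?c" by (rule conv_hom[OF A Ec vc Sa])
    have hS: "g \<cdot> ?S \<cdot> a = hopf_antipode Y \<cdot> g \<cdot> a" if Y: "hopf_coc M Y"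
        and g: "hopf_hom M A Y g" for Y g
      using comp_tail[OF hopf_hom_antipode[OF A Y g], of a] hopf_homD(1-3)[OF g] hopf_cocD[OF Y]
        by simp
    have "f \<cdot> ?c = conv M B ?E (f \<cdot> v) (f \<cdot> ?S \<cdot> a)"
      by (rule conv_hopf_hom[OF A B Ec f]) simp_all
    also have "\<dots> = conv M B ?E (f \<cdot> a) (hopf_antipode B \<cdot> f \<cdot> a)" unfolding hS[OF B f] fva ..
    also have "\<dots> = hopf_unit B \<cdot> com_counit ?E"
      by (rule conv_antipode(2)[OF B Ec comon_hom_comp[OF ac fc Ec Ac Bc]])
    finally have "hopf_unit B \<cdot> com_counit ?E = f \<cdot> ?c" ..
    moreover have "comon_hom M ?E ?I (com_counit ?E)" using comon_hom_counit[OF Ec]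
      by (simp add: hopf_one_comonoid)
    ultimately obtain z where z: "comon_hom M ?E (hopf_comonoid K) z" "k \<cdot> z = ?c"
      using KU[OF Ec _ c] by blast
    note [simp] = comon_homD(1-3)[OF z(1), simplified]
    have "conv M X ?E (h \<cdot> v) (hopf_antipode X \<cdot> h \<cdot> a) = h \<cdot> ?c"
      using conv_hopf_hom[OF A X Ec h, of v "?S \<cdot> a"] hS[OF X h] by simp
    also have "\<dots> = (h \<cdot> k) \<cdot> z" unfolding z(2)[symmetric] by simp
    also have "\<dots> = hopf_unit X \<cdot> com_counit ?E"
      unfolding hk using comon_homD(5)[OF z(1)] by simp
    finally have 1: "conv M X ?E (h \<cdot> v) (hopf_antipode X \<cdot> h \<cdot> a) = hopf_unit X \<cdot> com_counit ?E" .
    have 2: "conv M X ?E (hopf_antipode X \<cdot> h \<cdot> a) (h \<cdot> a) = hopf_unit X \<cdot> com_counit ?E"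
      by (rule conv_antipode(1)[OF X Ec comon_hom_comp[OF ac hopf_homD(4)[OF h] Ec Ac
          hopf_coc_comon[OF X]]])
    \<comment> \<open>By \<open>1\<close> and \<open>2\<close>, \<open>h \<cdot> v\<close> and
      \<open>h \<cdot> a\<close> are inverse to the same element under convolution.\<close>
    have hva: "h \<cdot> v = h \<cdot> a" by (rule conv_inverse_unique[OF X Ec _ _ _ _ _ _ _ _ _ 1 2]) simp_all
    \<comment> \<open>The passage from multiplicative to additive: \<open>h\<close> kills the
      difference \<open>v - a\<close>, and \<open>d\<close> is epic onto the kernel.\<close>
    have "h \<cdot> n = zero_arr M (Dom M n) (hopf_carrier X)"
    proof (rule epi_cancel[OF d(5)])
      have "(h \<cdot> n) \<cdot> d = diff (h \<cdot> v) (h \<cdot> a)" by (simp add: d(4) comp_diff)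
      then show "(h \<cdot> n) \<cdot> d = zero_arr M (Dom M n) (hopf_carrier X) \<cdot> d"
        using diff_props(6)[of "h \<cdot> v" "h \<cdot> a"] hva by simp
    qed simp_all
    then obtain l where l: "l \<in> Arr M" "Dom M l = hopf_carrier B" "Cod M l = hopf_carrier X" "l \<cdot>
        f = h"
      using cokernelD(6)[OF epi_cokernel_of_kernel[OF fe n], of h] by auto
    then show "\<exists>l. hopf_hom M B X l \<and> l \<cdot> f = h"
      using hopf_hom_epi_factor[OF A B X f fe h l] by blast
  qed
qed

end

section \<open>The category of cocommutative Hopf monoids\<close>

lemma Hopf_coc_simps:
  "A \<in> Obj (Hopf_coc M) \<longleftrightarrow> hopf_coc M A"
  "(A, f, B) \<in> Arr (Hopf_coc M) \<longleftrightarrow> hopf_coc M A \<and> hopf_coc M B \<and> hopf_hom M A B f"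
  "Dom (Hopf_coc M) (A, f, B) = A" "Cod (Hopf_coc M) (A, f, B) = B"
  "Comp (Hopf_coc M) (B', g, C) (A, f, B) = (A, Comp M g f, C)"
  by (auto simp: Hopf_coc_def struct_cat_def hopf_coc_def hopf_hom_def comon_hom_def)

lemma Hopf_coc_hset:
  "F \<in> hset (Hopf_coc M) A B \<longleftrightarrow> (\<exists>f. F = (A, f, B) \<and> hopf_coc M A \<and> hopf_coc M B \<and> hopf_hom M A B f)"
  by (cases F) (auto simp: in_hset Hopf_coc_simps)

context abelian_symmetric_monoidal_category
begin

lemma trivial_hopf_hom:
  assumes A: "hopf_coc M A" and B: "hopf_coc M B"
  shows "hopf_hom M A B (hopf_unit B \<cdot> hopf_counit A)"
  by (intro hopf_hom_comp[OF A hopf_one_coc B] hopf_counit_hopf_hom hopf_unit_hopf_hom A B)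

lemma hopf_one_zero_obj: "zero_obj (Hopf_coc M) hopf_one"
  unfolding zero_obj_def Hopf_coc_simps Hopf_coc_hset
proof (intro conjI ballI)
  show "hopf_coc M hopf_one" by (rule hopf_one_coc)
  fix A assume "A \<in> Obj (Hopf_coc M)"
  then have A: "hopf_coc M A" by (simp add: Hopf_coc_simps)
  have "h = hopf_counit A" if "hopf_hom M A hopf_one h" for h
    using hopf_hom_to_one[OF hopf_homD(4)[OF that, unfolded hopf_one_comonoid]] by simp
  then show "\<exists>!F. \<exists>f. F = (A, f, hopf_one) \<and> hopf_coc M A \<and> hopf_coc M hopf_one \<and>
      hopf_hom M A hopf_one f"
    using A hopf_one_coc hopf_counit_hopf_hom[OF A] by blast
  have "h = hopf_unit A" if h: "hopf_hom M hopf_one A h" for h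
    using hopf_homD(1-3,6)[OF h] by (simp add: hopf_one_def)
  then show "\<exists>!F. \<exists>f. F = (hopf_one, f, A) \<and> hopf_coc M hopf_one \<and> hopf_coc M A \<and>
      hopf_hom M hopf_one A f"
    using A hopf_one_coc hopf_unit_hopf_hom[OF A] by blast
qed

text \<open>A zero arrow may factor through any zero object \<open>Z\<close>. The arrow into
  \<open>Z\<close> must be the trivial one by uniqueness, and the arrow out of \<open>Z\<close>
  preserves the unit.\<close>

lemma hopf_zero_arr_iff:
  assumes A: "hopf_coc M A" and B: "hopf_coc M B" and f: "hopf_hom M A B f"
  shows "is_zero_arr (Hopf_coc M) (A, f, B) \<longleftrightarrow> f = hopf_unit B \<cdot> hopf_counit A"
proof
  assume "is_zero_arr (Hopf_coc M) (A, f, B)"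
  then obtain Z F G where Z1: "zero_obj (Hopf_coc M) Z" and F: "F \<in> hset (Hopf_coc M) A Z"
      and G: "G \<in> hset (Hopf_coc M) Z B"
    and FG: "(A, f, B) = Comp (Hopf_coc M) G F"
    unfolding is_zero_arr_def Hopf_coc_simps by blast
  obtain s t where Z: "zero_obj (Hopf_coc M) Z" "hopf_coc M Z" and s: "hopf_hom M A Z s"
      and t: "hopf_hom M Z B t" and ft: "f = t \<cdot> s"
    using Z1 F G FG by (auto simp: Hopf_coc_simps Hopf_coc_hset)
  note [simp] = hopf_cocD[OF A] hopf_cocD[OF B] hopf_cocD[OF Z(2)] hopf_homD(1-3)[OF t]
  have "\<exists>!F. F \<in> hset (Hopf_coc M) A Z" using Z(1) A unfolding zero_obj_def
    by (simp add: Hopf_coc_simps)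
  moreover have "(A, s, Z) \<in> hset (Hopf_coc M) A Z" "(A, hopf_unit Z \<cdot> hopf_counit A,
      Z) \<in> hset (Hopf_coc M) A Z"
    using A Z(2) s trivial_hopf_hom[OF A Z(2)] by (simp_all add: Hopf_coc_hset)
  ultimately have "s = hopf_unit Z \<cdot> hopf_counit A" by blast
  then show "f = hopf_unit B \<cdot> hopf_counit A"
    using comp_tail[OF hopf_homD(6)[OF t], of "hopf_counit A"] by (simp add: ft)
next
  assume "f = hopf_unit B \<cdot> hopf_counit A"
  then have "(A, f, B) = Comp (Hopf_coc M) (hopf_one, hopf_unit B, B) (A, hopf_counit A, hopf_one)"
    by (simp add: Hopf_coc_simps)
  moreover have "(A, hopf_counit A, hopf_one) \<in> hset (Hopf_coc M) A hopf_one" "(hopf_one,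
      hopf_unit B, B) \<in> hset (Hopf_coc M) hopf_one B"
    using A B hopf_one_coc hopf_counit_hopf_hom[OF A] hopf_unit_hopf_hom[OF B]
      by (simp_all add: Hopf_coc_hset)
  ultimately show "is_zero_arr (Hopf_coc M) (A, f, B)"
    unfolding is_zero_arr_def Hopf_coc_simps(2-4) using A B f hopf_one_zero_obj by blast
qed

text \<open>The image of a coequalizer coequalizes the same pair, hence its inclusion splits.\<close>

lemma regular_epi_epi:
  assumes "regular_epi (Hopf_coc M) F"
  obtains A q B where "F = (A, q, B)" "hopf_coc M A" "hopf_coc M B" "hopf_hom M A B q" "epi_arr M q"
proof -
  obtain G H where GH: "is_coequalizer (Hopf_coc M) G H F" using assms
    by (auto simp: regular_epi_def)
  obtain R f A where G: "G = (R, f, A)" by (cases G)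
  obtain A' q B where F: "F = (A', q, B)" by (cases F)
  have H: "H \<in> hset (Hopf_coc M) R A" and "A' = A" using GH
    by (auto simp: is_coequalizer_def G F Hopf_coc_simps)
  then obtain g where H: "H = (R, g, A)" and g: "hopf_hom M R A g" by (auto simp: Hopf_coc_hset)
  have R: "hopf_coc M R" and A: "hopf_coc M A" and B: "hopf_coc M B" and f: "hopf_hom M R A f"
      and q: "hopf_hom M A B q"
    and qf: "q \<cdot> f = q \<cdot> g"
    using GH by (auto simp: is_coequalizer_def G F H Hopf_coc_simps \<open>A' = A\<close>)
  have U: "\<exists>!K. K \<in> hset (Hopf_coc M) B X \<and> Comp (Hopf_coc M) K F = (A, h, X)"
    if "hopf_coc M X" "hopf_hom M A X h" "h \<cdot> f = h \<cdot> g" for X h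
  proof -
    have "\<forall>x. \<forall>h \<in> hset (Hopf_coc M) (Cod (Hopf_coc M) G) x. Comp (Hopf_coc M) h G =
        Comp (Hopf_coc M) h H \<longrightarrow>
      (\<exists>!k. k \<in> hset (Hopf_coc M) (Cod (Hopf_coc M) F) x \<and> Comp (Hopf_coc M) k F = h)"
      using GH unfolding is_coequalizer_def by (elim conjE)
    moreover have "(A, h, X) \<in> hset (Hopf_coc M) (Cod (Hopf_coc M) G) X" using that A
      by (simp add: Hopf_coc_hset G Hopf_coc_simps)
    ultimately show ?thesis using that(3) by (simp add: G H F Hopf_coc_simps)
  qed
  obtain I e i where I: "hopf_coc M I" and e: "hopf_hom M A I e" and i: "hopf_hom M I B i"
      and ee: "epi_arr M e" and im: "mono_arr M i"
    and ie: "i \<cdot> e = q"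
    by (rule hopf_image[OF A B q])
  note [simp] = hopf_cocD[OF A] hopf_cocD[OF B] hopf_cocD[OF I] hopf_cocD[OF R] hopf_homD(1-3)[OF f]
      hopf_homD(1-3)[OF g]
    hopf_homD(1-3)[OF q] hopf_homD(1-3)[OF e] hopf_homD(1-3)[OF i]
  \<comment> \<open>Monicity of \<open>i\<close> transfers the equation from \<open>q\<close> to
    \<open>e\<close>, so that the universal property of \<open>q\<close> applies to
    \<open>e\<close>.\<close>
  have "e \<cdot> f = e \<cdot> g"
    by (rule mono_cancel[OF im]) (use qf comp_tail[OF ie, of f] comp_tail[OF ie, of g] in simp_all)
  from ex1_implies_ex[OF U[OF I e this]] obtain l where l: "hopf_hom M B I l" "l \<cdot> q = e"
    by (auto simp: Hopf_coc_hset F Hopf_coc_simps \<open>A' = A\<close>)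
  note [simp] = hopf_homD(1-3)[OF l(1)]
  \<comment> \<open>Both \<open>i \<cdot> l\<close> and the identity of \<open>B\<close> compose
    with \<open>q\<close> to \<open>q\<close>; uniqueness in the universal property identifies
    them.\<close>
  have "(B, i \<cdot> l, B) \<in> hset (Hopf_coc M) B B \<and> Comp (Hopf_coc M) (B, i \<cdot> l, B) F = (A, q, B)"
    using B hopf_hom_comp[OF B I B l(1) i]
      by (simp add: Hopf_coc_hset F Hopf_coc_simps \<open>A' = A\<close> l(2) ie)
  moreover have "(B, Id M (hopf_carrier B), B) \<in> hset (Hopf_coc M) B B \<and> Comp (Hopf_coc M) (B,
      Id M (hopf_carrier B), B) F = (A, q, B)"
    using B hopf_hom_Id[OF B] by (simp add: Hopf_coc_hset F Hopf_coc_simps \<open>A' = A\<close>)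
  ultimately have "(B, i \<cdot> l, B) = (B, Id M (hopf_carrier B), B)" using U[OF B q qf] by blast
  then have "epi_arr M i" by (intro split_epi[of i l]) simp_all
  then have "epi_arr M q" unfolding ie[symmetric] by (intro epi_comp ee) simp_all
  then show thesis by (intro that[of A q B] A B q) (simp_all add: F \<open>A' = A\<close>)
qed

lemma epi_some_cokernel:
  assumes FC: "faithful_coflatness M" and A: "hopf_coc M A" and B: "hopf_coc M B"
      and f: "hopf_hom M A B f" and fe: "epi_arr M f"
  shows "some_cokernel (Hopf_coc M) (A, f, B)"
proof -
  obtain K k where K: "hopf_coc M K" and k: "hopf_hom M K A k"
      and fk: "f \<cdot> k = hopf_unit B \<cdot> hopf_counit K"
    and U: "\<And>X h. hopf_coc M X \<Longrightarrow> hopf_hom M A X h \<Longrightarrow> h \<cdot> k = hopf_unit X \<cdot> hopf_counit K \<Longrightarrow>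
        \<exists>l. hopf_hom M B X l \<and> l \<cdot> f = h"
    by (rule epi_hopf_cokernel[OF FC A B f fe]) blast
  have "is_cokernel (Hopf_coc M) (K, k, A) (A, f, B)"
    unfolding is_cokernel_def Hopf_coc_simps
  proof (intro conjI allI ballI impI)
    show "is_zero_arr (Hopf_coc M) (K, f \<cdot> k, B)"
      using hopf_zero_arr_iff[OF K B hopf_hom_comp[OF K A B k f]] fk by simp
    fix X H assume H: "H \<in> hset (Hopf_coc M) A X"
        and z: "is_zero_arr (Hopf_coc M) (Comp (Hopf_coc M) H (K, k, A))"
    obtain h where h: "H = (A, h, X)" "hopf_hom M A X h" and X: "hopf_coc M X" using H
      by (auto simp: Hopf_coc_hset)
    have "h \<cdot> k = hopf_unit X \<cdot> hopf_counit K"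
      using hopf_zero_arr_iff[OF K X hopf_hom_comp[OF K A X k h(2)]] z
        by (simp add: h(1) Hopf_coc_simps)
    with U[OF X h(2)] obtain l where l: "hopf_hom M B X l" "l \<cdot> f = h" by blast
    show "\<exists>!L. L \<in> hset (Hopf_coc M) B X \<and> Comp (Hopf_coc M) L (A, f, B) = H"
    proof (rule ex1I[of _ "(B, l, X)"])
      show "(B, l, X) \<in> hset (Hopf_coc M) B X \<and> Comp (Hopf_coc M) (B, l, X) (A, f, B) = H"
        using l B X by (simp add: Hopf_coc_hset Hopf_coc_simps h(1))
      fix L assume "L \<in> hset (Hopf_coc M) B X \<and> Comp (Hopf_coc M) L (A, f, B) = H"
      then obtain l' where l': "L = (B, l', X)" "hopf_hom M B X l'" "l' \<cdot> f = h"
        by (auto simp: Hopf_coc_hset Hopf_coc_simps h(1))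
      have "l' = l"
        by (rule epi_cancel[OF fe]) (use hopf_homD(1-3)[OF l(1)] hopf_homD(1-3)[OF l'(2)]
            hopf_homD(1-3)[OF f] l l' in simp_all)
      then show "L = (B, l, X)" using l' by simp
    qed
  qed (use K A B k f in simp_all)
  then show ?thesis by (auto simp: some_cokernel_def)
qed

text \<open>A cokernel of \<open>k\<close> is a coequalizer of \<open>k\<close> and the trivial
  morphism \<open>?z\<close>, since any \<open>h\<close> sends \<open>?z\<close> to the trivial
  morphism again.\<close>

lemma cokernel_regular_epi:
  assumes "some_cokernel (Hopf_coc M) Q"
  shows "regular_epi (Hopf_coc M) Q"
proof -
  obtain F where F: "is_cokernel (Hopf_coc M) F Q" using assms by (auto simp: some_cokernel_def)
  obtain K k A where Fk: "F = (K, k, A)" by (cases F)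
  obtain A' q B where Q: "Q = (A', q, B)" by (cases Q)
  have [simp]: "A' = A" and K: "hopf_coc M K" and A: "hopf_coc M A" and B: "hopf_coc M B"
      and k: "hopf_hom M K A k" and q: "hopf_hom M A B q"
    using F by (auto simp: is_cokernel_def Fk Q Hopf_coc_simps)
  have z: "is_zero_arr (Hopf_coc M) (K, q \<cdot> k, B)" using F
    by (auto simp: is_cokernel_def Fk Q Hopf_coc_simps)
  let ?z = "hopf_unit A \<cdot> hopf_counit K"
  have t: "h \<cdot> ?z = hopf_unit X \<cdot> hopf_counit K" if X: "hopf_coc M X"
      and h: "hopf_hom M A X h" for X h
    using comp_tail[OF hopf_homD(6)[OF h],
        of "hopf_counit K"] hopf_cocD[OF A] hopf_cocD[OF K] hopf_cocD[OF X] hopf_homD(1-3)[OF h]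
      by simp
  have "is_coequalizer (Hopf_coc M) F (K, ?z, A) Q"
    unfolding is_coequalizer_def Fk Q Hopf_coc_simps
  proof (intro conjI allI ballI impI)
    show "(K, ?z, A) \<in> hset (Hopf_coc M) K A" using K A trivial_hopf_hom[OF K A]
      by (simp add: Hopf_coc_hset)
    show "(K, q \<cdot> k, B) = (K, q \<cdot> ?z, B)"
      using hopf_zero_arr_iff[OF K B hopf_hom_comp[OF K A B k q]] z t[OF B q] by simp
    fix X H assume H: "H \<in> hset (Hopf_coc M) A X"
        and eq: "Comp (Hopf_coc M) H (K, k, A) = Comp (Hopf_coc M) H (K, ?z, A)"
    obtain h where h: "H = (A, h, X)" "hopf_hom M A X h" and X: "hopf_coc M X" using H
      by (auto simp: Hopf_coc_hset)
    have "is_zero_arr (Hopf_coc M) (Comp (Hopf_coc M) H F)"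
      using hopf_zero_arr_iff[OF K X hopf_hom_comp[OF K A X k h(2)]] eq t[OF X h(2)]
        by (simp add: h(1) Fk Hopf_coc_simps)
    moreover have "\<forall>x. \<forall>h \<in> hset (Hopf_coc M) (Cod (Hopf_coc M) F) x. is_zero_arr (Hopf_coc M) (Comp
        (Hopf_coc M) h F) \<longrightarrow>
      (\<exists>!l. l \<in> hset (Hopf_coc M) (Cod (Hopf_coc M) Q) x \<and> Comp (Hopf_coc M) l Q = h)"
      using F unfolding is_cokernel_def by (elim conjE)
    ultimately show "\<exists>!l. l \<in> hset (Hopf_coc M) B X \<and> Comp (Hopf_coc M) l (A', q, B) = H"
      using H by (simp add: Fk Q Hopf_coc_simps)
  qed (use K A B k q in simp_all)
  then show ?thesis unfolding regular_epi_def by blast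
qed

lemma regular_epi_iff_cokernel:
  assumes "faithful_coflatness M"
  shows "regular_epi (Hopf_coc M) F \<longleftrightarrow> some_cokernel (Hopf_coc M) F"
  using regular_epi_epi[of F] epi_some_cokernel[OF assms] cokernel_regular_epi by metis

text \<open>The given pullback need not be the constructed one. A comparison \<open>l\<close> writes
  the epimorphism \<open>v\<close> as \<open>q \<cdot> l\<close>, and the left factor of an
  epimorphism is epic.\<close>

lemma regular_epi_stable:
  assumes FC: "faithful_coflatness M"
  shows "stable_under_pullbacks (Hopf_coc M) (regular_epi (Hopf_coc M))"
  unfolding stable_under_pullbacks_def
proof (intro allI impI, elim conjE)
  fix F G P Q assume "regular_epi (Hopf_coc M) F" and pb: "is_pullback (Hopf_coc M) F G P Q"
  then obtain A f B where F: "F = (A, f, B)" and A: "hopf_coc M A" and B: "hopf_coc M B"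
      and f: "hopf_hom M A B f" and fe: "epi_arr M f"
    by (metis regular_epi_epi)
  obtain V g B' where G: "G = (V, g, B')" by (cases G)
  obtain D p A' where P: "P = (D, p, A')" by (cases P)
  obtain D' q V' where Q: "Q = (D', q, V')" by (cases Q)
  have [simp]: "B' = B" "D' = D" "A' = A" "V' = V" and V: "hopf_coc M V" and g: "hopf_hom M V B g"
      and D: "hopf_coc M D" and q: "hopf_hom M D V q"
    using pb by (auto simp: is_pullback_def F G P Q Hopf_coc_simps)
  obtain E v a where E: "hopf_coc M E" and v: "hopf_hom M E V v" and a: "hopf_hom M E A a"
      and gv: "g \<cdot> v = f \<cdot> a" and ve: "epi_arr M v"
    by (rule pullback_epi[OF FC A B V f fe g])
  have "\<forall>x. \<forall>h \<in> hset (Hopf_coc M) x (Dom (Hopf_coc M) F). \<forall>k \<in> hset (Hopf_coc M) x (Dom (Hopf_coc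
      M) G).
      Comp (Hopf_coc M) F h = Comp (Hopf_coc M) G k \<longrightarrow>
      (\<exists>!l. l \<in> hset (Hopf_coc M) x (Dom (Hopf_coc M) P) \<and> Comp (Hopf_coc M) P l = h \<and>
          Comp (Hopf_coc M) Q l = k)"
    using pb unfolding is_pullback_def by (elim conjE)
  moreover have "(E, a, A) \<in> hset (Hopf_coc M) E (Dom (Hopf_coc M) F)" "(E, v,
      V) \<in> hset (Hopf_coc M) E (Dom (Hopf_coc M) G)"
    using E a v A V by (simp_all add: Hopf_coc_hset F G Hopf_coc_simps)
  moreover have "Comp (Hopf_coc M) F (E, a, A) = Comp (Hopf_coc M) G (E, v, V)" using gv
    by (simp add: F G Hopf_coc_simps)
  ultimately obtain L where "L \<in> hset (Hopf_coc M) E (Dom (Hopf_coc M) P)" "Comp (Hopf_coc M) Q L =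
      (E, v, V)" by blast
  then obtain l where l: "hopf_hom M E D l" "q \<cdot> l = v"
    by (auto simp: Hopf_coc_hset P Q Hopf_coc_simps)
  have "epi_arr M q"
    by (rule epi_left_factor[of q l]) (use ve hopf_homD(1-3)[OF l(1)] hopf_homD(1-3)[OF q] in
        \<open>simp_all add: l(2)\<close>)
  then show "regular_epi (Hopf_coc M) Q"
    using cokernel_regular_epi[OF epi_some_cokernel[OF FC D V q]] by (simp add: Q)
qed

end

theorem proposition7p22:
  fixes M :: "('o, 'm) smc"
  assumes "abelian_symmetric_monoidal_category M"
    and "faithful_coflatness M"
    and "faithful_flatness M"
  shows "(\<forall>f. regular_epi (Hopf_coc M) f \<longleftrightarrow> some_cokernel (Hopf_coc M) f) \<and>
    stable_under_pullbacks (Hopf_coc M) (regular_epi (Hopf_coc M))"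
proof -
  interpret abelian_symmetric_monoidal_category M by (rule assms(1))
  show ?thesis
    using regular_epi_iff_cokernel[OF assms(2)] regular_epi_stable[OF assms(2)] by blast
qed

end
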